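(* Let $\Psi=\{\psi_m\}_{m=1}^M\subset L^2(K)$ be such that for each $m\in\{1,2,\dots,M\}$ we have $|\widehat{\psi}_m|=\chi_{W_m}$ (the characteristic function of $W_m$), where $W_1,\dots,W_M$ are measurable subsets of $K$ and $W=\bigcup_{m=1}^M W_m$ is a disjoint union. Then $\Psi$ is a semi-orthogonal Parseval frame multiwavelet in $L^2(K)$ if and only if the following hold: (i) $\{\mathfrak p^{j}W: j\in\mathbb Z\}$ is a measurable partition of $K$; and (ii) for each $m\in\{1,2,\dots,M\}$, the system $\{W_m+u(k): k\in\mathbb N_0\}$ is a measurable partition of a subset of $K$.
   Context: Local field setup. $K$ is a local field of positive characteristic, i.e. a locally compact, non-discrete, totally disconnected field of characteristic $p>0$, with absolute value $|\cdot|$. $\mathcal O=\{x\in K:|x|\le 1\}$ is the ring of integers, $\mathfrak P=\{x\in K:|x|<1\}$ its maximal ideal, $\mathfrak p$ a fixed prime element ($\mathfrak P=\mathfrak p\mathcal O$), $\mathcal O^*=\mathcal O\setminus\mathfrak P$, and $\mathcal O/\mathfrak P\cong GF(q)$ with $q=p^c$; $|\mathfrak p|=q^{-1}$. $dx$ is the Haar measure on $(K,+)$ with $|\mathcal O|=1$, where $|E|$ denotes the Haar measure of a measurable set $E$. $\mathbb N_0=\mathbb N\cup\{0\}$. The elements $u(n)$, $n\in\mathbb N_0$: fix $\{1=\epsilon_0,\epsilon_1,\dots,\epsilon_{c-1}\}\subset\mathcal O^*$ whose images in $\mathcal O/\mathfrak P$ form a basis of $GF(q)$ over $GF(p)$.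 For $0\le n<q$ write $n=\sum_{k=0}^{c-1}a_kp^k$, $0\le a_k<p$, and set $u(n)=\big(\sum_{k=0}^{c-1}a_k\epsilon_k\big)\mathfrak p^{-1}$. For general $n=\sum_{k=0}^s b_kq^k$, $0\le b_k<q$, set $u(n)=\sum_{k=0}^s u(b_k)\mathfrak p^{-k}$. The set $\{u(n)\}_{n\in\mathbb N_0}$ is a complete list of distinct coset representatives of $\mathcal O$ in $(K,+)$. Character and Fourier transform: $\chi$ is a fixed character of $(K,+)$, trivial on $\mathcal O$ and nontrivial on $\mathfrak P^{-1}=\mathfrak p^{-1}\mathcal O$; $\chi_y(x)=\chi(yx)$; the setup is such that $\chi_{u(k)}(u(l))=1$ for all $k,l\in\mathbb N_0$. $\widehat f(\xi)=\int_K f(x)\overline{\chi_\xi(x)}\,dx$ for $f\in L^1(K)$, extended to $L^2(K)$. Operators on $L^2(K)$: $D^jf(x)=q^{j/2}f(\mathfrak p^{-j}x)$ for $j\in\mathbb Z$, and $T^kf(x)=f(x-u(k))$ for $k\in\mathbb N_0$. Definitions. A finite set $\Psi=\{\psi_1,\dots,\psi_M\}\subset L^2(K)$ is a Parseval frame multiwavelet (of order $M$) if $\|f\|^2=\sum_{m=1}^M\sum_{(j,k)\in\mathbb Z\times\mathbb N_0}|\langle f,D^jT^k\psi_m\rangle|^2$ for every $f\in L^2(K)$. It is semi-orthogonal if, with $\mathcal W=\overline{\mathrm{span}}\{T^k\psi:k\in\mathbb N_0,\psi\in\Psi\}$, one has $D^j\mathcal W\perp D^{j'}\mathcal W$ for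 all $j\ne j'$ in $\mathbb Z$. A countable indexed system of measurable sets is a measurable partition of a measurable set $E$ if sets with different indices intersect in a null set and the union equals $E$ up to a null set; it is a measurable partition of a subset of $K$ if this holds for some measurable $E\subset K$. *)

theory Defs
  imports "HOL-Analysis.Analysis" "HOL-Computational_Algebra.Primes"
begin

section \<open>Local fields of positive characteristic\<close>

text \<open>
  The library constant \<open>norm\<close> is constrained to real normed spaces, hence a separate \<open>absv\<close>. By
  \<open>dist_absv\<close> it induces the topology and vanishes only at \<open>0\<close>. Its normalisation is fixed in
  \<open>local_field_setup\<close> below. Positive characteristic comes from \<open>field_prime_char\<close>. Total
  disconnectedness already follows from the ultrametric inequality; it is kept because it belongs
  to the definition of a local field.
\<close>

class local_field = field_prime_char + metric_space +
  fixes absv :: "'a \<Rightarrow> real"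
  assumes dist_absv: "dist x y = absv (x - y)"
    and absv_mult: "absv (x * y) = absv x * absv y"
    and absv_add_le_max: "absv (x + y) \<le> max (absv x) (absv y)"
    and locally_compact_lf: "\<exists>U C. open U \<and> x \<in> U \<and> U \<subseteq> C \<and> compact C"
    and not_discrete_lf: "\<not> open {0}"
    and totally_disconnected_lf: "connected S \<Longrightarrow> x \<in> S \<Longrightarrow> y \<in> S \<Longrightarrow> x = y"

definition ring_of_integers :: "'a::local_field set" where
  "ring_of_integers = {x. absv x \<le> 1}"

definition maximal_ideal :: "'a::local_field set" where
  "maximal_ideal = {x. absv x < 1}"

definition haar_measure :: "'a::local_field measure \<Rightarrow> bool" where
  "haar_measure \<mu> \<longleftrightarrow>
     sets \<mu> = sets borel \<and>
     (\<forall>A\<in>sets \<mu>. \<forall>a. emeasure \<mu> ((\<lambda>x. a + x) ` A) = emeasure \<mu> A) \<and>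
     emeasure \<mu> ring_of_integers = 1"

text \<open>
  \<open>u_small\<close> is \<open>u(n)\<close> for \<open>n < q\<close>, where \<open>q = p ^ c\<close>. In \<open>u_elem\<close> the sum may run up to \<open>n\<close>,
  since the base-\<open>q\<close> digits of \<open>n\<close> beyond the leading one vanish and \<open>u_small\<close> maps \<open>0\<close> to \<open>0\<close>.
\<close>

definition u_small :: "'a::local_field \<Rightarrow> nat \<Rightarrow> (nat \<Rightarrow> 'a) \<Rightarrow> nat \<Rightarrow> 'a" where
  "u_small \<pp> c \<epsilon> n =
     (\<Sum>k<c. of_nat ((n div CHAR('a) ^ k) mod CHAR('a)) * \<epsilon> k) * inverse \<pp>"

definition u_elem :: "'a::local_field \<Rightarrow> nat \<Rightarrow> (nat \<Rightarrow> 'a) \<Rightarrow> nat \<Rightarrow> 'a" where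
  "u_elem \<pp> c \<epsilon> n =
     (let q = CHAR('a) ^ c
      in \<Sum>k\<le>n. u_small \<pp> c \<epsilon> ((n div q ^ k) mod q) * \<pp> powi (- int k))"

text \<open>
  The assumption \<open>residue_basis\<close> says that the images of \<open>\<epsilon> 0, \<dots>, \<epsilon> (c - 1)\<close> form a basis of the
  residue field over its prime field, whose elements are the images of \<open>0, \<dots>, p - 1\<close>.
\<close>

locale local_field_setup =
  fixes \<pp> :: "'a::local_field"
    and c q :: nat
    and \<epsilon> :: "nat \<Rightarrow> 'a"
    and \<mu> :: "'a measure"
    and chi :: "'a \<Rightarrow> complex"
  assumes prime_element: "maximal_ideal = (\<lambda>x. \<pp> * x) ` ring_of_integers"
    and c_pos: "0 < c"
    and q_eq: "q = CHAR('a) ^ c"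
    and card_residue_field:
      "card (ring_of_integers // {(x, y). x \<in> ring_of_integers \<and> y \<in> ring_of_integers \<and>
         x - y \<in> (maximal_ideal :: 'a set)}) = q"
    and absv_prime_element: "absv \<pp> = 1 / real q"
    and eps_0: "\<epsilon> 0 = 1"
    and eps_unit: "\<And>k. k < c \<Longrightarrow> \<epsilon> k \<in> ring_of_integers - maximal_ideal"
    and residue_basis:
      "\<And>x. x \<in> ring_of_integers \<Longrightarrow>
         \<exists>!a. a \<in> {..<c} \<rightarrow>\<^sub>E {..<CHAR('a)} \<and> x - (\<Sum>k<c. of_nat (a k) * \<epsilon> k) \<in> maximal_ideal"
    and haar: "haar_measure \<mu>"
    and chi_continuous: "continuous_on UNIV chi"
    and chi_norm: "\<And>x. cmod (chi x) = 1"
    and chi_add: "\<And>x y. chi (x + y) = chi x * chi y"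
    and chi_trivial: "\<And>x. x \<in> ring_of_integers \<Longrightarrow> chi x = 1"
    and chi_nontrivial: "\<exists>x \<in> (\<lambda>y. inverse \<pp> * y) ` ring_of_integers. chi x \<noteq> 1"
    and chi_u_u: "\<And>k l. chi (u_elem \<pp> c \<epsilon> k * u_elem \<pp> c \<epsilon> l) = 1"


section \<open>The space of square-integrable functions and the Fourier transform\<close>

text \<open>
  Elements of \<open>L\<^sup>2\<close> are represented by functions; everything below is invariant under changing them
  on null sets.
\<close>

definition L2 :: "'a measure \<Rightarrow> ('a \<Rightarrow> complex) set" where
  "L2 \<mu> = {f. f \<in> borel_measurable \<mu> \<and> integrable \<mu> (\<lambda>x. (cmod (f x))\<^sup>2)}"

definition L2_inner :: "'a measure \<Rightarrow> ('a \<Rightarrow> complex) \<Rightarrow> ('a \<Rightarrow> complex) \<Rightarrow> complex" where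
  "L2_inner \<mu> f g = (LINT x|\<mu>. f x * cnj (g x))"

definition L2_norm :: "'a measure \<Rightarrow> ('a \<Rightarrow> complex) \<Rightarrow> real" where
  "L2_norm \<mu> f = sqrt (LINT x|\<mu>. (cmod (f x))\<^sup>2)"

definition L2_lim :: "'a measure \<Rightarrow> (nat \<Rightarrow> 'a \<Rightarrow> complex) \<Rightarrow> ('a \<Rightarrow> complex) \<Rightarrow> bool" where
  "L2_lim \<mu> F f \<longleftrightarrow> (\<forall>n. F n \<in> L2 \<mu>) \<and> f \<in> L2 \<mu> \<and>
     (\<lambda>n. L2_norm \<mu> (\<lambda>x. F n x - f x)) \<longlonglongrightarrow> 0"

definition closed_span :: "'a measure \<Rightarrow> ('a \<Rightarrow> complex) set \<Rightarrow> ('a \<Rightarrow> complex) set" where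
  "closed_span \<mu> S =
     {f. \<exists>F. (\<forall>n. \<exists>B a. finite B \<and> B \<subseteq> S \<and> F n = (\<lambda>x. \<Sum>g\<in>B. a g * g x)) \<and> L2_lim \<mu> F f}"

definition fourier_L1 ::
  "'a::local_field measure \<Rightarrow> ('a \<Rightarrow> complex) \<Rightarrow> ('a \<Rightarrow> complex) \<Rightarrow> 'a \<Rightarrow> complex" where
  "fourier_L1 \<mu> chi f = (\<lambda>\<xi>. LINT x|\<mu>. f x * cnj (chi (\<xi> * x)))"

text \<open>
  The extension to \<open>L\<^sup>2\<close> by continuity from \<open>L\<^sup>1 \<inter> L\<^sup>2\<close>. By Plancherel's theorem the limit exists and
  is unique up to null sets; \<open>SOME\<close> picks a representative.
\<close>

definition fourier ::
  "'a::local_field measure \<Rightarrow> ('a \<Rightarrow> complex) \<Rightarrow> ('a \<Rightarrow> complex) \<Rightarrow> 'a \<Rightarrow> complex" where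
  "fourier \<mu> chi f =
     (SOME g. \<exists>F. (\<forall>n. integrable \<mu> (F n)) \<and> L2_lim \<mu> F f \<and>
        L2_lim \<mu> (\<lambda>n. fourier_L1 \<mu> chi (F n)) g)"


section \<open>Wavelets\<close>

definition dilation ::
  "'a::local_field \<Rightarrow> nat \<Rightarrow> int \<Rightarrow> ('a \<Rightarrow> complex) \<Rightarrow> 'a \<Rightarrow> complex" where
  "dilation \<pp> q j f =
     (\<lambda>x. complex_of_real (real q powr (real_of_int j / 2)) * f (\<pp> powi (- j) * x))"

definition translation ::
  "(nat \<Rightarrow> 'a::local_field) \<Rightarrow> nat \<Rightarrow> ('a \<Rightarrow> complex) \<Rightarrow> 'a \<Rightarrow> complex" where
  "translation u k f = (\<lambda>x. f (x - u k))"

definition parseval_frame_multiwavelet ::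
  "'a::local_field measure \<Rightarrow> 'a \<Rightarrow> nat \<Rightarrow> (nat \<Rightarrow> 'a) \<Rightarrow> nat \<Rightarrow> (nat \<Rightarrow> 'a \<Rightarrow> complex) \<Rightarrow> bool" where
  "parseval_frame_multiwavelet \<mu> \<pp> q u M \<psi> \<longleftrightarrow>
     (\<forall>m\<in>{1..M}. \<psi> m \<in> L2 \<mu>) \<and>
     (\<forall>f\<in>L2 \<mu>.
        ((\<lambda>(m, j, k). (cmod (L2_inner \<mu> f (dilation \<pp> q j (translation u k (\<psi> m)))))\<^sup>2)
           has_sum (L2_norm \<mu> f)\<^sup>2) ({1..M} \<times> (UNIV :: int set) \<times> (UNIV :: nat set)))"

definition semi_orthogonal ::
  "'a::local_field measure \<Rightarrow> 'a \<Rightarrow> nat \<Rightarrow> (nat \<Rightarrow> 'a) \<Rightarrow> nat \<Rightarrow> (nat \<Rightarrow> 'a \<Rightarrow> complex) \<Rightarrow> bool" where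
  "semi_orthogonal \<mu> \<pp> q u M \<psi> \<longleftrightarrow>
     (let \<W> = closed_span \<mu> {translation u k (\<psi> m) | k m. m \<in> {1..M}}
      in \<forall>j j'. j \<noteq> j' \<longrightarrow>
           (\<forall>f\<in>\<W>. \<forall>g\<in>\<W>. L2_inner \<mu> (dilation \<pp> q j f) (dilation \<pp> q j' g) = 0))"

definition measurable_partition :: "'a measure \<Rightarrow> 'i set \<Rightarrow> ('i \<Rightarrow> 'a set) \<Rightarrow> 'a set \<Rightarrow> bool" where
  "measurable_partition \<mu> I A E \<longleftrightarrow>
     countable I \<and> E \<in> sets \<mu> \<and> (\<forall>i\<in>I. A i \<in> sets \<mu>) \<and>
     (\<forall>i\<in>I. \<forall>j\<in>I. i \<noteq> j \<longrightarrow> A i \<inter> A j \<in> null_sets \<mu>) \<and>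
     sym_diff (\<Union>i\<in>I. A i) E \<in> null_sets \<mu>"

end

theory Submission
  imports Defs
begin

text \<open>
  Write \<open>\<psi>'\<close> for the Fourier transform of \<open>\<psi>\<close>. Dilation and translation act on the Fourier side as
  \<open>(D^j T^k \<psi>)'(\<xi>) = q^(-j/2) * cnj (chi (u k * \<pp>^j * \<xi>)) * \<psi>'(\<pp>^j * \<xi>)\<close>. By Plancherel's theorem the
  coefficients of \<open>f\<close> at scale \<open>j = 0\<close> are therefore, up to conjugation, the Fourier coefficients
  \<open>\<integral> \<psi>' * cnj f' * cnj (chi (u k * \<xi>)) d\<xi>\<close>. As \<open>chi (u k * u l) = 1\<close>, they do not change when
  \<open>g = \<psi>' * cnj f'\<close> is replaced by its periodization \<open>\<Sum>k. g (\<xi> + u k)\<close> on \<open>\<O>\<close>, and the characters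
  \<open>chi (u k * \<xi>)\<close> form an orthonormal basis of \<open>L2(\<O>)\<close>. The sum over \<open>k\<close> of the squared coefficients
  is thus the energy of the periodization over \<open>\<O>\<close> (\<open>parseval_periodization\<close>, \<open>sum_translates\<close>).

  Suppose that the translates \<open>W m + u k\<close> are disjoint up to null sets (\<open>packs\<close>). Then almost
  everywhere at most one term of the periodization is nonzero, and its energy is the integral of
  \<open>\<bar>f'\<bar>\<^sup>2\<close> over \<open>W m\<close>. Summing over all \<open>m\<close> and \<open>j\<close>, the Parseval identity becomes
  \<open>\<integral> \<bar>f'\<bar>\<^sup>2 * n = \<integral> \<bar>f'\<bar>\<^sup>2\<close>, where \<open>n \<xi>\<close> is the number of dilates of \<open>W\<close> that contain \<open>\<xi>\<close>. As \<open>f'\<close>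
  ranges over all of \<open>L2\<close>, this says \<open>n = 1\<close> almost everywhere: the dilates of \<open>W\<close> partition \<open>K\<close>
  (\<open>parseval_iff_dilates\<close>). In that case the dilates of the span of the translates have disjoint
  Fourier supports, so they are orthogonal (\<open>semi_orthogonalI\<close>).

  It remains to derive the disjointness of the translates from a semi-orthogonal Parseval frame
  (\<open>packs_if_parseval\<close>). In the Parseval identity for \<open>f = \<psi> m\<close> only the terms with \<open>j = 0\<close> and with
  the generator \<open>\<psi> m\<close> survive.
  It says that the number \<open>N\<close> of translates of \<open>W m\<close> that cover a point of \<open>\<O>\<close> satisfies
  \<open>\<integral> N\<^sup>2 = \<integral> N < \<infinity>\<close> over \<open>\<O>\<close>; since \<open>N\<close> is integer-valued, \<open>N \<le> 1\<close> almost everywhere.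

  Plancherel's theorem is obtained from finite Fourier analysis. A function that is supported in
  \<open>\<pp>^(-n) * \<O>\<close> and constant on cosets of \<open>\<pp>^n * \<O>\<close> is a function on a finite group. A locally integrable
  \<open>f\<close> and its transform, related by integrals over balls (\<open>fpair\<close>), have averages that are finite
  Fourier transforms of each other, so these averages have the same energy (\<open>fpair_energy\<close>). The
  energies increase to the squared \<open>L2\<close> norm (\<open>energy_bounded_imp_L2\<close>).
\<close>

section \<open>Square-integrable functions\<close>

lemma borel_measurable_cnj [measurable (raw)]:
  "f \<in> borel_measurable M \<Longrightarrow> (\<lambda>x. cnj (f x)) \<in> borel_measurable M"
  by (rule borel_measurable_continuous_on[where f = cnj]) (auto intro!: continuous_intros)

lemma L2_meas: "f \<in> L2 M \<Longrightarrow> f \<in> borel_measurable M"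
  and L2_int: "f \<in> L2 M \<Longrightarrow> integrable M (\<lambda>x. (cmod (f x))\<^sup>2)"
  by (auto simp: L2_def)

abbreviation esq :: "complex \<Rightarrow> ennreal" where
  "esq z \<equiv> ennreal ((cmod z)\<^sup>2)"

lemma L2_iff_nn:
  "f \<in> L2 M \<longleftrightarrow> f \<in> borel_measurable M \<and> (\<integral>\<^sup>+x. esq (f x) \<partial>M) < \<infinity>"
  by (auto simp: L2_def integrable_iff_bounded)

lemma L2_norm_nonneg [simp]: "0 \<le> L2_norm M f"
  by (simp add: L2_norm_def)

lemma L2_norm_sq: "(L2_norm M f)\<^sup>2 = (LINT x|M. (cmod (f x))\<^sup>2)"
  by (simp add: L2_norm_def)

lemma nn_eq_L2_norm:
  "f \<in> L2 M \<Longrightarrow> (\<integral>\<^sup>+x. esq (f x) \<partial>M) = ennreal ((L2_norm M f)\<^sup>2)"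
  by (simp add: L2_norm_sq nn_integral_eq_integral L2_int)

lemma L2_inner_self: "L2_inner M f f = complex_of_real ((L2_norm M f)\<^sup>2)"
  unfolding L2_inner_def L2_norm_sq
  by (subst integral_complex_of_real[symmetric]) (simp only: complex_norm_square)

lemma L2_abs_mult_integrable:
  assumes "f \<in> L2 M" "g \<in> L2 M"
  shows "integrable M (\<lambda>x. cmod (f x) * cmod (g x))"
proof (rule Bochner_Integration.integrable_bound)
  show "integrable M (\<lambda>x. (cmod (f x))\<^sup>2 + (cmod (g x))\<^sup>2)"
    using assms by (auto simp: L2_def)
  show "(\<lambda>x. cmod (f x) * cmod (g x)) \<in> borel_measurable M"
    using assms[THEN L2_meas] by measurable
  show "AE x in M. norm (cmod (f x) * cmod (g x)) \<le> norm ((cmod (f x))\<^sup>2 + (cmod (g x))\<^sup>2)"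
  proof (rule AE_I2)
    fix x
    have "0 \<le> (cmod (f x) - cmod (g x))\<^sup>2" by simp
    then have "2 * (cmod (f x) * cmod (g x)) \<le> (cmod (f x))\<^sup>2 + (cmod (g x))\<^sup>2"
      by (simp add: power2_diff)
    moreover have "0 \<le> cmod (f x) * cmod (g x)" by simp
    ultimately show "norm (cmod (f x) * cmod (g x)) \<le> norm ((cmod (f x))\<^sup>2 + (cmod (g x))\<^sup>2)"
      unfolding real_norm_def by linarith
  qed
qed

lemma L2_mult_integrable:
  assumes "f \<in> L2 M" "g \<in> L2 M"
  shows "integrable M (\<lambda>x. f x * g x)" "integrable M (\<lambda>x. f x * cnj (g x))"
  using assms[THEN L2_meas]
  by (auto intro!: Bochner_Integration.integrable_bound[OF L2_abs_mult_integrable[OF assms]]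
      simp: norm_mult)

lemma L2_cauchy_schwarz_abs:
  assumes "f \<in> L2 M" "g \<in> L2 M"
  shows "(LINT x|M. cmod (f x) * cmod (g x)) \<le> L2_norm M f * L2_norm M g"
proof -
  have [measurable]: "f \<in> borel_measurable M" "g \<in> borel_measurable M"
    using assms by (auto dest: L2_meas)
  let ?I = "LINT x|M. cmod (f x) * cmod (g x)"
  have I0: "0 \<le> ?I" by (intro Bochner_Integration.integral_nonneg) auto
  have "(\<integral>\<^sup>+x. ennreal (cmod (f x)) * ennreal (cmod (g x)) \<partial>M)\<^sup>2
      \<le> (\<integral>\<^sup>+x. (ennreal (cmod (f x)))\<^sup>2 \<partial>M) * (\<integral>\<^sup>+x. (ennreal (cmod (g x)))\<^sup>2 \<partial>M)"
    by (rule Cauchy_Schwarz_nn_integral) auto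
  also have "(\<integral>\<^sup>+x. ennreal (cmod (f x)) * ennreal (cmod (g x)) \<partial>M) = ennreal ?I"
    by (subst nn_integral_eq_integral[OF L2_abs_mult_integrable[OF assms], symmetric])
       (auto simp: ennreal_mult)
  also have "(\<integral>\<^sup>+x. (ennreal (cmod (f x)))\<^sup>2 \<partial>M) = ennreal ((L2_norm M f)\<^sup>2)"
    by (simp add: ennreal_power nn_eq_L2_norm assms)
  also have "(\<integral>\<^sup>+x. (ennreal (cmod (g x)))\<^sup>2 \<partial>M) = ennreal ((L2_norm M g)\<^sup>2)"
    by (simp add: ennreal_power nn_eq_L2_norm assms)
  finally have "ennreal (?I\<^sup>2) \<le> ennreal ((L2_norm M f * L2_norm M g)\<^sup>2)"
    by (simp add: ennreal_power I0 ennreal_mult[symmetric] power_mult_distrib)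
  then have "?I\<^sup>2 \<le> (L2_norm M f * L2_norm M g)\<^sup>2"
    by (simp add: ennreal_le_iff)
  then show ?thesis
    by (rule power2_le_imp_le) simp
qed

lemma L2_cauchy_schwarz:
  assumes "f \<in> L2 M" "g \<in> L2 M"
  shows "cmod (L2_inner M f g) \<le> L2_norm M f * L2_norm M g"
proof -
  have "cmod (L2_inner M f g) \<le> (LINT x|M. cmod (f x * cnj (g x)))"
    unfolding L2_inner_def by (rule integral_norm_bound)
  also have "\<dots> = (LINT x|M. cmod (f x) * cmod (g x))"
    by (simp add: norm_mult)
  finally show ?thesis
    using L2_cauchy_schwarz_abs[OF assms] by linarith
qed

lemma L2_scale: "f \<in> L2 M \<Longrightarrow> (\<lambda>x. c * f x) \<in> L2 M"
  by (auto simp: L2_def norm_mult power_mult_distrib)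

lemma L2_add:
  assumes "f \<in> L2 M" "g \<in> L2 M"
  shows "(\<lambda>x. f x + g x) \<in> L2 M"
proof -
  have [measurable]: "f \<in> borel_measurable M" "g \<in> borel_measurable M"
    using assms by (auto dest: L2_meas)
  have "integrable M (\<lambda>x. (cmod (f x))\<^sup>2 + 2 * (cmod (f x) * cmod (g x)) + (cmod (g x))\<^sup>2)"
    using assms L2_abs_mult_integrable[OF assms] by (auto simp: L2_def)
  then have "integrable M (\<lambda>x. (cmod (f x + g x))\<^sup>2)"
  proof (rule Bochner_Integration.integrable_bound)
    show "AE x in M. norm ((cmod (f x + g x))\<^sup>2)
      \<le> norm ((cmod (f x))\<^sup>2 + 2 * (cmod (f x) * cmod (g x)) + (cmod (g x))\<^sup>2)"
    proof (rule AE_I2)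
      fix x
      have "(cmod (f x + g x))\<^sup>2 \<le> (cmod (f x) + cmod (g x))\<^sup>2"
        by (intro power_mono norm_triangle_ineq) auto
      then show "norm ((cmod (f x + g x))\<^sup>2)
        \<le> norm ((cmod (f x))\<^sup>2 + 2 * (cmod (f x) * cmod (g x)) + (cmod (g x))\<^sup>2)"
        by (simp add: power2_sum)
    qed
  qed measurable
  then show ?thesis by (simp add: L2_def)
qed

lemma L2_diff:
  assumes "f \<in> L2 M" "g \<in> L2 M"
  shows "(\<lambda>x. f x - g x) \<in> L2 M"
  using L2_add[OF assms(1) L2_scale[OF assms(2), of "-1"]] by simp

lemma L2_zero: "(\<lambda>x. 0) \<in> L2 M"
  by (simp add: L2_def)

lemma L2_sum: "(\<And>i. i \<in> I \<Longrightarrow> f i \<in> L2 M) \<Longrightarrow> (\<lambda>x. \<Sum>i\<in>I. f i x) \<in> L2 M"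
  by (induction I rule: infinite_finite_induct) (auto simp: L2_zero intro!: L2_add)

lemma L2_cnj: "f \<in> L2 M \<Longrightarrow> (\<lambda>x. cnj (f x)) \<in> L2 M"
  by (auto simp: L2_def)

lemma L2_bounded_mult:
  assumes "f \<in> L2 M" and [measurable]: "h \<in> borel_measurable M" and b: "\<And>x. cmod (h x) \<le> 1"
  shows "(\<lambda>x. h x * f x) \<in> L2 M"
proof -
  have [measurable]: "f \<in> borel_measurable M"
    using assms by (auto dest: L2_meas)
  have "cmod (h x * f x) \<le> cmod (f x)" for x
    using mult_right_mono[OF b, of "cmod (f x)" x] by (simp add: norm_mult)
  then have "integrable M (\<lambda>x. (cmod (h x * f x))\<^sup>2)"
    by (intro Bochner_Integration.integrable_bound[OF L2_int[OF assms(1)]])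
       (auto intro!: power_mono)
  then show ?thesis by (simp add: L2_def)
qed

lemma L2_inner_add_left:
  "f \<in> L2 M \<Longrightarrow> f' \<in> L2 M \<Longrightarrow> g \<in> L2 M \<Longrightarrow>
    L2_inner M (\<lambda>x. f x + f' x) g = L2_inner M f g + L2_inner M f' g"
  by (simp add: L2_inner_def distrib_right L2_mult_integrable)

lemma L2_inner_diff_left:
  "f \<in> L2 M \<Longrightarrow> f' \<in> L2 M \<Longrightarrow> g \<in> L2 M \<Longrightarrow>
    L2_inner M (\<lambda>x. f x - f' x) g = L2_inner M f g - L2_inner M f' g"
  by (simp add: L2_inner_def left_diff_distrib L2_mult_integrable)

lemma L2_inner_commute: "L2_inner M g f = cnj (L2_inner M f g)"
  unfolding L2_inner_def by (subst Bochner_Integration.integral_cnj[symmetric]) (simp add: mult.commute)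

lemma L2_inner_add_right:
  "f \<in> L2 M \<Longrightarrow> f' \<in> L2 M \<Longrightarrow> g \<in> L2 M \<Longrightarrow>
    L2_inner M g (\<lambda>x. f x + f' x) = L2_inner M g f + L2_inner M g f'"
  by (simp add: L2_inner_def distrib_left L2_mult_integrable)

lemma L2_norm_add_sq:
  assumes "f \<in> L2 M" "g \<in> L2 M"
  shows "(L2_norm M (\<lambda>x. f x + g x))\<^sup>2 = (L2_norm M f)\<^sup>2 + 2 * Re (L2_inner M f g) + (L2_norm M g)\<^sup>2"
proof -
  have "complex_of_real ((L2_norm M (\<lambda>x. f x + g x))\<^sup>2)
      = L2_inner M (\<lambda>x. f x + g x) (\<lambda>x. f x + g x)"
    by (rule L2_inner_self[symmetric])
  also have "\<dots> = L2_inner M f f + (L2_inner M f g + cnj (L2_inner M f g)) + L2_inner M g g"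
    using assms
    by (simp add: L2_inner_add_left L2_inner_add_right L2_add L2_inner_commute[of M g f])
  also have "\<dots> = complex_of_real ((L2_norm M f)\<^sup>2 + 2 * Re (L2_inner M f g) + (L2_norm M g)\<^sup>2)"
    by (simp add: L2_inner_self complex_add_cnj)
  finally show ?thesis by (simp only: of_real_eq_iff)
qed

lemma L2_norm_scale: "L2_norm M (\<lambda>x. c * f x) = cmod c * L2_norm M f"
  by (simp add: L2_norm_def norm_mult power_mult_distrib real_sqrt_mult)

lemma L2_inner_scale_right: "L2_inner M f (\<lambda>x. c * g x) = cnj c * L2_inner M f g"
  unfolding L2_inner_def
  by (subst integral_mult_right_zero[symmetric]) (simp add: mult_ac)

lemma L2_norm_diff_sq:
  assumes "f \<in> L2 M" "g \<in> L2 M"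
  shows "(L2_norm M (\<lambda>x. f x - g x))\<^sup>2 = (L2_norm M f)\<^sup>2 - 2 * Re (L2_inner M f g) + (L2_norm M g)\<^sup>2"
  using L2_norm_add_sq[OF assms(1) L2_scale[OF assms(2), of "-1"]]
    L2_norm_scale[of M "-1" g] L2_inner_scale_right[of M f "-1" g] by simp

lemma L2_triangle:
  assumes "f \<in> L2 M" "g \<in> L2 M"
  shows "L2_norm M (\<lambda>x. f x + g x) \<le> L2_norm M f + L2_norm M g"
proof (rule power2_le_imp_le)
  have "Re (L2_inner M f g) \<le> L2_norm M f * L2_norm M g"
    using complex_Re_le_cmod L2_cauchy_schwarz[OF assms] by (rule order_trans)
  then show "(L2_norm M (\<lambda>x. f x + g x))\<^sup>2 \<le> (L2_norm M f + L2_norm M g)\<^sup>2"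
    by (simp add: L2_norm_add_sq[OF assms] power2_sum)
qed simp

lemma L2_norm_minus_commute: "L2_norm M (\<lambda>x. f x - g x) = L2_norm M (\<lambda>x. g x - f x)"
  by (simp add: L2_norm_def norm_minus_commute)

lemma L2_dist_triangle:
  assumes "f \<in> L2 M" "g \<in> L2 M" "h \<in> L2 M"
  shows "L2_norm M (\<lambda>x. f x - h x) \<le> L2_norm M (\<lambda>x. f x - g x) + L2_norm M (\<lambda>x. g x - h x)"
  using L2_triangle[OF L2_diff[OF assms(1,2)] L2_diff[OF assms(2,3)]] by simp

lemma L2_norm_diff_abs:
  assumes "f \<in> L2 M" "g \<in> L2 M"
  shows "\<bar>L2_norm M f - L2_norm M g\<bar> \<le> L2_norm M (\<lambda>x. f x - g x)"
  using L2_triangle[OF L2_diff[OF assms] assms(2)]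
    L2_triangle[OF L2_diff[OF assms(2,1)] assms(1)] L2_norm_minus_commute[of M f g]
  by simp

lemma L2_lim_norm:
  assumes "L2_lim M F f"
  shows "(\<lambda>n. L2_norm M (F n)) \<longlonglongrightarrow> L2_norm M f"
proof (rule LIM_zero_cancel, rule Lim_null_comparison)
  show "\<forall>\<^sub>F n in sequentially. norm (L2_norm M (F n) - L2_norm M f) \<le> L2_norm M (\<lambda>x. F n x - f x)"
    using assms by (auto simp: L2_lim_def intro!: always_eventually L2_norm_diff_abs)
  show "(\<lambda>n. L2_norm M (\<lambda>x. F n x - f x)) \<longlonglongrightarrow> 0"
    using assms by (simp add: L2_lim_def)
qed

lemma L2_lim_inner:
  assumes "L2_lim M F f" "g \<in> L2 M"
  shows "(\<lambda>n. L2_inner M (F n) g) \<longlonglongrightarrow> L2_inner M f g"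
proof (rule LIM_zero_cancel, rule Lim_null_comparison)
  have F: "\<And>n. F n \<in> L2 M" "f \<in> L2 M" using assms by (auto simp: L2_lim_def)
  show "\<forall>\<^sub>F n in sequentially. norm (L2_inner M (F n) g - L2_inner M f g)
      \<le> L2_norm M (\<lambda>x. F n x - f x) * L2_norm M g"
    by (rule always_eventually)
       (auto simp: L2_inner_diff_left[symmetric] F assms(2) intro!: L2_cauchy_schwarz L2_diff)
  have "(\<lambda>n. L2_norm M (\<lambda>x. F n x - f x)) \<longlonglongrightarrow> 0"
    using assms by (simp add: L2_lim_def)
  then show "(\<lambda>n. L2_norm M (\<lambda>x. F n x - f x) * L2_norm M g) \<longlonglongrightarrow> 0"
    by (rule tendsto_mult_left_zero)
qed

lemma L2_lim_Cauchy:
  assumes "L2_lim M F f" "0 < e"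
  shows "\<exists>N. \<forall>m\<ge>N. \<forall>n\<ge>N. L2_norm M (\<lambda>x. F m x - F n x) < e"
proof -
  have "\<forall>\<^sub>F n in sequentially. L2_norm M (\<lambda>x. F n x - f x) < e / 2"
    using assms by (auto simp: L2_lim_def intro!: order_tendstoD)
  then obtain N where N: "\<And>n. n \<ge> N \<Longrightarrow> L2_norm M (\<lambda>x. F n x - f x) < e / 2"
    by (auto simp: eventually_sequentially)
  have "L2_norm M (\<lambda>x. F m x - F n x) < e" if "m \<ge> N" "n \<ge> N" for m n
    using L2_dist_triangle[of "F m" M f "F n"] assms(1) N[OF that(1)] N[OF that(2)]
      L2_norm_minus_commute[of M f "F n"]
    by (auto simp: L2_lim_def)
  then show ?thesis by blast
qed

text \<open>
  Riesz and Fischer. Along a subsequence the increments \<open>d k\<close> have norms at most \<open>2 ^ (- k)\<close>, so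
  \<open>\<Sum>k. 2 ^ k * \<bar>d k\<bar>\<^sup>2\<close> has a finite integral. Where this sum is finite, \<open>d k\<close> decays geometrically,
  which gives convergence almost everywhere; Fatou's lemma does the rest.
\<close>

lemma L2_complete:
  assumes F: "\<And>n. F n \<in> L2 M"
    and Cauchy: "\<And>e. 0 < e \<Longrightarrow> \<exists>N. \<forall>m\<ge>N. \<forall>n\<ge>N. L2_norm M (\<lambda>x. F m x - F n x) < e"
  obtains f where "L2_lim M F f"
proof -
  have [measurable]: "\<And>n. F n \<in> borel_measurable M" using F by (auto dest: L2_meas)
  have "\<exists>N. \<forall>k. \<forall>m\<ge>N k. \<forall>n\<ge>N k. L2_norm M (\<lambda>x. F m x - F n x) < 1 / 2 ^ k"
    by (rule choice) (auto intro!: Cauchy)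
  then obtain N where N: "\<And>k m n. m \<ge> N k \<Longrightarrow> n \<ge> N k \<Longrightarrow> L2_norm M (\<lambda>x. F m x - F n x) < 1 / 2 ^ k"
    by blast
  \<comment> \<open>A nondecreasing choice of indices above \<open>N k\<close> that tends to infinity.\<close>
  define r where "r k = (\<Sum>i\<le>k. N i) + k" for k
  have rN: "r k \<ge> N k" for k
    unfolding r_def by (rule trans_le_add1) (rule member_le_sum, auto)
  have rm: "r k \<le> r (Suc k)" and rk: "r k \<ge> k" for k
    by (auto simp: r_def)
  define d where "d k x = F (r (Suc k)) x - F (r k) x" for k x
  have [measurable]: "\<And>k. d k \<in> borel_measurable M" unfolding d_def by measurable
  have dL: "d k \<in> L2 M" for k unfolding d_def by (intro L2_diff F)
  have dn: "L2_norm M (d k) \<le> 1 / 2 ^ k" for k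
    using N[of k "r (Suc k)" "r k"] rN[of k] rm[of k] unfolding d_def by simp
  have "(\<integral>\<^sup>+x. (\<Sum>k. ennreal (2 ^ k * (cmod (d k x))\<^sup>2)) \<partial>M)
      = (\<Sum>k. \<integral>\<^sup>+x. ennreal (2 ^ k * (cmod (d k x))\<^sup>2) \<partial>M)"
    by (rule nn_integral_suminf) measurable
  also have "\<dots> = (\<Sum>k. ennreal (2 ^ k * (L2_norm M (d k))\<^sup>2))"
    by (simp add: ennreal_mult nn_integral_cmult nn_eq_L2_norm[OF dL])
  also have "\<dots> \<le> (\<Sum>k. ennreal ((1 / 2) ^ k))"
  proof (intro suminf_le ennreal_leI)
    fix k :: nat
    have "(L2_norm M (d k))\<^sup>2 \<le> (1 / 2 ^ k)\<^sup>2" by (intro power_mono dn) simp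
    then have "2 ^ k * (L2_norm M (d k))\<^sup>2 \<le> 2 ^ k * (1 / 2 ^ k)\<^sup>2" by simp
    then show "2 ^ k * (L2_norm M (d k))\<^sup>2 \<le> (1 / 2) ^ k"
      by (simp add: power2_eq_square field_simps)
  qed auto
  also have "\<dots> < \<infinity>"
    by (subst suminf_ennreal2) (auto simp: less_top[symmetric])
  finally have "AE x in M. (\<Sum>k. ennreal (2 ^ k * (cmod (d k x))\<^sup>2)) \<noteq> \<infinity>"
    by (intro nn_integral_PInf_AE) auto
  then have conv: "AE x in M. convergent (\<lambda>k. F (r k) x)"
  proof eventually_elim
    fix x
    assume fin: "(\<Sum>k. ennreal (2 ^ k * (cmod (d k x))\<^sup>2)) \<noteq> \<infinity>"
    define S where "S = enn2real (\<Sum>k. ennreal (2 ^ k * (cmod (d k x))\<^sup>2))"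
    have S0: "0 \<le> S" by (simp add: S_def)
    have bound: "2 ^ k * (cmod (d k x))\<^sup>2 \<le> S" for k
    proof -
      have "ennreal (2 ^ k * (cmod (d k x))\<^sup>2) = (\<Sum>i\<in>{k}. ennreal (2 ^ i * (cmod (d i x))\<^sup>2))"
        by simp
      also have "\<dots> \<le> (\<Sum>i. ennreal (2 ^ i * (cmod (d i x))\<^sup>2))"
        by (rule sum_le_suminf) auto
      also have "\<dots> = ennreal S"
        using fin by (simp add: S_def ennreal_enn2real less_top)
      finally show ?thesis using S0 by (simp add: ennreal_le_iff)
    qed
    have "summable (\<lambda>k. d k x)"
    proof (rule summable_comparison_test')
      show "summable (\<lambda>k. sqrt S * (1 / sqrt 2) ^ k)"
        by (intro summable_mult summable_geometric) auto
      fix k :: nat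
      have "cmod (d k x) = sqrt ((cmod (d k x))\<^sup>2)" by simp
      also have "\<dots> \<le> sqrt (S / 2 ^ k)"
        using bound[of k] by (intro real_sqrt_le_mono) (simp add: field_simps)
      also have "\<dots> = sqrt S * (1 / sqrt 2) ^ k"
        by (simp add: real_sqrt_divide power_divide real_sqrt_power)
      finally show "norm (d k x) \<le> sqrt S * (1 / sqrt 2) ^ k" .
    qed
    then have "convergent (\<lambda>n. \<Sum>k<n. d k x)"
      by (simp add: summable_iff_convergent)
    moreover have "(\<lambda>n. \<Sum>k<n. d k x) = (\<lambda>n. F (r n) x - F (r 0) x)"
      unfolding d_def by (rule ext) (rule sum_lessThan_telescope)
    ultimately have "convergent (\<lambda>n. F (r n) x - F (r 0) x)" by simp
    from convergent_add[OF this convergent_const[of "F (r 0) x"]]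
    show "convergent (\<lambda>k. F (r k) x)" by simp
  qed
  define f where "f x = lim (\<lambda>k. F (r k) x)" for x
  have [measurable]: "f \<in> borel_measurable M" unfolding f_def by measurable
  have lim: "AE x in M. (\<lambda>k. F (r k) x) \<longlonglongrightarrow> f x"
    using conv by eventually_elim (simp add: f_def convergent_LIMSEQ_iff)
  have close: "(\<integral>\<^sup>+x. esq (f x - F n x) \<partial>M) \<le> ennreal (e\<^sup>2)"
    if n: "n \<ge> n0" and n0: "\<And>m n. m \<ge> n0 \<Longrightarrow> n \<ge> n0 \<Longrightarrow> L2_norm M (\<lambda>x. F m x - F n x) < e" for n n0 e
  proof -
    have "(\<integral>\<^sup>+x. esq (f x - F n x) \<partial>M)
        = (\<integral>\<^sup>+x. liminf (\<lambda>k. esq (F (r k) x - F n x)) \<partial>M)"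
    proof (rule nn_integral_cong_AE, use lim in eventually_elim)
      fix x assume "(\<lambda>k. F (r k) x) \<longlonglongrightarrow> f x"
      then have "(\<lambda>k. esq (F (r k) x - F n x)) \<longlonglongrightarrow> esq (f x - F n x)"
        by (intro tendsto_intros)
      then show "esq (f x - F n x) = liminf (\<lambda>k. esq (F (r k) x - F n x))"
        by (intro lim_imp_Liminf[symmetric]) auto
    qed
    also have "\<dots> \<le> liminf (\<lambda>k. \<integral>\<^sup>+x. esq (F (r k) x - F n x) \<partial>M)"
      by (rule nn_integral_liminf) measurable
    also have "\<dots> \<le> limsup (\<lambda>k. \<integral>\<^sup>+x. esq (F (r k) x - F n x) \<partial>M)"
      by (rule Liminf_le_Limsup) simp
    also have "\<dots> \<le> ennreal (e\<^sup>2)"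
    proof (rule Limsup_bounded, rule eventually_sequentiallyI)
      fix k assume "n0 \<le> k"
      then have "n0 \<le> r k" using rk[of k] by simp
      then have "L2_norm M (\<lambda>x. F (r k) x - F n x) \<le> e" using n0[of "r k" n] n by simp
      then show "(\<integral>\<^sup>+x. esq (F (r k) x - F n x) \<partial>M) \<le> ennreal (e\<^sup>2)"
        by (subst nn_eq_L2_norm[OF L2_diff[OF F F]]) (auto intro!: ennreal_leI power_mono)
    qed
    finally show ?thesis .
  qed
  have fL: "f \<in> L2 M"
  proof -
    obtain n0 where n0: "\<And>m n. m \<ge> n0 \<Longrightarrow> n \<ge> n0 \<Longrightarrow> L2_norm M (\<lambda>x. F m x - F n x) < 1"
      using Cauchy[of 1] by auto
    have "(\<integral>\<^sup>+x. esq (f x - F n0 x) \<partial>M) \<le> ennreal (1\<^sup>2)"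
      by (rule close[OF order_refl n0])
    then have "(\<lambda>x. f x - F n0 x) \<in> L2 M"
      by (auto simp: L2_iff_nn intro: order_le_less_trans)
    from L2_add[OF this F[of n0]] show ?thesis by simp
  qed
  have "(\<lambda>n. L2_norm M (\<lambda>x. F n x - f x)) \<longlonglongrightarrow> 0"
  proof (rule LIMSEQ_I)
    fix e :: real assume e: "0 < e"
    then obtain n0 where n0: "\<And>m n. m \<ge> n0 \<Longrightarrow> n \<ge> n0 \<Longrightarrow> L2_norm M (\<lambda>x. F m x - F n x) < e / 2"
      using Cauchy[of "e / 2"] by auto
    have "norm (L2_norm M (\<lambda>x. F n x - f x) - 0) < e" if "n \<ge> n0" for n
    proof -
      have "ennreal ((L2_norm M (\<lambda>x. f x - F n x))\<^sup>2) \<le> ennreal ((e / 2)\<^sup>2)"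
        using close[OF that n0] nn_eq_L2_norm[OF L2_diff[OF fL F[of n]]] by simp
      then have "(L2_norm M (\<lambda>x. f x - F n x))\<^sup>2 \<le> (e / 2)\<^sup>2"
        by (simp add: ennreal_le_iff)
      then have "L2_norm M (\<lambda>x. f x - F n x) \<le> e / 2"
        by (rule power2_le_imp_le) (use e in simp)
      then show ?thesis using e by (simp add: L2_norm_minus_commute[of M f])
    qed
    then show "\<exists>no. \<forall>n\<ge>no. norm (L2_norm M (\<lambda>x. F n x - f x) - 0) < e" by blast
  qed
  with F fL have "L2_lim M F f" by (simp add: L2_lim_def)
  then show ?thesis by (rule that)
qed

lemma L2_inner_polarization:
  assumes "f \<in> L2 M" "g \<in> L2 M" "f' \<in> L2 M" "g' \<in> L2 M"
    and "\<And>c. L2_norm M (\<lambda>x. f x + c * g x) = L2_norm M (\<lambda>x. f' x + c * g' x)"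
    and "L2_norm M f = L2_norm M f'" "L2_norm M g = L2_norm M g'"
  shows "L2_inner M f g = L2_inner M f' g'"
proof -
  have "Re (L2_inner M f (\<lambda>x. c * g x)) = Re (L2_inner M f' (\<lambda>x. c * g' x))" for c
    using L2_norm_add_sq[OF assms(1) L2_scale[OF assms(2), of c]]
      L2_norm_add_sq[OF assms(3) L2_scale[OF assms(4), of c]] assms(5)[of c] assms(6,7)
    by (simp add: L2_norm_scale)
  from this[of 1] this[of \<i>] show ?thesis
    by (simp add: L2_inner_scale_right complex_eq_iff)
qed

lemma L2_cong_AE:
  assumes "f \<in> L2 M" "g \<in> borel_measurable M" "AE x in M. f x = g x"
  shows "g \<in> L2 M"
proof -
  have "(\<integral>\<^sup>+x. esq (g x) \<partial>M) = (\<integral>\<^sup>+x. esq (f x) \<partial>M)"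
    by (rule nn_integral_cong_AE) (use assms(3) in \<open>eventually_elim, simp\<close>)
  then show ?thesis using assms(1,2) by (simp add: L2_iff_nn)
qed

lemma L2_norm_cong_AE:
  assumes "f \<in> borel_measurable M" "g \<in> borel_measurable M" "AE x in M. f x = g x"
  shows "L2_norm M f = L2_norm M g"
proof -
  have "AE x in M. (cmod (f x))\<^sup>2 = (cmod (g x))\<^sup>2"
    using assms(3) by eventually_elim simp
  with assms(1,2) have "(LINT x|M. (cmod (f x))\<^sup>2) = (LINT x|M. (cmod (g x))\<^sup>2)"
    by (intro integral_cong_AE) auto
  then show ?thesis by (simp add: L2_norm_def)
qed

lemma L2_inner_sum_right:
  assumes "g \<in> L2 M" "\<And>i. i \<in> I \<Longrightarrow> f i \<in> L2 M"
  shows "L2_inner M g (\<lambda>x. \<Sum>i\<in>I. f i x) = (\<Sum>i\<in>I. L2_inner M g (f i))"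
  unfolding L2_inner_def cnj_sum sum_distrib_left
  by (rule Bochner_Integration.integral_sum) (use assms in \<open>auto intro!: L2_mult_integrable(2)\<close>)

section \<open>Sums of nonnegative terms as integrals\<close>

lemma has_sum_nonneg_iff_nn_integral:
  fixes f :: "'b \<Rightarrow> real"
  assumes f: "\<And>x. x \<in> A \<Longrightarrow> 0 \<le> f x" and s: "0 \<le> s"
  shows "(f has_sum s) A \<longleftrightarrow> (\<integral>\<^sup>+x. ennreal (f x) \<partial>count_space A) = ennreal s"
proof -
  have eq: "(\<integral>\<^sup>+x. ennreal (f x) \<partial>count_space A) = ennreal (infsum f A)"
    and fin: "0 \<le> infsum f A" if "f summable_on A"
  proof -
    have "Infinite_Set_Sum.abs_summable_on f A"
      using that summable_on_iff_abs_summable_on_real[of f A] abs_summable_equivalent[of f A] by blast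
    then have "integrable (count_space A) f" "infsum f A = (LINT x|count_space A. f x)"
      using infsetsum_infsum[of f A] by (simp_all add: Infinite_Set_Sum.abs_summable_on_def infsetsum_def)
    then show "(\<integral>\<^sup>+x. ennreal (f x) \<partial>count_space A) = ennreal (infsum f A)"
      by (simp add: nn_integral_eq_integral f AE_count_space)
    show "0 \<le> infsum f A" by (rule infsum_nonneg) (rule f)
  qed
  have summ: "f summable_on A" if "(\<integral>\<^sup>+x. ennreal (f x) \<partial>count_space A) = ennreal s"
  proof -
    have "(\<integral>\<^sup>+x. ennreal (norm (f x)) \<partial>count_space A) = (\<integral>\<^sup>+x. ennreal (f x) \<partial>count_space A)"
      by (rule nn_integral_cong) (use f in simp)
    then have "integrable (count_space A) f"
      by (simp add: integrable_iff_bounded that)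
    then show ?thesis
      using summable_on_iff_abs_summable_on_real[of f A] abs_summable_equivalent[of f A]
      unfolding Infinite_Set_Sum.abs_summable_on_def by blast
  qed
  show ?thesis
  proof
    assume *: "(f has_sum s) A"
    then show "(\<integral>\<^sup>+x. ennreal (f x) \<partial>count_space A) = ennreal s"
      using eq[OF has_sum_imp_summable[OF *]] infsumI[OF *] by simp
  next
    assume *: "(\<integral>\<^sup>+x. ennreal (f x) \<partial>count_space A) = ennreal s"
    then have "infsum f A = s" using eq[OF summ[OF *]] fin[OF summ[OF *]] s by simp
    then show "(f has_sum s) A" using has_sum_infsum[OF summ[OF *]] by simp
  qed
qed

lemma nn_integral_count_space_triple:
  fixes F :: "'b \<times> 'c \<times> nat \<Rightarrow> ennreal"
  assumes "finite I"
  shows "(\<integral>\<^sup>+z. F z \<partial>count_space (I \<times> UNIV \<times> UNIV))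
    = (\<Sum>m\<in>I. \<integral>\<^sup>+j. (\<Sum>k. F (m, j, k)) \<partial>count_space UNIV)"
proof -
  let ?G = "\<lambda>z. F z * indicator (I \<times> UNIV \<times> UNIV) z"
  have "(\<integral>\<^sup>+z. F z \<partial>count_space (I \<times> UNIV \<times> UNIV)) = (\<integral>\<^sup>+z. ?G z \<partial>count_space UNIV)"
    by (simp add: nn_integral_count_space_indicator)
  also have "\<dots> = (\<integral>\<^sup>+m. \<integral>\<^sup>+y. ?G (m, y) \<partial>count_space UNIV \<partial>count_space UNIV)"
    by (rule nn_integral_fst_count_space[symmetric])
  also have "\<dots> = (\<integral>\<^sup>+m. (\<integral>\<^sup>+j. \<integral>\<^sup>+k. ?G (m, j, k) \<partial>count_space UNIV \<partial>count_space UNIV) \<partial>count_space UNIV)"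
    by (intro nn_integral_cong nn_integral_fst_count_space[symmetric])
  also have "\<dots> = (\<Sum>m\<in>I. \<integral>\<^sup>+j. \<integral>\<^sup>+k. ?G (m, j, k) \<partial>count_space UNIV \<partial>count_space UNIV)"
    by (rule nn_integral_count_space') (use assms in auto)
  also have "\<dots> = (\<Sum>m\<in>I. \<integral>\<^sup>+j. (\<Sum>k. F (m, j, k)) \<partial>count_space UNIV)"
    by (intro sum.cong refl nn_integral_cong) (simp add: nn_integral_count_space_nat)
  finally show ?thesis .
qed

section \<open>Measurable partitions\<close>

lemma measurable_partition_iff_AE:
  fixes A :: "'i :: countable \<Rightarrow> 'b set"
  assumes A: "\<And>i. A i \<in> sets M" and E: "E \<in> sets M"
  shows "measurable_partition M UNIV A E \<longleftrightarrow>
    (AE x in M. (\<forall>i j. x \<in> A i \<longrightarrow> x \<in> A j \<longrightarrow> i = j) \<and> ((\<exists>i. x \<in> A i) \<longleftrightarrow> x \<in> E))"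
proof -
  have null: "N \<in> null_sets M \<longleftrightarrow> (AE x in M. x \<notin> N)" if "N \<in> sets M" for N
    by (rule AE_iff_null_sets[OF that])
  have "A i \<inter> A j \<in> sets M" for i j using A by blast
  then have 1: "(\<forall>i j. i \<noteq> j \<longrightarrow> A i \<inter> A j \<in> null_sets M)
      \<longleftrightarrow> (AE x in M. \<forall>i j. i \<noteq> j \<longrightarrow> x \<notin> A i \<inter> A j)"
    unfolding AE_all_countable by (simp only: null) simp
  have "sym_diff (\<Union>i. A i) E \<in> sets M" using A E by (intro sets.Un sets.Diff sets.countable_UN) auto
  note 2 = null[OF this]
  have "measurable_partition M UNIV A E \<longleftrightarrow>
      (AE x in M. \<forall>i j. i \<noteq> j \<longrightarrow> x \<notin> A i \<inter> A j) \<and> (AE x in M. x \<notin> sym_diff (\<Union>i. A i) E)"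
    unfolding measurable_partition_def 1[symmetric] 2[symmetric] using A E by simp
  also have "\<dots> \<longleftrightarrow>
      (AE x in M. (\<forall>i j. x \<in> A i \<longrightarrow> x \<in> A j \<longrightarrow> i = j) \<and> ((\<exists>i. x \<in> A i) \<longleftrightarrow> x \<in> E))"
    unfolding AE_conj_iff[symmetric] by (rule arg_cong[where f = "almost_everywhere M"]) auto
  finally show ?thesis .
qed

section \<open>The absolute value\<close>

lemma absv_eq_0_iff [simp]: "absv x = 0 \<longleftrightarrow> x = (0 :: 'a::local_field)"
  using dist_absv[of x 0] dist_eq_0_iff[of x 0] by simp

lemma absv_zero [simp]: "absv (0 :: 'a::local_field) = 0"
  by simp

lemma absv_nonneg [simp]: "0 \<le> absv (x :: 'a::local_field)"
  using dist_absv[of x 0] zero_le_dist[of x 0] by simp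

lemma absv_pos_iff [simp]: "0 < absv x \<longleftrightarrow> x \<noteq> (0 :: 'a::local_field)"
  using absv_nonneg[of x] absv_eq_0_iff[of x] by linarith

lemma absv_one [simp]: "absv (1 :: 'a::local_field) = 1"
  using absv_mult[of 1 "1 :: 'a"] by simp

lemma absv_minus [simp]: "absv (- x) = absv (x :: 'a::local_field)"
  using dist_absv[of x 0] dist_absv[of 0 x] by (simp add: dist_commute)

lemma absv_minus_commute: "absv (x - y) = absv (y - x :: 'a::local_field)"
  using absv_minus[of "x - y"] by simp

lemma absv_inverse [simp]: "absv (inverse x) = inverse (absv (x :: 'a::local_field))"
proof (cases "x = 0")
  case False
  then have "absv x * absv (inverse x) = 1" by (simp add: absv_mult[symmetric])
  with False show ?thesis by (simp add: field_simps)
qed simp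

lemma absv_power [simp]: "absv (x ^ n) = absv (x :: 'a::local_field) ^ n"
  by (induction n) (auto simp: absv_mult)

lemma absv_powi [simp]: "absv (x powi j) = absv (x :: 'a::local_field) powi j"
  by (auto simp: power_int_def)

lemma absv_add_le: "absv x \<le> r \<Longrightarrow> absv y \<le> r \<Longrightarrow> absv (x + y :: 'a::local_field) \<le> r"
  using absv_add_le_max[of x y] by simp

lemma absv_diff_le: "absv x \<le> r \<Longrightarrow> absv y \<le> r \<Longrightarrow> absv (x - y :: 'a::local_field) \<le> r"
  using absv_add_le[of x r "- y"] by simp

lemma absv_sum_le:
  "0 \<le> r \<Longrightarrow> (\<And>i. i \<in> I \<Longrightarrow> absv (f i) \<le> r) \<Longrightarrow> absv (\<Sum>i\<in>I. f i :: 'a::local_field) \<le> r"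
  by (induction I rule: infinite_finite_induct) (auto intro!: absv_add_le)

lemma absv_of_nat_le_1: "absv (of_nat n :: 'a::local_field) \<le> 1"
  by (induction n) (auto intro!: absv_add_le)

lemma continuous_on_lf_add: "continuous_on S (\<lambda>x :: 'a::local_field. x + a)"
  by (rule lipschitz_on_continuous_on[of 1])
     (simp add: lipschitz_on_def dist_absv)

lemma continuous_on_lf_mult: "continuous_on S (\<lambda>x :: 'a::local_field. a * x)"
  by (rule lipschitz_on_continuous_on[of "absv a"])
     (simp add: lipschitz_on_def dist_absv right_diff_distrib[symmetric] absv_mult)

section \<open>Digits in base b\<close>

lemma digit_of_sum_high:
  fixes b k N d n :: nat
  assumes "k < N"
  shows "((n + d * b ^ N) div b ^ k) mod b = (n div b ^ k) mod b"
proof (cases "b = 0")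
  case False
  have "b ^ N = b ^ k * (b * b ^ (N - Suc k))"
    using assms by (simp flip: power_Suc power_add)
  then have "n + d * b ^ N = n + (b * (d * b ^ (N - Suc k))) * b ^ k"
    by (simp add: mult_ac)
  then have "(n + d * b ^ N) div b ^ k = b * (d * b ^ (N - Suc k)) + n div b ^ k"
    using False by (simp only: div_mult_self1 power_not_zero not_False_eq_True)
  then show ?thesis by simp
next
  case True
  with assms show ?thesis by (cases N) auto
qed

lemma digits_exist:
  assumes "\<And>i. i < N \<Longrightarrow> a i < (b::nat)"
  shows "\<exists>d < b ^ N. \<forall>i<N. (d div b ^ i) mod b = a i"
  using assms
proof (induction N)
  case (Suc N)
  then obtain d where d: "d < b ^ N" "\<forall>i<N. (d div b ^ i) mod b = a i" by auto
  have aN: "a N < b" using Suc.prems by simp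
  have "d + a N * b ^ N < b ^ N + a N * b ^ N" using d by simp
  also have "\<dots> = (1 + a N) * b ^ N" by simp
  also have "\<dots> \<le> b * b ^ N" using aN by (intro mult_right_mono) auto
  finally have "d + a N * b ^ N < b ^ Suc N" by simp
  moreover have "((d + a N * b ^ N) div b ^ i) mod b = a i" if "i < Suc N" for i
  proof (cases "i = N")
    case True
    have "0 < b ^ N" using d(1) by linarith
    then show ?thesis using True d aN by simp
  next
    case False
    then show ?thesis using that d by (simp add: digit_of_sum_high)
  qed
  ultimately show ?case by blast
qed simp

context local_field_setup
begin

section \<open>Balls\<close>

abbreviation u :: "nat \<Rightarrow> 'a" where "u \<equiv> u_elem \<pp> c \<epsilon>"

definition pball :: "'a \<Rightarrow> int \<Rightarrow> 'a set" where
  "pball a n = {x. absv (x - a) \<le> real q powi (- n)}"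

abbreviation qpow :: "int \<Rightarrow> complex" where
  "qpow n \<equiv> complex_of_real (real q powi n)"

lemma char_ge_2: "2 \<le> CHAR('a)"
  using prime_CHAR_semidom[where ?'a = 'a] by (simp add: prime_ge_2_nat)

lemma q_ge_2: "2 \<le> q"
proof -
  have "CHAR('a) ^ 1 \<le> CHAR('a) ^ c"
    using c_pos char_ge_2 by (intro power_increasing) auto
  then show ?thesis using char_ge_2 by (simp add: q_eq)
qed

lemma q_simps [simp]:
  "1 < real q" "0 < real q" "0 < q" "q \<noteq> 0" "1 < q" "Suc 0 < q" "Suc 0 \<le> q" "1 \<le> q"
  "inverse (real q) < 1" "1 / real q < 1"
  using q_ge_2 by (auto simp: field_simps)

lemma pp_nonzero [simp]: "\<pp> \<noteq> 0"
proof
  assume "\<pp> = 0"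
  then have "1 / real q = 0" using absv_prime_element by simp
  then show False using q_ge_2 by simp
qed

lemma absv_pp_powi: "absv (\<pp> powi j) = real q powi (- j)"
  by (simp add: absv_prime_element power_int_minus divide_inverse power_int_inverse)

lemma pp_powi_cancel [simp]:
  "\<pp> powi j * (\<pp> powi (- j) * x) = x" "\<pp> powi (- j) * (\<pp> powi j * x) = x"
  by (simp_all add: mult.assoc[symmetric] flip: power_int_add)

text \<open>Nonzero values of \<open>absv\<close> are powers of \<open>q\<close> because the maximal ideal is \<open>\<pp> * \<O>\<close>.\<close>

lemma absv_less_powi:
  fixes x :: 'a
  assumes "absv x < real q powi n"
  shows "absv x \<le> real q powi (n - 1)"
proof -
  have *: "absv (\<pp> powi n * x) = real q powi (- n) * absv x"
    by (simp only: absv_mult absv_pp_powi)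
  have "real q powi (- n) * absv x < real q powi (- n) * real q powi n"
    using assms by (intro mult_strict_left_mono) auto
  then have "absv (\<pp> powi n * x) < 1"
    unfolding * by (simp flip: power_int_add)
  then have "\<pp> powi n * x \<in> maximal_ideal" by (simp add: maximal_ideal_def)
  then obtain y where y: "\<pp> powi n * x = \<pp> * y" "absv y \<le> 1"
    unfolding prime_element by (auto simp: ring_of_integers_def)
  have "real q powi (- n) * absv x \<le> 1 / real q"
    unfolding *[symmetric] y(1) absv_mult absv_prime_element
    using y(2) by (simp add: divide_right_mono)
  then have "real q powi n * (real q powi (- n) * absv x) \<le> real q powi n * (1 / real q)"
    by (intro mult_left_mono) auto
  then show ?thesis
    by (simp add: mult.assoc[symmetric] power_int_diff flip: power_int_add)
qed

lemma center_in_pball [simp]: "a \<in> pball a n"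
  by (simp add: pball_def)

lemma pball_sym: "x \<in> pball a n \<longleftrightarrow> a \<in> pball x n"
  by (simp add: pball_def absv_minus_commute)

lemma pball_0_shift: "x \<in> pball a n \<longleftrightarrow> x - a \<in> pball 0 n"
  by (simp add: pball_def)

lemma pball_recenter: "x \<in> pball a n \<Longrightarrow> pball x n = pball a n"
proof -
  have "pball x n \<subseteq> pball a n" if "x \<in> pball a n" for x a
  proof
    fix y assume "y \<in> pball x n"
    with that absv_add_le[of "y - x" _ "x - a"] show "y \<in> pball a n"
      by (simp add: pball_def)
  qed
  then show "x \<in> pball a n \<Longrightarrow> pball x n = pball a n" using pball_sym by blast
qed

lemma pball_mono: "n \<le> m \<Longrightarrow> pball a m \<subseteq> pball a n"
  unfolding pball_def using power_int_increasing[of "- m" "- n" "real q"]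
  by (auto intro: order_trans)

lemma pball_subset: "n \<le> m \<Longrightarrow> x \<in> pball a n \<Longrightarrow> pball x m \<subseteq> pball a n"
  using pball_mono pball_recenter by blast

lemma pball_0_add: "x \<in> pball 0 n \<Longrightarrow> y \<in> pball 0 n \<Longrightarrow> x + y \<in> pball 0 n"
  and pball_0_diff: "x \<in> pball 0 n \<Longrightarrow> y \<in> pball 0 n \<Longrightarrow> x - y \<in> pball 0 n"
  by (auto simp: pball_def intro: absv_add_le absv_diff_le)

lemma pball_0_mult: "x \<in> pball 0 n \<Longrightarrow> y \<in> pball 0 m \<Longrightarrow> x * y \<in> pball 0 (n + m)"
proof -
  assume "x \<in> pball 0 n" "y \<in> pball 0 m"
  then have "absv x * absv y \<le> real q powi (- n) * real q powi (- m)"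
    by (intro mult_mono) (auto simp: pball_def)
  then show ?thesis by (simp add: pball_def absv_mult flip: power_int_add)
qed

lemma pball_pp_mult: "\<pp> powi j * x \<in> pball (\<pp> powi j * a) (n + j) \<longleftrightarrow> x \<in> pball a n"
proof -
  have "absv (\<pp> powi j * x - \<pp> powi j * a) = real q powi (- j) * absv (x - a)"
    by (simp only: right_diff_distrib[symmetric] absv_mult absv_pp_powi)
  moreover have "real q powi (- (n + j)) = real q powi (- j) * real q powi (- n)"
    by (simp add: add.commute flip: power_int_add)
  ultimately show ?thesis by (simp add: pball_def)
qed

lemma pball_pp_mult': "\<pp> powi j * x \<in> pball a n \<longleftrightarrow> x \<in> pball (\<pp> powi (- j) * a) (n - j)"
  using pball_pp_mult[of j x "\<pp> powi (- j) * a" "n - j"] by simp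

lemma pball_translate: "x + t \<in> pball a n \<longleftrightarrow> x \<in> pball (a - t) n"
  by (simp add: pball_def algebra_simps)

lemma ring_of_integers_eq: "ring_of_integers = pball 0 0"
  by (simp add: pball_def ring_of_integers_def)

lemma maximal_ideal_eq: "maximal_ideal = pball 0 1"
proof -
  have "absv x < 1 \<longleftrightarrow> absv x \<le> inverse (real q)" for x :: 'a
    using absv_less_powi[of x 0] q_simps(9)
    by (auto simp: power_int_minus simp del: q_simps intro: order_le_less_trans)
  then show ?thesis by (auto simp: pball_def maximal_ideal_def power_int_minus)
qed

lemma exists_small_radius: "0 < e \<Longrightarrow> \<exists>n::nat. real q powi (- int n) < e"
  using real_arch_pow_inv[of e "1 / real q"]
  by (auto simp: power_int_minus power_divide divide_inverse power_inverse)

lemma exists_pball_0: "\<exists>n::nat. x \<in> pball 0 (- int n)"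
proof -
  obtain n where "absv x < real q ^ n" using real_arch_pow[of "real q" "absv x"] by auto
  then show ?thesis by (intro exI[of _ n]) (simp add: pball_def)
qed

lemma open_pball [simp]: "open (pball a n)"
proof (unfold open_dist, intro ballI exI conjI allI impI)
  fix x y assume x: "x \<in> pball a n" and "dist y x < real q powi (- n)"
  then have "y \<in> pball x n" by (simp add: pball_def dist_absv)
  then show "y \<in> pball a n" using pball_recenter[OF x] by simp
qed simp

section \<open>Coset representatives of the ring of integers\<close>

lemma u_small_0 [simp]: "u_small \<pp> c \<epsilon> 0 = 0"
  by (simp add: u_small_def)

lemma u_eq_sum:
  assumes "n < q ^ K"
  shows "u n = (\<Sum>k<K. u_small \<pp> c \<epsilon> ((n div q ^ k) mod q) * \<pp> powi (- int k))"
proof -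
  let ?f = "\<lambda>k. u_small \<pp> c \<epsilon> ((n div q ^ k) mod q) * \<pp> powi (- int k)"
  let ?K = "max K (Suc n)"
  have 0: "?f k = 0" if "n < q ^ k" for k using that by simp
  have "(\<Sum>k\<le>n. ?f k) = (\<Sum>k<?K. ?f k)"
  proof (rule sum.mono_neutral_left)
    show "\<forall>k\<in>{..<?K} - {..n}. ?f k = 0"
    proof
      fix k assume "k \<in> {..<?K} - {..n}"
      then have "n < k" by auto
      also have "k < q ^ k" by (rule power_gt_expt) simp
      finally show "?f k = 0" by (rule 0)
    qed
  qed auto
  also have "\<dots> = (\<Sum>k<K. ?f k)"
  proof (rule sum.mono_neutral_right)
    show "\<forall>k\<in>{..<?K} - {..<K}. ?f k = 0"
    proof
      fix k assume "k \<in> {..<?K} - {..<K}"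
      then have "q ^ K \<le> q ^ k" by (intro power_increasing) auto
      with assms have "n < q ^ k" by (rule order_less_le_trans)
      then show "?f k = 0" by (rule 0)
    qed
  qed auto
  finally show ?thesis by (simp add: u_elem_def Let_def q_eq[symmetric])
qed

lemma u_0 [simp]: "u 0 = 0"
  by (simp add: u_elem_def)

lemma u_add_high:
  assumes "n < q ^ N" "d < q"
  shows "u (n + d * q ^ N) = u n + u_small \<pp> c \<epsilon> d * \<pp> powi (- int N)"
proof -
  have "n + d * q ^ N < (1 + d) * q ^ N" using assms by simp
  also have "\<dots> \<le> q * q ^ N" using assms by (intro mult_right_mono) auto
  finally have "n + d * q ^ N < q ^ Suc N" by simp
  from u_eq_sum[OF this] u_eq_sum[OF assms(1)] show ?thesis
    using assms by (simp add: digit_of_sum_high)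
qed

lemma absv_eps_sum: "absv (\<Sum>k<c. of_nat (a k) * \<epsilon> k) \<le> 1"
proof (rule absv_sum_le)
  fix k assume "k \<in> {..<c}"
  then have "absv (\<epsilon> k) \<le> 1" using eps_unit[of k] by (auto simp: ring_of_integers_def)
  then show "absv (of_nat (a k) * \<epsilon> k) \<le> 1"
    by (simp add: absv_mult mult_le_one absv_of_nat_le_1)
qed simp

lemma absv_u_small: "absv (u_small \<pp> c \<epsilon> d) \<le> real q"
proof -
  show ?thesis
    using absv_eps_sum[of "\<lambda>k. (d div CHAR('a) ^ k) mod CHAR('a)"]
    unfolding u_small_def absv_mult by (simp add: absv_prime_element)
qed

lemma u_in_pball: "n < q ^ K \<Longrightarrow> u n \<in> pball 0 (- int K)"
proof -
  assume "n < q ^ K"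
  have "absv (\<Sum>k<K. u_small \<pp> c \<epsilon> ((n div q ^ k) mod q) * \<pp> powi (- int k)) \<le> real q powi (int K)"
  proof (rule absv_sum_le)
    fix k assume "k \<in> {..<K}"
    have "absv (u_small \<pp> c \<epsilon> ((n div q ^ k) mod q)) * absv (\<pp> powi (- int k))
        \<le> real q * real q powi (int k)"
      using absv_pp_powi[of "- int k"] by (intro mult_mono absv_u_small) auto
    also have "\<dots> = real q ^ Suc k" by simp
    also have "\<dots> \<le> real q ^ K"
      using \<open>k \<in> {..<K}\<close> q_ge_2 by (intro power_increasing) auto
    finally show "absv (u_small \<pp> c \<epsilon> ((n div q ^ k) mod q) * \<pp> powi (- int k)) \<le> real q powi (int K)"
      by (simp add: absv_mult)
  qed simp
  then show ?thesis using u_eq_sum[OF \<open>n < q ^ K\<close>] by (simp add: pball_def)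
qed

text \<open>
  For \<open>x\<close> in \<open>\<pp>^(-N - 1) * \<O>\<close>, the class modulo \<open>\<pp>^(-N) * \<O>\<close> is a combination of the \<open>\<epsilon> k\<close> times a power of \<open>\<pp>\<close>, which gives the
  leading digit; the lower digits come by induction.
\<close>

lemma u_covers: "x \<in> pball 0 (- int N) \<Longrightarrow> \<exists>n < q ^ N. x \<in> pball (u n) 0"
proof (induction N arbitrary: x)
  case 0
  then show ?case by (intro exI[of _ 0]) simp
next
  case (Suc N)
  let ?y = "\<pp> powi (int (Suc N)) * x"
  have "?y \<in> ring_of_integers"
    using Suc.prems pball_pp_mult[of "int (Suc N)" x 0 "- int (Suc N)"] by (simp add: ring_of_integers_eq)
  from residue_basis[OF this] obtain a where a: "a \<in> {..<c} \<rightarrow>\<^sub>E {..<CHAR('a)}"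
    "?y - (\<Sum>k<c. of_nat (a k) * \<epsilon> k) \<in> maximal_ideal" by blast
  obtain d where d: "d < q" "\<forall>i<c. (d div CHAR('a) ^ i) mod CHAR('a) = a i"
    using digits_exist[of c a "CHAR('a)"] a by (auto simp: q_eq PiE_iff)
  have us: "u_small \<pp> c \<epsilon> d = (\<Sum>k<c. of_nat (a k) * \<epsilon> k) * inverse \<pp>"
    unfolding u_small_def using d by simp
  have "\<pp> powi (- int (Suc N)) * (?y - (\<Sum>k<c. of_nat (a k) * \<epsilon> k)) \<in> pball 0 (1 - int (Suc N))"
    using a(2) pball_pp_mult[of "- int (Suc N)" _ 0 1] unfolding maximal_ideal_eq by simp
  moreover have "\<pp> powi (- int (Suc N)) = inverse \<pp> * \<pp> powi (- int N)"
    by (simp only: power_int_minus power_int_of_nat power_Suc inverse_mult_distrib)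
  then have "\<pp> powi (- int (Suc N)) * (?y - (\<Sum>k<c. of_nat (a k) * \<epsilon> k))
      = x - u_small \<pp> c \<epsilon> d * \<pp> powi (- int N)"
    unfolding us right_diff_distrib pp_powi_cancel by (simp only: mult_ac)
  ultimately have "x - u_small \<pp> c \<epsilon> d * \<pp> powi (- int N) \<in> pball 0 (- int N)" by simp
  from Suc.IH[OF this] obtain n where n: "n < q ^ N"
    "x - u_small \<pp> c \<epsilon> d * \<pp> powi (- int N) \<in> pball (u n) 0" by blast
  have "n + d * q ^ N < (1 + d) * q ^ N" using n by simp
  also have "\<dots> \<le> q * q ^ N" using d by (intro mult_right_mono) auto
  finally have "n + d * q ^ N < q ^ Suc N" by simp
  moreover have "x \<in> pball (u (n + d * q ^ N)) 0"
    using n(2) unfolding u_add_high[OF n(1) d(1)] pball_def by (simp add: algebra_simps)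
  ultimately show ?case by blast
qed

section \<open>The Haar measure of balls\<close>

lemma sets_mu [simp, measurable_cong]: "sets \<mu> = sets borel"
  using haar by (simp add: haar_measure_def)

lemma space_mu [simp]: "space \<mu> = UNIV"
  using sets_eq_imp_space_eq[OF sets_mu] by simp

lemma pball_sets [measurable]: "pball a n \<in> sets borel"
  by (simp add: borel_open)

lemma measurable_lf_add [measurable]: "(\<lambda>x. x + a) \<in> borel_measurable (borel :: 'a measure)"
  by (rule borel_measurable_continuous_onI) (rule continuous_on_lf_add)

lemma measurable_lf_diff [measurable]: "(\<lambda>x. x - a) \<in> borel_measurable (borel :: 'a measure)"
  using measurable_lf_add[of "- a"] by simp

lemma measurable_lf_mult [measurable]: "(\<lambda>x. a * x) \<in> borel_measurable (borel :: 'a measure)"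
  by (rule borel_measurable_continuous_onI) (rule continuous_on_lf_mult)

lemma emeasure_pball_center: "emeasure \<mu> (pball a n) = emeasure \<mu> (pball 0 n)"
proof -
  have "(\<lambda>x. a + x) ` pball 0 n = pball a n"
  proof (intro equalityI subsetI)
    fix x assume "x \<in> pball a n"
    then show "x \<in> (\<lambda>x. a + x) ` pball 0 n"
      by (intro image_eqI[of _ _ "x - a"]) (auto simp: pball_def)
  qed (auto simp: pball_def)
  moreover have "emeasure \<mu> ((\<lambda>x. a + x) ` pball 0 n) = emeasure \<mu> (pball 0 n)"
    using haar pball_sets by (simp add: haar_measure_def)
  ultimately show ?thesis by simp
qed

text \<open>
  Each of the \<open>q\<close> residue classes, listed by the basis of the residue field, contributes one
  translate of the smaller ball.
\<close>

lemma emeasure_pball_step: "emeasure \<mu> (pball 0 n) = of_nat q * emeasure \<mu> (pball 0 (n + 1))"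
proof -
  let ?F = "{..<c} \<rightarrow>\<^sub>E {..<CHAR('a)}"
  let ?s = "\<lambda>a. \<Sum>k<c. of_nat (a k) * \<epsilon> k"
  let ?B = "\<lambda>a. pball (\<pp> powi n * ?s a) (n + 1)"
  have s: "?s a \<in> pball 0 0" for a
    using absv_eps_sum[of a] by (simp add: pball_def)
  have mem: "x \<in> ?B a \<longleftrightarrow> \<pp> powi (- n) * x - ?s a \<in> maximal_ideal" for x a
    using pball_pp_mult[of n "\<pp> powi (- n) * x" "?s a" 1]
    unfolding maximal_ideal_eq pball_0_shift[symmetric] by (simp only: pp_powi_cancel add.commute)
  have sub: "?B a \<subseteq> pball 0 n" for a
    using s[of a] pball_pp_mult[of n "?s a" 0 0] by (intro pball_subset) auto
  have x: "\<pp> powi (- n) * x \<in> ring_of_integers" if "x \<in> pball 0 n" for x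
    using that pball_pp_mult[of "- n" x 0 n] by (simp add: ring_of_integers_eq)
  have "pball 0 n = (\<Union>a\<in>?F. ?B a)"
  proof (intro equalityI subsetI)
    fix y assume "y \<in> pball 0 n"
    from residue_basis[OF x[OF this]] show "y \<in> (\<Union>a\<in>?F. ?B a)"
      using mem by blast
  qed (use sub in blast)
  moreover have "disjoint_family_on ?B ?F"
  proof (unfold disjoint_family_on_def, intro ballI impI)
    fix a b assume ab: "a \<in> ?F" "b \<in> ?F" "a \<noteq> b"
    show "?B a \<inter> ?B b = {}"
    proof (rule ccontr)
      assume "?B a \<inter> ?B b \<noteq> {}"
      then obtain y where y: "y \<in> ?B a" "y \<in> ?B b" by blast
      then have "y \<in> pball 0 n" using sub by blast
      from residue_basis[OF x[OF this]] have "a = b"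
        by (rule ex1E) (use y ab mem in metis)
      with ab(3) show False by simp
    qed
  qed
  moreover have "finite ?F" by (intro finite_PiE) auto
  ultimately have "emeasure \<mu> (pball 0 n) = (\<Sum>a\<in>?F. emeasure \<mu> (?B a))"
    by (subst sum_emeasure) auto
  also have "\<dots> = (\<Sum>a\<in>?F. emeasure \<mu> (pball 0 (n + 1)))"
    by (intro sum.cong refl emeasure_pball_center)
  also have "\<dots> = of_nat q * emeasure \<mu> (pball 0 (n + 1))"
    by (simp add: card_PiE q_eq)
  finally show ?thesis .
qed

lemma emeasure_pball: "emeasure \<mu> (pball a n) = ennreal (real q powi (- n))"
proof -
  have "emeasure \<mu> (pball 0 n) = ennreal (real q powi (- n))"
  proof (induction n rule: int_induct[where k = 0])
    case base
    have "emeasure \<mu> ring_of_integers = 1" using haar unfolding haar_measure_def by blast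
    then show ?case by (simp add: ring_of_integers_eq)
  next
    case (step1 i)
    have "ennreal (real q) * emeasure \<mu> (pball 0 (i + 1)) = ennreal (real q powi (- i))"
      using emeasure_pball_step[of i] step1(2) by (simp only: ennreal_of_nat_eq_real_of_nat)
    also have "real q powi (- i) = real q * real q powi (- (i + 1))"
      using power_int_add_1'[of "real q" "- (i + 1)"] by simp
    also have "ennreal (real q * real q powi (- (i + 1)))
        = ennreal (real q) * ennreal (real q powi (- (i + 1)))"
      by (rule ennreal_mult) auto
    finally have "ennreal (real q) = top \<or> ennreal (real q) = 0
        \<or> emeasure \<mu> (pball 0 (i + 1)) = ennreal (real q powi (- (i + 1)))"
      by (simp only: ennreal_mult_cancel_left) blast
    then show ?case by (elim disjE) simp_all
  next
    case (step2 i)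
    have "emeasure \<mu> (pball 0 (i - 1)) = ennreal (real q) * ennreal (real q powi (- i))"
      using emeasure_pball_step[of "i - 1"] step2(2)
      by (simp only: ennreal_of_nat_eq_real_of_nat diff_add_cancel)
    also have "\<dots> = ennreal (real q * real q powi (- i))"
      by (rule ennreal_mult[symmetric]) auto
    also have "real q * real q powi (- i) = real q powi (- (i - 1))"
      using power_int_add_1'[of "real q" "- i"] by simp
    finally show ?case .
  qed
  then show ?thesis by (simp add: emeasure_pball_center[of a])
qed

lemma measure_pball: "measure \<mu> (pball a n) = real q powi (- n)"
  by (simp add: measure_def emeasure_pball)

text \<open>
  The \<open>q^l\<close> cosets \<open>u n + \<O>\<close> with \<open>n < q^l\<close> cover \<open>\<pp>^(-l) * \<O>\<close>, which has measure \<open>q^l\<close>. If two of them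
  coincided, \<open>q^l - 1\<close> sets of measure 1 would suffice.
\<close>

lemma u_distinct_cosets:
  assumes "k < l" shows "u k \<notin> pball (u l) 0"
proof
  assume "u k \<in> pball (u l) 0"
  then have eq: "pball (u k) 0 = pball (u l) 0" by (rule pball_recenter)
  have "l < q ^ l" by (rule power_gt_expt) simp
  let ?I = "{..<q ^ l} - {l}"
  have "pball 0 (- int l) \<subseteq> (\<Union>n\<in>?I. pball (u n) 0)"
  proof
    fix x assume "x \<in> pball 0 (- int l)"
    then obtain n where n: "n < q ^ l" "x \<in> pball (u n) 0" using u_covers by blast
    show "x \<in> (\<Union>n\<in>?I. pball (u n) 0)"
    proof (cases "n = l")
      case True
      with n eq have "x \<in> pball (u k) 0" by simp
      moreover have "k \<in> ?I" using assms \<open>l < q ^ l\<close> by simp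
      ultimately show ?thesis by blast
    qed (use n in auto)
  qed
  then have "emeasure \<mu> (pball 0 (- int l)) \<le> emeasure \<mu> (\<Union>n\<in>?I. pball (u n) 0)"
    by (rule emeasure_mono) auto
  also have "\<dots> \<le> (\<Sum>n\<in>?I. emeasure \<mu> (pball (u n) 0))"
    by (rule emeasure_subadditive_finite) auto
  also have "\<dots> = of_nat (card ?I)"
    by (simp only: emeasure_pball) simp
  also have "card ?I = q ^ l - 1"
    using \<open>l < q ^ l\<close> by simp
  also have "emeasure \<mu> (pball 0 (- int l)) = of_nat (q ^ l)"
    by (simp only: emeasure_pball) (simp add: ennreal_of_nat_eq_real_of_nat)
  finally have "q ^ l \<le> q ^ l - 1"
    by (simp only: of_nat_le_iff)
  with \<open>l < q ^ l\<close> show False by linarith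
qed

lemma u_inj_cosets: "u k \<in> pball (u l) 0 \<Longrightarrow> k = l"
  using u_distinct_cosets[of k l] u_distinct_cosets[of l k] pball_sym[of "u k" "u l" 0]
  by (cases k l rule: linorder_cases) auto

text \<open>Scaling moves the representatives of \<open>K / \<O>\<close> to representatives of \<open>K / \<pp>^N * \<O>\<close>.\<close>

definition rep :: "int \<Rightarrow> nat \<Rightarrow> 'a" where
  "rep N k = \<pp> powi N * u k"

lemma rep_disjoint:
  assumes "k \<noteq> l" shows "pball (rep N k) N \<inter> pball (rep N l) N = {}"
proof (rule ccontr)
  assume "pball (rep N k) N \<inter> pball (rep N l) N \<noteq> {}"
  then obtain x where "x \<in> pball (rep N k) N" "x \<in> pball (rep N l) N" by blast
  then have "rep N k \<in> pball (rep N l) N" using pball_recenter pball_sym by blast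
  then show False
    using assms u_inj_cosets[of k l] pball_pp_mult[of N "u k" "u l" 0] by (simp add: rep_def)
qed

lemma rep_cover:
  assumes "M \<le> N"
  shows "pball 0 M = (\<Union>k<q ^ nat (N - M). pball (rep N k) N)"
proof (intro equalityI subsetI)
  fix x assume "x \<in> pball 0 M"
  then have "\<pp> powi (- N) * x \<in> pball 0 (- int (nat (N - M)))"
    using pball_pp_mult[of "- N" x 0 M] assms by simp
  then obtain n where "n < q ^ nat (N - M)" "\<pp> powi (- N) * x \<in> pball (u n) 0"
    using u_covers by blast
  then show "x \<in> (\<Union>k<q ^ nat (N - M). pball (rep N k) N)"
    using pball_pp_mult[of "- N" x "rep N n" N] by (auto simp: rep_def)
next
  fix x assume "x \<in> (\<Union>k<q ^ nat (N - M). pball (rep N k) N)"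
  then obtain k where k: "k < q ^ nat (N - M)" "x \<in> pball (rep N k) N" by blast
  have "rep N k \<in> pball 0 M"
    using u_in_pball[OF k(1)] pball_pp_mult[of N "u k" 0 "M - N"] assms by (simp add: rep_def)
  then show "x \<in> pball 0 M" using pball_subset[OF assms] k(2) by blast
qed

lemma rep_in_pball: "M \<le> N \<Longrightarrow> k < q ^ nat (N - M) \<Longrightarrow> rep N k \<in> pball 0 M"
  using rep_cover[of M N] center_in_pball by blast

lemma rep_cover_UNIV: "\<exists>k. x \<in> pball (rep N k) N"
proof -
  obtain n :: nat where "x \<in> pball 0 (- int n)" using exists_pball_0 by blast
  then have "x \<in> pball 0 (min (- int n) N)" using pball_mono[of "min (- int n) N" "- int n"] by auto
  then show ?thesis using rep_cover[of "min (- int n) N" N] by auto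
qed

text \<open>
  The representatives form a group. If \<open>u k - u l\<close> differs from its representative by an integer
  \<open>z\<close>, then \<open>chi (u s * z) = 1\<close> for all \<open>s\<close>, hence \<open>chi\<close> is trivial on \<open>K * z\<close>, which forces \<open>z = 0\<close>.
\<close>

lemma u_diff: "\<exists>r. u k - u l = u r"
proof -
  obtain r where r: "u k - u l \<in> pball (u r) 0"
    using rep_cover_UNIV[of "u k - u l" 0] by (auto simp: rep_def)
  define z where "z = u k - u l - u r"
  have zO: "z \<in> pball 0 0" using r by (simp add: z_def pball_def)
  have chi_m: "chi (- x) * chi x = 1" for x
    using chi_add[of "- x" x] chi_trivial[of 0] by (simp add: ring_of_integers_def)
  have z: "chi (u s * z) = 1" for s
  proof -
    have "u s * z = u s * u k + (- (u s * u l) + - (u s * u r))"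
      by (simp add: z_def algebra_simps)
    then have "chi (u s * z) = chi (- (u s * u l)) * chi (- (u s * u r))"
      by (simp only: chi_add chi_u_u) simp
    then show ?thesis using chi_m[of "u s * u l"] chi_m[of "u s * u r"] by (simp add: chi_u_u)
  qed
  have "z = 0"
  proof (rule ccontr)
    assume "z \<noteq> 0"
    obtain x where x: "chi x \<noteq> 1" using chi_nontrivial by blast
    obtain s where s: "x / z \<in> pball (u s) 0"
      using rep_cover_UNIV[of "x / z" 0] by (auto simp: rep_def)
    then have "x / z - u s \<in> pball 0 0" by (simp add: pball_def)
    from pball_0_mult[OF this zO] have "chi ((x / z - u s) * z) = 1"
      by (intro chi_trivial) (simp add: ring_of_integers_eq)
    moreover have "x = u s * z + (x / z - u s) * z"
      using \<open>z \<noteq> 0\<close> by (simp add: field_simps)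
    ultimately have "chi x = 1" using chi_add[of "u s * z" "(x / z - u s) * z"] z by simp
    with x show False by contradiction
  qed
  then show ?thesis by (auto simp: z_def)
qed

section \<open>Measures determined by balls\<close>

lemma pball_Int_cases: "pball a n \<inter> pball b m \<in> {{}, pball a n, pball b m}"
proof (cases "pball a n \<inter> pball b m = {}")
  case False
  then obtain x where "x \<in> pball a n" "x \<in> pball b m" by blast
  then have "pball a n = pball x n" "pball b m = pball x m" using pball_recenter by auto
  then show ?thesis using pball_mono[of n m x] pball_mono[of m n x] by (cases "n \<le> m") auto
qed simp

lemma open_eq_Union_pball:
  assumes "open (S :: 'a set)"
  shows "S = (\<Union>(n, k)\<in>{(n, k). pball (rep (int n) k) (int n) \<subseteq> S}. pball (rep (int n) k) (int n))"
proof (intro equalityI subsetI)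
  fix x assume "x \<in> S"
  then obtain e where e: "0 < e" "\<And>y. dist y x < e \<Longrightarrow> y \<in> S"
    using assms unfolding open_dist by blast
  obtain n :: nat where n: "real q powi (- int n) < e" using exists_small_radius e by blast
  obtain k where k: "x \<in> pball (rep (int n) k) (int n)" using rep_cover_UNIV by blast
  have "pball x (int n) \<subseteq> S"
    using e(2) n by (auto simp: pball_def dist_absv)
  then show "x \<in> (\<Union>(n, k)\<in>{(n, k). pball (rep (int n) k) (int n) \<subseteq> S}. pball (rep (int n) k) (int n))"
    using k pball_recenter[OF k] by auto
qed auto

text \<open>
  Balls are nested or disjoint, so together with the empty set they are closed under intersection.
  They generate the Borel sets: an open set is a union of balls, and there are only countably many.
\<close>

lemma measure_eqI_pball:
  fixes M N :: "'a measure"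
  assumes "sets M = sets borel" "sets N = sets borel"
    and "\<And>a n. emeasure M (pball a n) = emeasure N (pball a n)"
    and "\<And>a n. emeasure M (pball a n) \<noteq> \<infinity>"
  shows "M = N"
proof -
  let ?E = "insert {} (range (\<lambda>(a, n). pball a n))"
  have gen: "sets (borel :: 'a measure) = sigma_sets UNIV ?E"
  proof (rule antisym)
    have sub: "S \<in> sigma_sets UNIV ?E" if "S \<in> {S. open S}" for S
    proof -
      let ?I = "{(n, k). pball (rep (int n) k) (int n) \<subseteq> S}"
      have "(\<Union>((\<lambda>(n, k). pball (rep (int n) k) (int n)) ` ?I)) \<in> sigma_sets UNIV ?E"
        by (rule sigma_sets_UNION) (auto intro!: sigma_sets.Basic)
      then show ?thesis using open_eq_Union_pball[of S] that by simp
    qed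
    then show "sets borel \<subseteq> sigma_sets UNIV ?E"
      using sigma_sets_mono[of "{S. open S}" UNIV ?E] by (simp add: borel_def subset_iff)
    show "sigma_sets UNIV ?E \<subseteq> sets borel"
      using sets.sigma_sets_subset[of ?E "borel :: 'a measure"] pball_sets by (simp add: image_subset_iff)
  qed
  show ?thesis
  proof (rule measure_eqI_generator_eq_countable[of ?E UNIV M N "range (\<lambda>k. pball (rep 0 k) 0)"])
    show "Int_stable ?E"
      unfolding Int_stable_def using pball_Int_cases by force
    show "\<Union>(range (\<lambda>k. pball (rep 0 k) 0)) = UNIV"
      using rep_cover_UNIV by blast
    show "sets M = sigma_sets UNIV ?E" "sets N = sigma_sets UNIV ?E"
      using assms(1,2) gen by simp_all
    show "emeasure M X = emeasure N X" if "X \<in> ?E" for X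
      using that assms(3) by auto
    show "emeasure M X \<noteq> \<infinity>" if "X \<in> range (\<lambda>k. pball (rep 0 k) 0)" for X
      using that assms(4) by auto
  qed auto
qed

lemma emeasure_pball_finite [simp]: "emeasure \<mu> (pball a n) < \<infinity>" "emeasure \<mu> (pball a n) \<noteq> \<infinity>"
  by (simp_all add: emeasure_pball)

lemma sigma_finite_mu: "sigma_finite_measure \<mu>"
proof
  show "\<exists>A. countable A \<and> A \<subseteq> sets \<mu> \<and> \<Union>A = space \<mu> \<and> (\<forall>a\<in>A. emeasure \<mu> a \<noteq> \<infinity>)"
    using rep_cover_UNIV[of _ 0]
    by (intro exI[of _ "range (\<lambda>k. pball (rep 0 k) 0)"]) (auto simp: emeasure_pball)
qed

lemma distr_mu_translate: "distr \<mu> \<mu> (\<lambda>x. x + t) = \<mu>"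
proof (rule measure_eqI_pball)
  fix a n
  have "(\<lambda>x. x + t) -` pball a n \<inter> space \<mu> = pball (a - t) n"
    using pball_translate by auto
  then show "emeasure (distr \<mu> \<mu> (\<lambda>x. x + t)) (pball a n) = emeasure \<mu> (pball a n)"
    by (subst emeasure_distr) (auto simp: emeasure_pball)
  then show "emeasure (distr \<mu> \<mu> (\<lambda>x. x + t)) (pball a n) \<noteq> \<infinity>"
    by (simp add: emeasure_pball)
qed auto

lemma distr_mu_dilate: "distr \<mu> \<mu> (\<lambda>x. \<pp> powi j * x) = density \<mu> (\<lambda>_. ennreal (real q powi j))"
proof (rule measure_eqI_pball)
  fix a n
  have "(\<lambda>x. \<pp> powi j * x) -` pball a n \<inter> space \<mu> = pball (\<pp> powi (- j) * a) (n - j)"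
    using pball_pp_mult' by auto
  then have 1: "emeasure (distr \<mu> \<mu> (\<lambda>x. \<pp> powi j * x)) (pball a n) = ennreal (real q powi (j - n))"
    by (subst emeasure_distr) (auto simp: emeasure_pball)
  have "emeasure (density \<mu> (\<lambda>_. ennreal (real q powi j))) (pball a n)
      = ennreal (real q powi j) * ennreal (real q powi (- n))"
    by (simp add: emeasure_density_const emeasure_pball)
  also have "\<dots> = ennreal (real q powi j * real q powi (- n))"
    by (rule ennreal_mult[symmetric]) auto
  also have "real q powi j * real q powi (- n) = real q powi (j - n)"
    using power_int_add[of "real q" j "- n"] by simp
  finally show "emeasure (distr \<mu> \<mu> (\<lambda>x. \<pp> powi j * x)) (pball a n)
      = emeasure (density \<mu> (\<lambda>_. ennreal (real q powi j))) (pball a n)"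
    using 1 by simp
  show "emeasure (distr \<mu> \<mu> (\<lambda>x. \<pp> powi j * x)) (pball a n) \<noteq> \<infinity>"
    using 1 by simp
qed auto

lemma nn_integral_translate:
  assumes [measurable]: "f \<in> borel_measurable borel"
  shows "(\<integral>\<^sup>+x. f (x + t) \<partial>\<mu>) = (\<integral>\<^sup>+x. f x \<partial>\<mu>)"
proof -
  have "(\<integral>\<^sup>+x. f (x + t) \<partial>\<mu>) = (\<integral>\<^sup>+x. f x \<partial>distr \<mu> \<mu> (\<lambda>x. x + t))"
    by (subst nn_integral_distr) simp_all
  then show ?thesis by (simp only: distr_mu_translate)
qed

lemma integral_translate:
  fixes f :: "'a \<Rightarrow> complex"
  assumes [measurable]: "f \<in> borel_measurable borel"
  shows "(LINT x|\<mu>. f (x + t)) = (LINT x|\<mu>. f x)"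
proof -
  have "(LINT x|\<mu>. f (x + t)) = (LINT x|distr \<mu> \<mu> (\<lambda>x. x + t). f x)"
    by (subst integral_distr) simp_all
  then show ?thesis by (simp only: distr_mu_translate)
qed

lemma nn_integral_dilate:
  assumes [measurable]: "f \<in> borel_measurable borel"
  shows "(\<integral>\<^sup>+x. f (\<pp> powi j * x) \<partial>\<mu>) = ennreal (real q powi j) * (\<integral>\<^sup>+x. f x \<partial>\<mu>)"
proof -
  have "(\<integral>\<^sup>+x. f (\<pp> powi j * x) \<partial>\<mu>) = (\<integral>\<^sup>+x. f x \<partial>distr \<mu> \<mu> (\<lambda>x. \<pp> powi j * x))"
    by (subst nn_integral_distr) simp_all
  also have "\<dots> = ennreal (real q powi j) * (\<integral>\<^sup>+x. f x \<partial>\<mu>)"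
    unfolding distr_mu_dilate by (subst nn_integral_density) (simp_all add: nn_integral_cmult)
  finally show ?thesis .
qed

lemma integral_dilate:
  fixes f :: "'a \<Rightarrow> complex"
  assumes [measurable]: "f \<in> borel_measurable borel"
  shows "(LINT x|\<mu>. f (\<pp> powi j * x)) = qpow j * (LINT x|\<mu>. f x)"
proof -
  have "(LINT x|\<mu>. f (\<pp> powi j * x)) = (LINT x|distr \<mu> \<mu> (\<lambda>x. \<pp> powi j * x). f x)"
    by (subst integral_distr) simp_all
  also have "\<dots> = qpow j * (LINT x|\<mu>. f x)"
    unfolding distr_mu_dilate
    by (subst integral_density) (simp_all add: scaleR_conv_of_real)
  finally show ?thesis .
qed

lemma borel_measurable_mu_iff [simp]: "borel_measurable \<mu> = borel_measurable borel"
  by (rule measurable_cong_sets) simp_all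

lemma AE_translate:
  assumes "AE x in \<mu>. P x" shows "AE x in \<mu>. P (x + t)"
proof -
  have "AE x in distr \<mu> \<mu> (\<lambda>x. x + t). P x" using assms by (simp only: distr_mu_translate)
  then show ?thesis by (rule AE_distrD[rotated]) simp
qed

lemma AE_dilate:
  assumes "AE x in \<mu>. P x" shows "AE x in \<mu>. P (\<pp> powi j * x)"
proof -
  have "AE x in distr \<mu> \<mu> (\<lambda>x. \<pp> powi j * x). P x"
    using assms unfolding distr_mu_dilate by (simp add: AE_density)
  then show ?thesis by (rule AE_distrD[rotated]) simp
qed

section \<open>Locally integrable functions\<close>

definition loc_int :: "('a \<Rightarrow> 'b :: {banach, second_countable_topology}) \<Rightarrow> bool" where
  "loc_int f \<longleftrightarrow> f \<in> borel_measurable borel \<and> (\<forall>n. set_integrable \<mu> (pball 0 n) f)"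

lemma loc_int_measurable: "loc_int f \<Longrightarrow> f \<in> borel_measurable borel"
  by (simp add: loc_int_def)

lemma pball_subset_0: "\<exists>m. pball a n \<subseteq> pball 0 m"
proof -
  obtain k :: nat where "a \<in> pball 0 (- int k)" using exists_pball_0 by blast
  then have "a \<in> pball 0 (min (- int k) n)" using pball_mono[of "min (- int k) n" "- int k"] by auto
  then show ?thesis using pball_subset[of "min (- int k) n" n a 0] by auto
qed

lemma loc_int_set_integrable: "loc_int f \<Longrightarrow> set_integrable \<mu> (pball a n) f"
proof -
  assume f: "loc_int f"
  obtain m where "pball a n \<subseteq> pball 0 m" using pball_subset_0 by blast
  moreover have "set_integrable \<mu> (pball 0 m) f" using f by (simp add: loc_int_def)
  moreover have "pball a n \<in> sets \<mu>" by simp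
  ultimately show ?thesis using set_integrable_subset by blast
qed

lemma integrable_loc_int:
  fixes f :: "'a \<Rightarrow> 'b :: {banach, second_countable_topology}"
  assumes "integrable \<mu> f"
  shows "loc_int f"
proof -
  have "f \<in> borel_measurable borel" using borel_measurable_integrable[OF assms] by simp
  moreover have "set_integrable \<mu> (pball 0 n) f" for n
    unfolding set_integrable_def by (intro integrable_mult_indicator assms) simp
  ultimately show ?thesis by (simp add: loc_int_def)
qed

lemma loc_int_bound:
  fixes f :: "'a \<Rightarrow> 'b :: {banach, second_countable_topology}"
    and g :: "'a \<Rightarrow> 'c :: {banach, second_countable_topology}"
  assumes f: "loc_int f" and [measurable]: "g \<in> borel_measurable borel"
    and le: "\<And>x. norm (g x) \<le> norm (f x)"
  shows "loc_int g"
proof -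
  have "set_integrable \<mu> (pball 0 n) g" for n
    unfolding set_integrable_def
  proof (rule Bochner_Integration.integrable_bound)
    show "integrable \<mu> (\<lambda>x. indicator (pball 0 n) x *\<^sub>R f x)"
      using f by (simp add: loc_int_def set_integrable_def)
    show "AE x in \<mu>. norm (indicator (pball 0 n) x *\<^sub>R g x) \<le> norm (indicator (pball 0 n) x *\<^sub>R f x)"
      using le by (auto intro!: AE_I2 mult_left_mono)
  qed simp
  then show ?thesis by (simp add: loc_int_def)
qed

lemma loc_int_bounded_mult:
  fixes f h :: "'a \<Rightarrow> complex"
  assumes f: "loc_int f" and h: "h \<in> borel_measurable borel" "\<And>x. cmod (h x) \<le> 1"
  shows "loc_int (\<lambda>x. f x * h x)"
proof (rule loc_int_bound[OF f])
  show "(\<lambda>x. f x * h x) \<in> borel_measurable borel"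
    using loc_int_measurable[OF f] h by simp
  show "cmod (f x * h x) \<le> cmod (f x)" for x
    using mult_left_mono[OF h(2), of "cmod (f x)" x] by (simp add: norm_mult)
qed

lemma indicator_pball_L2: "(indicator (pball a n) :: 'a \<Rightarrow> complex) \<in> L2 \<mu>"
proof -
  have "(\<lambda>x. (cmod (indicator (pball a n) x))\<^sup>2) = (indicator (pball a n) :: 'a \<Rightarrow> real)"
    by (rule ext) (simp split: split_indicator)
  moreover have "integrable \<mu> (indicator (pball a n) :: 'a \<Rightarrow> real)"
    by (rule integrable_real_indicator) (simp_all add: emeasure_pball)
  ultimately show ?thesis by (simp add: L2_def)
qed

lemma L2_loc_int: "f \<in> L2 \<mu> \<Longrightarrow> loc_int f"
proof -
  assume f: "f \<in> L2 \<mu>"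
  have "set_integrable \<mu> (pball 0 n) f" for n
    using L2_mult_integrable(1)[OF indicator_pball_L2 f, of 0 n]
    unfolding set_integrable_def by (simp add: of_real_indicator scaleR_conv_of_real)
  then show ?thesis using L2_meas[OF f] by (simp add: loc_int_def)
qed

lemma loc_int_Re: "loc_int f \<Longrightarrow> loc_int (\<lambda>x. Re (f x))"
  and loc_int_Im: "loc_int f \<Longrightarrow> loc_int (\<lambda>x. Im (f x))"
  and loc_int_cnj: "loc_int f \<Longrightarrow> loc_int (\<lambda>x. cnj (f x))"
proof -
  assume f: "loc_int f"
  then have [measurable]: "f \<in> borel_measurable borel" by (rule loc_int_measurable)
  show "loc_int (\<lambda>x. Re (f x))" "loc_int (\<lambda>x. Im (f x))" "loc_int (\<lambda>x. cnj (f x))"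
    by (rule loc_int_bound[OF f]; simp add: abs_Re_le_cmod abs_Im_le_cmod)+
qed

lemma loc_int_add:
  "loc_int f \<Longrightarrow> loc_int g \<Longrightarrow> loc_int (\<lambda>x. f x + g x :: 'b :: {banach, second_countable_topology})"
  unfolding loc_int_def by (auto intro!: set_integral_add borel_measurable_add)

lemma loc_int_diff:
  "loc_int f \<Longrightarrow> loc_int g \<Longrightarrow> loc_int (\<lambda>x. f x - g x :: 'b :: {banach, second_countable_topology})"
  unfolding loc_int_def by (auto intro!: set_integral_diff borel_measurable_diff)

text \<open>The positive and negative parts are densities of measures that agree on balls.\<close>

lemma loc_int_real_eq_0:
  fixes f :: "'a \<Rightarrow> real"
  assumes f: "loc_int f" and 0: "\<And>a n. (LINT x:pball a n|\<mu>. f x) = 0"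
  shows "AE x in \<mu>. f x = 0"
proof -
  interpret sigma_finite_measure \<mu> by (rule sigma_finite_mu)
  have [measurable]: "f \<in> borel_measurable borel" using f by (simp add: loc_int_def)
  let ?p = "\<lambda>x. max 0 (f x)" and ?m = "\<lambda>x. max 0 (- f x)"
  have p: "set_integrable \<mu> (pball a n) ?p" and m: "set_integrable \<mu> (pball a n) ?m" for a n
    by (auto intro!: loc_int_set_integrable loc_int_bound[OF f])
  have ep: "emeasure (density \<mu> (\<lambda>x. ennreal (g x))) (pball a n) = ennreal (LINT x:pball a n|\<mu>. g x)"
    if g: "set_integrable \<mu> (pball a n) g" "g \<in> borel_measurable borel" "\<And>x. 0 \<le> g x" for g a n
  proof -
    have "emeasure (density \<mu> (\<lambda>x. ennreal (g x))) (pball a n)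
        = (\<integral>\<^sup>+x. ennreal (indicator (pball a n) x *\<^sub>R g x) \<partial>\<mu>)"
      using g by (subst emeasure_density) (auto intro!: nn_integral_cong simp: indicator_def)
    also have "\<dots> = ennreal (LINT x:pball a n|\<mu>. g x)"
      unfolding set_lebesgue_integral_def
      by (rule nn_integral_eq_integral) (use g in \<open>auto simp: set_integrable_def\<close>)
    finally show ?thesis .
  qed
  have "density \<mu> (\<lambda>x. ennreal (?p x)) = density \<mu> (\<lambda>x. ennreal (?m x))"
  proof (rule measure_eqI_pball)
    fix a n
    have "(LINT x:pball a n|\<mu>. ?p x) - (LINT x:pball a n|\<mu>. ?m x) = (LINT x:pball a n|\<mu>. ?p x - ?m x)"
      by (rule set_integral_diff(2)[symmetric, OF p m])
    also have "(\<lambda>x. ?p x - ?m x) = f" by (auto simp: max_def)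
    finally have "(LINT x:pball a n|\<mu>. ?p x) = (LINT x:pball a n|\<mu>. ?m x)" using 0 by simp
    then show "emeasure (density \<mu> (\<lambda>x. ennreal (?p x))) (pball a n)
        = emeasure (density \<mu> (\<lambda>x. ennreal (?m x))) (pball a n)"
      by (simp add: ep[OF p] ep[OF m])
    show "emeasure (density \<mu> (\<lambda>x. ennreal (?p x))) (pball a n) \<noteq> \<infinity>"
      by (simp add: ep[OF p])
  qed auto
  then have "AE x in \<mu>. ennreal (?p x) = ennreal (?m x)"
    by (intro density_unique) auto
  then show ?thesis
    by eventually_elim (auto simp: max_def split: if_splits)
qed

lemma loc_int_eqI:
  fixes f g :: "'a \<Rightarrow> complex"
  assumes f: "loc_int f" and g: "loc_int g"
    and eq: "\<And>a n. (LINT x:pball a n|\<mu>. f x) = (LINT x:pball a n|\<mu>. g x)"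
  shows "AE x in \<mu>. f x = g x"
proof -
  let ?h = "\<lambda>x. f x - g x"
  have h: "loc_int ?h" by (rule loc_int_diff[OF f g])
  have h0: "(LINT x:pball a n|\<mu>. ?h x) = 0" for a n
    using eq set_integral_diff(2)[OF loc_int_set_integrable[OF f] loc_int_set_integrable[OF g]] by simp
  have i: "integrable \<mu> (\<lambda>x. indicator (pball a n) x *\<^sub>R ?h x)" for a n
    using loc_int_set_integrable[OF h] by (simp add: set_integrable_def)
  have "AE x in \<mu>. Re (?h x) = 0"
  proof (rule loc_int_real_eq_0[OF loc_int_Re[OF h]])
    show "(LINT x:pball a n|\<mu>. Re (?h x)) = 0" for a n
      using h0[of a n] integral_Re[OF i, of a n] by (simp add: set_lebesgue_integral_def)
  qed
  moreover have "AE x in \<mu>. Im (?h x) = 0"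
  proof (rule loc_int_real_eq_0[OF loc_int_Im[OF h]])
    show "(LINT x:pball a n|\<mu>. Im (?h x)) = 0" for a n
      using h0[of a n] integral_Im[OF i, of a n] by (simp add: set_lebesgue_integral_def)
  qed
  ultimately show ?thesis by eventually_elim (auto simp: complex_eq_iff)
qed

section \<open>Integrals over balls\<close>

abbreviation bint :: "('a \<Rightarrow> complex) \<Rightarrow> 'a \<Rightarrow> int \<Rightarrow> complex" where
  "bint f a n \<equiv> (LINT x:pball a n|\<mu>. f x)"

lemma loc_int_ball_integrable: "loc_int f \<Longrightarrow> integrable \<mu> (\<lambda>x. indicator (pball a n) x *\<^sub>R f x)"
  using loc_int_set_integrable by (simp add: set_integrable_def)

lemma bint_cong: "(\<And>x. x \<in> pball a n \<Longrightarrow> f x = g x) \<Longrightarrow> bint f a n = bint g a n"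
  by (rule set_lebesgue_integral_cong) auto

lemma bint_cmult: "bint (\<lambda>x. z * f x) a n = z * bint f a n"
  by simp

lemma bint_multc: "bint (\<lambda>x. f x * z) a n = bint f a n * z"
  by simp

lemma bint_const: "bint (\<lambda>_. z) a n = qpow (- n) * z"
  unfolding set_lebesgue_integral_def by (simp add: measure_pball scaleR_conv_of_real)

lemma bint_sum:
  assumes "\<And>i. i \<in> I \<Longrightarrow> loc_int (f i)"
  shows "bint (\<lambda>x. \<Sum>i\<in>I. f i x) a n = (\<Sum>i\<in>I. bint (f i) a n)"
  unfolding set_lebesgue_integral_def scaleR_sum_right
  by (rule Bochner_Integration.integral_sum) (use assms loc_int_ball_integrable in auto)

lemma bint_cnj: "bint (\<lambda>x. cnj (f x)) a n = cnj (bint f a n)"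
  unfolding set_lebesgue_integral_def
  by (subst Bochner_Integration.integral_cnj[symmetric]) simp

lemma loc_int_cmult: "loc_int f \<Longrightarrow> loc_int (\<lambda>x. z * f x :: complex)"
  unfolding loc_int_def by auto

lemma indicator_subball_sum:
  assumes "M \<le> n" "n \<le> m" "a \<in> pball 0 M"
  shows "(indicator (pball a n) x :: real)
    = (\<Sum>k<q ^ nat (m - M). if rep m k \<in> pball a n then indicator (pball (rep m k) m) x else 0)"
proof -
  have Mm: "M \<le> m" using assms by simp
  have sub: "x \<in> pball (rep m k) m \<Longrightarrow> rep m k \<in> pball a n \<longleftrightarrow> x \<in> pball a n" for k
    using pball_subset[OF assms(2)] pball_sym by blast
  have "(\<Sum>k<q ^ nat (m - M). if rep m k \<in> pball a n then indicator (pball (rep m k) m) x else (0::real))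
      = (\<Sum>k<q ^ nat (m - M). indicator (pball (rep m k) m) x * indicator (pball a n) x)"
    by (rule sum.cong) (use sub in \<open>auto simp: indicator_def\<close>)
  also have "\<dots> = indicator (\<Union>k<q ^ nat (m - M). pball (rep m k) m) x * indicator (pball a n) x"
    by (subst indicator_UN_disjoint)
       (auto simp: disjoint_family_on_def rep_disjoint sum_distrib_right)
  also have "\<dots> = indicator (pball 0 M) x * indicator (pball a n) x"
    by (simp only: rep_cover[OF Mm])
  also have "\<dots> = indicator (pball a n) x"
    using pball_subset[OF assms(1,3)] by (auto simp: indicator_def)
  finally show ?thesis ..
qed

lemma bint_subball_sum:
  assumes f: "loc_int f" and "M \<le> n" "n \<le> m" "a \<in> pball 0 M"
  shows "bint f a n = (\<Sum>k<q ^ nat (m - M). if rep m k \<in> pball a n then bint f (rep m k) m else 0)"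
proof -
  have "bint f a n = (LINT x|\<mu>. (\<Sum>k<q ^ nat (m - M).
      if rep m k \<in> pball a n then indicator (pball (rep m k) m) x *\<^sub>R f x else 0))"
    unfolding set_lebesgue_integral_def indicator_subball_sum[OF assms(2-4)] scaleR_sum_left
    by (intro Bochner_Integration.integral_cong refl sum.cong) auto
  also have "\<dots> = (\<Sum>k<q ^ nat (m - M). (LINT x|\<mu>.
      (if rep m k \<in> pball a n then indicator (pball (rep m k) m) x *\<^sub>R f x else 0)))"
  proof (rule Bochner_Integration.integral_sum)
    fix k
    show "integrable \<mu>
        (\<lambda>x. if rep m k \<in> pball a n then indicator (pball (rep m k) m) x *\<^sub>R f x else 0)"
      by (cases "rep m k \<in> pball a n") (simp_all add: loc_int_ball_integrable f)
  qed
  also have "\<dots> = (\<Sum>k<q ^ nat (m - M). if rep m k \<in> pball a n then bint f (rep m k) m else 0)"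
    unfolding set_lebesgue_integral_def by (intro sum.cong refl) auto
  finally show ?thesis .
qed

lemma bint_0_sum:
  assumes f: "loc_int f" and "M \<le> m"
  shows "bint f 0 M = (\<Sum>k<q ^ nat (m - M). bint f (rep m k) m)"
proof -
  have "bint f 0 M = (\<Sum>k<q ^ nat (m - M). if rep m k \<in> pball 0 M then bint f (rep m k) m else 0)"
    by (rule bint_subball_sum[OF f]) (use assms in auto)
  also have "\<dots> = (\<Sum>k<q ^ nat (m - M). bint f (rep m k) m)"
    by (rule sum.cong) (use rep_in_pball[OF assms(2)] in auto)
  finally show ?thesis .
qed

section \<open>Projections onto functions constant on small balls\<close>

text \<open>
  On \<open>L2\<close>, \<open>proj n\<close> is the orthogonal projection onto the functions that are supported in
  \<open>\<pp>^(-n) * \<O>\<close> and constant on cosets of \<open>\<pp>^n * \<O>\<close>, and \<open>energy n f\<close> is the squared norm of \<open>proj n f\<close>.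
  Both make sense for locally integrable functions.
\<close>

definition proj :: "nat \<Rightarrow> ('a \<Rightarrow> complex) \<Rightarrow> 'a \<Rightarrow> complex" where
  "proj n f x = (\<Sum>k<q ^ (2 * n). complex_of_real (real q ^ n) * bint f (rep n k) n
      * indicator (pball (rep n k) n) x)"

definition energy :: "nat \<Rightarrow> ('a \<Rightarrow> complex) \<Rightarrow> real" where
  "energy n f = real q ^ n * (\<Sum>k<q ^ (2 * n). (cmod (bint f (rep n k) n))\<^sup>2)"

lemma proj_L2: "proj n f \<in> L2 \<mu>"
  unfolding proj_def by (intro L2_sum L2_scale indicator_pball_L2)

lemma L2_inner_indicator: "L2_inner \<mu> g (indicator (pball a n)) = bint g a n"
  unfolding L2_inner_def set_lebesgue_integral_def
  by (intro Bochner_Integration.integral_cong) (auto simp: indicator_def)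

lemma L2_inner_proj:
  assumes "g \<in> L2 \<mu>"
  shows "L2_inner \<mu> g (proj n f)
    = (\<Sum>k<q ^ (2 * n). complex_of_real (real q ^ n) * cnj (bint f (rep n k) n) * bint g (rep n k) n)"
  unfolding proj_def
  by (subst L2_inner_sum_right)
     (auto simp: assms L2_inner_scale_right L2_inner_indicator intro!: L2_scale indicator_pball_L2)

lemma energy_eq_inner:
  assumes "g \<in> L2 \<mu>" and "\<And>k. k < q ^ (2 * n) \<Longrightarrow> bint g (rep n k) n = bint f (rep n k) n"
  shows "L2_inner \<mu> g (proj n f) = complex_of_real (energy n f)"
proof -
  have "L2_inner \<mu> g (proj n f)
      = (\<Sum>k<q ^ (2 * n). complex_of_real (real q ^ n) * complex_of_real ((cmod (bint f (rep n k) n))\<^sup>2))"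
    unfolding L2_inner_proj[OF assms(1)]
    by (rule sum.cong) (use assms(2) in \<open>simp_all only: complex_norm_square mult_ac lessThan_iff\<close>)
  then show ?thesis by (simp add: energy_def sum_distrib_left)
qed

lemma bint_proj:
  assumes f: "loc_int f" and "- int m \<le> n" "n \<le> int m" "a \<in> pball 0 (- int m)"
  shows "bint (proj m f) a n = bint f a n"
proof -
  have m2: "nat (int m - - int m) = 2 * m" by simp
  have B: "bint (proj m f) (rep m k) m = bint f (rep m k) m" if k: "k < q ^ (2 * m)" for k
  proof -
    have "proj m f x = complex_of_real (real q ^ m) * bint f (rep m k) m" if "x \<in> pball (rep m k) m" for x
    proof -
      have "proj m f x = (\<Sum>l<q ^ (2 * m). if l = k then complex_of_real (real q ^ m) * bint f (rep m k) m else 0)"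
        unfolding proj_def
        by (rule sum.cong) (use that rep_disjoint[of _ k m] in \<open>auto simp: indicator_def\<close>)
      then show ?thesis using k by simp
    qed
    then have "bint (proj m f) (rep m k) m
        = bint (\<lambda>_. complex_of_real (real q ^ m) * bint f (rep m k) m) (rep m k) m"
      by (rule bint_cong)
    also have "\<dots> = bint f (rep m k) m"
      unfolding bint_const by (simp add: power_int_minus)
    finally show ?thesis .
  qed
  show ?thesis
    unfolding bint_subball_sum[OF L2_loc_int[OF proj_L2] assms(2-4)] bint_subball_sum[OF assms] m2
    by (rule sum.cong) (use B in auto)
qed

lemma inner_proj_proj:
  assumes f: "loc_int f" and "n \<le> m"
  shows "L2_inner \<mu> (proj m f) (proj n f) = complex_of_real (energy n f)"
proof (rule energy_eq_inner[OF proj_L2])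
  fix k assume k: "k < q ^ (2 * n)"
  have "nat (int n - - int n) = 2 * n" by simp
  with k have "k < q ^ nat (int n - - int n)" by (simp only:)
  then have "rep n k \<in> pball 0 (- int n)"
    by (intro rep_in_pball) auto
  then have "rep n k \<in> pball 0 (- int m)"
    using pball_mono[of "- int m" "- int n"] assms(2) by auto
  then show "bint (proj m f) (rep n k) n = bint f (rep n k) n"
    by (intro bint_proj[OF f]) (use assms(2) in auto)
qed

lemma norm_proj: "loc_int f \<Longrightarrow> (L2_norm \<mu> (proj n f))\<^sup>2 = energy n f"
  using inner_proj_proj[of f n n] unfolding L2_inner_self by (simp only: of_real_eq_iff order_refl)

lemma norm_proj_diff:
  assumes "loc_int f" "n \<le> m"
  shows "(L2_norm \<mu> (\<lambda>x. proj m f x - proj n f x))\<^sup>2 = energy m f - energy n f"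
  unfolding L2_norm_diff_sq[OF proj_L2 proj_L2] norm_proj[OF assms(1)] inner_proj_proj[OF assms]
  by simp

lemma energy_mono: "loc_int f \<Longrightarrow> incseq (\<lambda>n. energy n f)"
  unfolding incseq_def using norm_proj_diff[of f] by (metis diff_ge_0_iff_ge zero_le_power2)

lemma energy_le_norm:
  assumes "f \<in> L2 \<mu>"
  shows "energy n f \<le> (L2_norm \<mu> f)\<^sup>2"
proof -
  have "0 \<le> (L2_norm \<mu> (\<lambda>x. f x - proj n f x))\<^sup>2" by simp
  also have "\<dots> = (L2_norm \<mu> f)\<^sup>2 - energy n f"
    unfolding L2_norm_diff_sq[OF assms proj_L2] norm_proj[OF L2_loc_int[OF assms]]
      energy_eq_inner[OF assms refl] by simp
  finally show ?thesis by simp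
qed

text \<open>
  If the energies stay bounded, the projections are Cauchy. Their limit has the same integrals over
  balls as \<open>f\<close>, hence equals \<open>f\<close>. This is how \<open>f\<close> is shown to be the limit of its projections.
\<close>

lemma energy_bounded_imp_L2:
  assumes f: "loc_int f" and bdd: "\<And>n. energy n f \<le> C"
  shows "f \<in> L2 \<mu> \<and> (\<lambda>n. energy n f) \<longlonglongrightarrow> (L2_norm \<mu> f)\<^sup>2"
proof -
  obtain L where L: "(\<lambda>n. energy n f) \<longlonglongrightarrow> L"
    using incseq_convergent[OF energy_mono[OF f]] bdd by blast
  have cau: "\<exists>N. \<forall>m\<ge>N. \<forall>n\<ge>N. L2_norm \<mu> (\<lambda>x. proj m f x - proj n f x) < e" if e: "0 < e" for e
  proof -
    obtain N where N: "\<And>m n. m \<ge> N \<Longrightarrow> n \<ge> N \<Longrightarrow> norm (energy m f - energy n f) < e\<^sup>2"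
      using CauchyD[OF LIMSEQ_imp_Cauchy[OF L], of "e\<^sup>2"] e by auto
    have *: "L2_norm \<mu> (\<lambda>x. proj m f x - proj n f x) < e" if "n \<ge> N" "m \<ge> n" for m n
    proof (rule power2_less_imp_less)
      show "(L2_norm \<mu> (\<lambda>x. proj m f x - proj n f x))\<^sup>2 < e\<^sup>2"
        using N[of m n] that unfolding norm_proj_diff[OF f that(2)] by simp
    qed (use e in simp)
    show ?thesis
    proof (intro exI allI impI)
      fix m n assume "N \<le> m" "N \<le> n"
      then show "L2_norm \<mu> (\<lambda>x. proj m f x - proj n f x) < e"
        using *[of n m] *[of m n] L2_norm_minus_commute[of \<mu> "proj m f" "proj n f"]
        by (cases "n \<le> m") auto
    qed
  qed
  obtain g where g: "L2_lim \<mu> (\<lambda>n. proj n f) g"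
    using L2_complete[of "\<lambda>n. proj n f", OF proj_L2 cau] by blast
  have gL: "g \<in> L2 \<mu>" using g by (simp add: L2_lim_def)
  have "AE x in \<mu>. g x = f x"
  proof (rule loc_int_eqI[OF L2_loc_int[OF gL] f])
    fix a n
    obtain k :: nat where k: "a \<in> pball 0 (- int k)" using exists_pball_0 by blast
    let ?N = "max k (nat \<bar>n\<bar>)"
    have "bint (proj m f) a n = bint f a n" if "m \<ge> ?N" for m
      by (rule bint_proj[OF f])
         (use that k pball_mono[of "- int m" "- int k" 0] in auto)
    then have "(\<lambda>m. bint (proj m f) a n) \<longlonglongrightarrow> bint f a n"
      by (intro tendsto_eventually eventually_sequentiallyI[of ?N]) simp
    moreover have "(\<lambda>m. bint (proj m f) a n) \<longlonglongrightarrow> bint g a n"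
      using L2_lim_inner[OF g indicator_pball_L2[of a n]] by (simp add: L2_inner_indicator)
    ultimately show "bint g a n = bint f a n" using LIMSEQ_unique by blast
  qed
  then have "f \<in> L2 \<mu>" "L2_norm \<mu> g = L2_norm \<mu> f"
    using L2_cong_AE[OF gL] L2_norm_cong_AE[of g \<mu> f] loc_int_measurable[OF f] L2_meas[OF gL] by auto
  moreover have "(\<lambda>n. energy n f) \<longlonglongrightarrow> (L2_norm \<mu> g)\<^sup>2"
    using tendsto_power[OF L2_lim_norm[OF g], of 2] by (simp add: norm_proj f)
  ultimately show ?thesis by simp
qed

lemma energy_tendsto: "f \<in> L2 \<mu> \<Longrightarrow> (\<lambda>n. energy n f) \<longlonglongrightarrow> (L2_norm \<mu> f)\<^sup>2"
  using energy_bounded_imp_L2[OF L2_loc_int] energy_le_norm by blast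

section \<open>Characters\<close>

lemma chi_0 [simp]: "chi 0 = 1"
  by (rule chi_trivial) (simp add: ring_of_integers_def)

lemma chi_minus: "chi (- x) = cnj (chi x)"
proof -
  have "chi x * chi (- x) = 1" using chi_add[of x "- x"] by simp
  moreover have "chi x * cnj (chi x) = 1" using complex_norm_square[of "chi x"] by (simp add: chi_norm)
  ultimately have "cnj (chi x) * (chi x * chi (- x)) = cnj (chi x)" "cnj (chi x) * chi x = 1"
    by (simp_all add: mult.commute)
  then show ?thesis by (simp add: mult.assoc[symmetric])
qed

lemma chi_diff: "chi (x - y) = chi x * cnj (chi y)"
  using chi_add[of x "- y"] by (simp add: chi_minus)

lemma chi_measurable [measurable]: "chi \<in> borel_measurable borel"
  by (rule borel_measurable_continuous_onI[OF chi_continuous])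

lemma chi_mult_measurable [measurable]: "(\<lambda>x. chi (a * x)) \<in> borel_measurable borel"
  by (rule measurable_compose[OF measurable_lf_mult chi_measurable])

lemma chi_const_on_ball:
  assumes "a \<in> pball 0 (- n)" "x \<in> pball b n"
  shows "chi (a * x) = chi (a * b)"
proof -
  have "x - b \<in> pball 0 n" using assms(2) pball_0_shift by blast
  from pball_0_mult[OF assms(1) this] have "chi (a * (x - b)) = 1"
    by (intro chi_trivial) (simp add: ring_of_integers_eq)
  then show ?thesis using chi_add[of "a * (x - b)" "a * b"] by (simp add: right_diff_distrib)
qed

lemma loc_int_chi_mult: "loc_int f \<Longrightarrow> loc_int (\<lambda>x. f x * chi (a * x))"
  by (rule loc_int_bounded_mult) (auto simp: chi_norm)

lemma loc_int_cnj_chi_mult: "loc_int f \<Longrightarrow> loc_int (\<lambda>x. f x * cnj (chi (a * x)))"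
  by (rule loc_int_bounded_mult) (auto simp: chi_norm)

lemma loc_int_const: "loc_int (\<lambda>_. z :: complex)"
proof -
  have "set_integrable \<mu> (pball 0 n) (\<lambda>_. z)" for n
    unfolding set_integrable_def
    by (intro integrable_scaleR_left integrable_real_indicator) (simp_all add: emeasure_pball)
  then show ?thesis by (simp add: loc_int_def)
qed

lemma loc_int_chi: "loc_int (\<lambda>x. chi (a * x))"
  using loc_int_chi_mult[OF loc_int_const, of 1] by simp

text \<open>
  If \<open>chi (a * _)\<close> is not trivial on \<open>\<pp>^(-n) * \<O>\<close>, translating by a point \<open>t\<close> of this ball with
  \<open>chi (a * t) \<noteq> 1\<close> multiplies the integral by \<open>chi (a * t)\<close>, so it vanishes.
\<close>

lemma bint_chi:
  "bint (\<lambda>x. chi (a * x)) 0 (- n) = (if a \<in> pball 0 n then qpow n else 0)"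
proof (cases "a \<in> pball 0 n")
  case True
  have "bint (\<lambda>x. chi (a * x)) 0 (- n) = bint (\<lambda>_. 1) 0 (- n)"
    by (rule bint_cong) (use True chi_const_on_ball[of a "- n" _ 0] in simp)
  then show ?thesis using True by (simp add: bint_const)
next
  case False
  obtain y where y: "absv y \<le> 1" "chi (inverse \<pp> * y) \<noteq> 1"
    using chi_nontrivial by (auto simp: ring_of_integers_def)
  \<comment> \<open>Since values of \<open>absv\<close> are powers of \<open>q\<close>, \<open>\<bar>a\<bar> > q^(-n)\<close> gives \<open>\<bar>a\<bar> \<ge> q^(1 - n)\<close>, so \<open>t\<close> is in the ball.\<close>
  define t where "t = inverse \<pp> * y / a"
  have a0: "a \<noteq> 0" using False by (auto simp: pball_def)
  have "real q powi (1 - n) \<le> absv a"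
    using False absv_less_powi[of a "1 - n"] by (force simp: pball_def)
  then have "real q powi (1 - n) * real q powi n \<le> absv a * real q powi n"
    by (intro mult_right_mono) auto
  then have *: "real q \<le> absv a * real q powi n"
    by (simp flip: power_int_add)
  have "absv t * absv a = absv y * real q"
    using a0 by (simp add: t_def absv_mult[symmetric]) (simp add: absv_mult absv_prime_element)
  also have "\<dots> \<le> real q" using mult_right_mono[OF y(1), of "real q"] by simp
  also note *
  finally have "absv t * absv a \<le> real q powi n * absv a" by (simp only: mult.commute)
  then have t: "t \<in> pball 0 (- n)" using a0 by (simp add: pball_def)
  have at: "chi (a * t) \<noteq> 1" using y a0 by (simp add: t_def)
  have "bint (\<lambda>x. chi (a * x)) 0 (- n)
      = (LINT x|\<mu>. indicator (pball 0 (- n)) (x + t) *\<^sub>R chi (a * (x + t)))"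
    unfolding set_lebesgue_integral_def by (subst integral_translate) simp_all
  also have "\<dots> = (LINT x|\<mu>. chi (a * t) * (indicator (pball 0 (- n)) x *\<^sub>R chi (a * x)))"
  proof (rule Bochner_Integration.integral_cong)
    fix x
    have "x + t \<in> pball 0 (- n) \<longleftrightarrow> x \<in> pball 0 (- n)"
      using pball_0_add[OF _ t] pball_0_diff[OF _ t, of "x + t"] by auto
    then show "indicator (pball 0 (- n)) (x + t) *\<^sub>R chi (a * (x + t))
        = chi (a * t) * (indicator (pball 0 (- n)) x *\<^sub>R chi (a * x))"
      by (simp add: indicator_def distrib_left chi_add)
  qed simp
  also have "\<dots> = chi (a * t) * bint (\<lambda>x. chi (a * x)) 0 (- n)"
    unfolding set_lebesgue_integral_def by (rule integral_mult_right_zero)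
  finally have "(chi (a * t) - 1) * bint (\<lambda>x. chi (a * x)) 0 (- n) = 0"
    by (simp add: left_diff_distrib)
  then show ?thesis using at False by simp
qed

lemma chi_orthogonality:
  assumes "M \<le> N" "d \<in> pball 0 (- N)"
  shows "(\<Sum>k<q ^ nat (N - M). chi (rep N k * d))
    = (if d \<in> pball 0 (- M) then qpow (N - M) else 0)"
proof -
  have "bint (\<lambda>x. chi (d * x)) 0 M = (\<Sum>k<q ^ nat (N - M). bint (\<lambda>x. chi (d * x)) (rep N k) N)"
    by (rule bint_0_sum[OF loc_int_chi assms(1)])
  also have "\<dots> = (\<Sum>k<q ^ nat (N - M). bint (\<lambda>x. chi (d * rep N k)) (rep N k) N)"
    by (intro sum.cong refl bint_cong chi_const_on_ball[OF assms(2)])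
  also have "\<dots> = qpow (- N) * (\<Sum>k<q ^ nat (N - M). chi (rep N k * d))"
    unfolding bint_const by (simp add: sum_distrib_left mult.commute)
  finally have *: "qpow N * bint (\<lambda>x. chi (d * x)) 0 M
      = complex_of_real (real q powi N * real q powi (- N)) * (\<Sum>k<q ^ nat (N - M). chi (rep N k * d))"
    by (simp only: of_real_mult mult.assoc)
  have "real q powi N * real q powi (- N) = 1" by (simp flip: power_int_add)
  with * have S: "(\<Sum>k<q ^ nat (N - M). chi (rep N k * d))
      = qpow N * bint (\<lambda>x. chi (d * x)) 0 M"
    by (simp only: of_real_1 mult_1_left)
  have "real q powi N * real q powi (- M) = real q powi (N - M)"
    using power_int_add[of "real q" N "- M"] by simp
  then show ?thesis
    unfolding S using bint_chi[where a = d and n = "- M"]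
    by (simp only: minus_minus of_real_mult[symmetric] mult_zero_right split: if_split) simp
qed

section \<open>Fourier pairs\<close>

lemma integrable_translate:
  fixes f :: "'a \<Rightarrow> complex"
  assumes [measurable]: "f \<in> borel_measurable borel"
  shows "integrable \<mu> (\<lambda>x. f (x + t)) \<longleftrightarrow> integrable \<mu> f"
proof -
  have "integrable \<mu> (\<lambda>x. f (x + t)) \<longleftrightarrow> integrable (distr \<mu> \<mu> (\<lambda>x. x + t)) f"
    by (subst integrable_distr_eq) simp_all
  then show ?thesis by (simp only: distr_mu_translate)
qed

lemma integrable_dilate:
  fixes f :: "'a \<Rightarrow> complex"
  assumes [measurable]: "f \<in> borel_measurable borel"
  shows "integrable \<mu> (\<lambda>x. f (\<pp> powi j * x)) \<longleftrightarrow> integrable \<mu> f"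
proof -
  have "integrable \<mu> (\<lambda>x. f (\<pp> powi j * x)) \<longleftrightarrow> integrable (distr \<mu> \<mu> (\<lambda>x. \<pp> powi j * x)) f"
    by (subst integrable_distr_eq) simp_all
  also have "\<dots> \<longleftrightarrow> integrable \<mu> f"
  proof -
    let ?r = "real q powi j"
    have "integrable \<mu> (\<lambda>x. ?r *\<^sub>R f x) \<longleftrightarrow> integrable \<mu> f"
      using integrable_scaleR_right[of "inverse ?r" \<mu> "\<lambda>x. ?r *\<^sub>R f x"]
        integrable_scaleR_right[of ?r \<mu> f] by auto
    then show ?thesis
      unfolding distr_mu_dilate by (subst integrable_density) simp_all
  qed
  finally show ?thesis .
qed

text \<open>
  \<open>fpair f g\<close> says that \<open>g\<close> is the Fourier transform of \<open>f\<close>, in the weak form obtained by testing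
  against indicators of balls: the transform of the indicator of \<open>a + \<pp>^n * \<O>\<close> is
  \<open>q^(-n)\<close> times the conjugate of \<open>chi (a * \<xi>)\<close> on \<open>\<pp>^(-n) * \<O>\<close>. It only needs local integrability, so it
  covers the integral formula on \<open>L1\<close> and its extension to \<open>L2\<close> at once.
\<close>

definition fpair :: "('a \<Rightarrow> complex) \<Rightarrow> ('a \<Rightarrow> complex) \<Rightarrow> bool" where
  "fpair f g \<longleftrightarrow> loc_int f \<and> loc_int g \<and>
     (\<forall>a n. bint (\<lambda>\<xi>. g \<xi> * chi (a * \<xi>)) 0 (- n) = qpow n * bint f a n)"

lemma fpairD:
  "fpair f g \<Longrightarrow> bint (\<lambda>\<xi>. g \<xi> * chi (a * \<xi>)) 0 (- n) = qpow n * bint f a n"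
  and fpair_loc_int: "fpair f g \<Longrightarrow> loc_int f" "fpair f g \<Longrightarrow> loc_int g"
  by (auto simp: fpair_def)

lemma bint_add: "loc_int f \<Longrightarrow> loc_int g \<Longrightarrow> bint (\<lambda>x. f x + g x) a n = bint f a n + bint g a n"
  by (rule set_integral_add(2)) (auto intro: loc_int_set_integrable)

lemma fpair_add:
  assumes "fpair f g" "fpair f' g'"
  shows "fpair (\<lambda>x. f x + f' x) (\<lambda>x. g x + g' x)"
  using assms unfolding fpair_def
  by (auto simp: distrib_right distrib_left bint_add loc_int_chi_mult intro!: loc_int_add)

lemma fpair_cmult:
  assumes "fpair f g"
  shows "fpair (\<lambda>x. z * f x) (\<lambda>x. z * g x)"
  using assms unfolding fpair_def
  by (auto simp: mult.assoc loc_int_cmult)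

lemma fpair_diff:
  assumes "fpair f g" "fpair f' g'"
  shows "fpair (\<lambda>x. f x - f' x) (\<lambda>x. g x - g' x)"
  using fpair_add[OF assms(1) fpair_cmult[OF assms(2), of "-1"]] by simp

lemma fpair_zero: "fpair (\<lambda>_. 0) (\<lambda>_. 0)"
  by (simp add: fpair_def loc_int_const)

text \<open>
  Fourier inversion, in the form of a symmetry of \<open>fpair\<close>. Splitting \<open>\<pp>^(-m) * \<O>\<close> into cosets of a
  small ball turns the left-hand side into a finite sum of character values, which orthogonality
  evaluates.
\<close>

lemma fpair_swap:
  assumes "fpair f g"
  shows "fpair (\<lambda>x. cnj (g x)) (\<lambda>x. cnj (f x))"
proof -
  note li = fpair_loc_int[OF assms]
  have D: "bint (\<lambda>x. f x * cnj (chi (b * x))) 0 (- m) = qpow m * bint g b m" for b m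
  proof -
    obtain j :: nat where j: "b \<in> pball 0 (- int j)" using exists_pball_0 by blast
    \<comment> \<open>So large that \<open>b + \<pp>^m * \<O>\<close> lies in \<open>\<pp>^(-n) * \<O>\<close> and \<open>chi (b * _)\<close> is constant on cosets of \<open>\<pp>^n * \<O>\<close>.\<close>
    define n where "n = max (int j) \<bar>m\<bar>"
    have n: "- m \<le> n" "- n \<le> m" by (auto simp: n_def)
    have bn: "b \<in> pball 0 (- n)" using j pball_mono[of "- n" "- int j" 0] by (auto simp: n_def)
    let ?K = "q ^ nat (n - - m)"
    let ?t = "\<lambda>k \<xi>. g \<xi> * chi (rep n k * \<xi>) * cnj (chi (b * rep n k))"
    have bsub: "pball b m \<subseteq> pball 0 (- n)" by (rule pball_subset[OF n(2) bn])
    have "bint (\<lambda>x. f x * cnj (chi (b * x))) 0 (- m)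
        = (\<Sum>k<?K. bint (\<lambda>x. f x * cnj (chi (b * x))) (rep n k) n)"
      by (rule bint_0_sum[OF loc_int_cnj_chi_mult[OF li(1)] n(1)])
    also have "\<dots> = (\<Sum>k<?K. bint (\<lambda>x. f x * cnj (chi (b * rep n k))) (rep n k) n)"
      by (intro sum.cong refl bint_cong) (simp add: chi_const_on_ball[OF bn])
    also have "\<dots> = (\<Sum>k<?K. qpow (- n) *
        bint (?t k) 0 (- n))"
    proof (rule sum.cong[OF refl])
      fix k
      have "qpow (- n) * bint (?t k) 0 (- n)
        = qpow (- n) * (qpow n * bint f (rep n k) n * cnj (chi (b * rep n k)))"
        by (simp only: bint_multc fpairD[OF assms])
      also have "\<dots> = complex_of_real (real q powi (- n) * real q powi n) * bint f (rep n k) n * cnj (chi (b * rep n k))"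
        by (simp only: of_real_mult mult.assoc)
      also have "real q powi (- n) * real q powi n = 1" by (simp flip: power_int_add)
      finally show "bint (\<lambda>x. f x * cnj (chi (b * rep n k))) (rep n k) n = qpow (- n) *
        bint (?t k) 0 (- n)"
        by (simp only: bint_multc) simp
    qed
    also have "\<dots> = qpow (- n) *
        bint (\<lambda>\<xi>. \<Sum>k<?K. ?t k \<xi>) 0 (- n)"
      unfolding sum_distrib_left[symmetric]
      by (subst bint_sum)
         (auto intro!: loc_int_bounded_mult[OF loc_int_chi_mult[OF li(2)]] simp: chi_norm)
    also have "bint (\<lambda>\<xi>. \<Sum>k<?K. ?t k \<xi>) 0 (- n)
        = bint (\<lambda>\<xi>. g \<xi> * (if \<xi> \<in> pball b m then qpow (n + m) else 0)) 0 (- n)"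
    proof (rule bint_cong)
      fix \<xi> assume xi: "\<xi> \<in> pball 0 (- n)"
      have "(\<Sum>k<?K. ?t k \<xi>)
          = g \<xi> * (\<Sum>k<?K. chi (rep n k * (\<xi> - b)))"
        unfolding sum_distrib_left
        by (intro sum.cong refl) (simp add: right_diff_distrib chi_diff mult.commute[of b])
      also have "(\<Sum>k<?K. chi (rep n k * (\<xi> - b)))
          = (if \<xi> - b \<in> pball 0 (- (- m)) then qpow (n - - m) else 0)"
        by (rule chi_orthogonality[OF n(1) pball_0_diff[OF xi bn]])
      finally show "(\<Sum>k<?K. ?t k \<xi>)
        = g \<xi> * (if \<xi> \<in> pball b m then qpow (n + m) else 0)"
        using pball_0_shift[of \<xi> b m] by simp
    qed
    also have "\<dots> = (LINT \<xi>|\<mu>. qpow (n + m) * (indicator (pball b m) \<xi> *\<^sub>R g \<xi>))"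
      unfolding set_lebesgue_integral_def
      by (intro Bochner_Integration.integral_cong refl) (use bsub in \<open>auto simp: indicator_def\<close>)
    also have "\<dots> = qpow (n + m) * bint g b m"
      unfolding set_lebesgue_integral_def by (rule integral_mult_right_zero)
    also have "qpow (- n) * (qpow (n + m) * bint g b m)
        = complex_of_real (real q powi (- n) * real q powi (n + m)) * bint g b m"
      by (simp only: of_real_mult mult.assoc)
    also have "real q powi (- n) * real q powi (n + m) = real q powi m"
      by (simp flip: power_int_add)
    finally show ?thesis .
  qed
  have "bint (\<lambda>\<xi>. cnj (f \<xi>) * chi (a * \<xi>)) 0 (- n) = qpow n * bint (\<lambda>x. cnj (g x)) a n" for a n
  proof -
    have "bint (\<lambda>\<xi>. cnj (f \<xi>) * chi (a * \<xi>)) 0 (- n) = cnj (bint (\<lambda>x. f x * cnj (chi (a * x))) 0 (- n))"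
      by (subst bint_cnj[symmetric]) simp
    also have "\<dots> = qpow n * bint (\<lambda>x. cnj (g x)) a n"
      unfolding D bint_cnj complex_cnj_mult complex_cnj_complex_of_real ..
    finally show ?thesis .
  qed
  then show ?thesis using li by (simp add: fpair_def loc_int_cnj)
qed

text \<open>Plancherel's identity for the projections, which is Parseval's identity on a finite group.\<close>

lemma fpair_energy:
  assumes "fpair f g"
  shows "energy n f = energy n g"
proof -
  let ?K = "q ^ (2 * n)" and ?r = "rep (int n)"
  let ?\<beta> = "\<lambda>l. bint g (?r l) n"
  let ?Q = "complex_of_real (real q ^ (2 * n))"
  have K: "nat (int n - - int n) = 2 * n" by simp
  have rb: "?r k \<in> pball 0 (- int n)" if "k < ?K" for k
    by (rule rep_in_pball) (use that K in simp_all)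
  \<comment> \<open>The integrals of \<open>f\<close> over small balls are the finite Fourier transform of those of \<open>g\<close>.\<close>
  have alpha: "complex_of_real (real q ^ n) * bint f (?r k) n = (\<Sum>l<?K. ?\<beta> l * chi (?r k * ?r l))"
    if "k < ?K" for k
  proof -
    have "complex_of_real (real q ^ n) * bint f (?r k) n = bint (\<lambda>\<xi>. g \<xi> * chi (?r k * \<xi>)) 0 (- int n)"
      using fpairD[OF assms, where a = "?r k" and n = "int n"] by simp
    also have "\<dots> = (\<Sum>l<q ^ nat (int n - - int n). bint (\<lambda>\<xi>. g \<xi> * chi (?r k * \<xi>)) (?r l) n)"
      by (rule bint_0_sum[OF loc_int_chi_mult[OF fpair_loc_int(2)[OF assms]]]) simp
    also have "\<dots> = (\<Sum>l<?K. bint (\<lambda>\<xi>. g \<xi> * chi (?r k * \<xi>)) (?r l) n)"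
      by (simp only: K)
    also have "\<dots> = (\<Sum>l<?K. bint (\<lambda>\<xi>. g \<xi> * chi (?r k * ?r l)) (?r l) n)"
      by (intro sum.cong refl bint_cong) (simp add: chi_const_on_ball[OF rb[OF that]])
    also have "\<dots> = (\<Sum>l<?K. ?\<beta> l * chi (?r k * ?r l))"
      by (simp only: bint_multc)
    finally show ?thesis .
  qed
  have orth: "(\<Sum>k<?K. chi (?r k * ?r l) * cnj (chi (?r k * ?r l'))) = (if l = l' then ?Q else 0)"
    if l: "l < ?K" "l' < ?K" for l l'
  proof -
    have "(\<Sum>k<?K. chi (?r k * ?r l) * cnj (chi (?r k * ?r l'))) = (\<Sum>k<?K. chi (?r k * (?r l - ?r l')))"
      by (intro sum.cong refl) (simp add: right_diff_distrib chi_diff)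
    also have "\<dots> = (\<Sum>k<q ^ nat (int n - - int n). chi (?r k * (?r l - ?r l')))"
      by (simp only: K)
    also have "\<dots> = (if ?r l - ?r l' \<in> pball 0 (- (- int n)) then qpow (int n - - int n) else 0)"
      by (rule chi_orthogonality) (use pball_0_diff[OF rb[OF l(1)] rb[OF l(2)]] in auto)
    also have "?r l - ?r l' \<in> pball 0 (- (- int n)) \<longleftrightarrow> l = l'"
    proof (cases "l = l'")
      case True
      then show ?thesis using pball_0_shift[of "?r l" "?r l'" n] by simp
    next
      case False
      then show ?thesis
        using rep_disjoint[of l l' n] pball_0_shift[of "?r l" "?r l'" n] center_in_pball[of "?r l" n]
        unfolding minus_minus by blast
    qed
    also have "real q powi (int n - - int n) = real q ^ (2 * n)"
      unfolding power_int_def using K by simp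
    finally show ?thesis .
  qed
  have "?Q * (\<Sum>k<?K. complex_of_real ((cmod (bint f (?r k) n))\<^sup>2))
      = (\<Sum>k<?K. (complex_of_real (real q ^ n) * bint f (?r k) n) * cnj (complex_of_real (real q ^ n) * bint f (?r k) n))"
    unfolding sum_distrib_left
    unfolding complex_norm_square mult_2 power_add
    by (intro sum.cong refl) (simp add: mult_ac)
  also have "\<dots> = (\<Sum>k<?K. (\<Sum>l<?K. ?\<beta> l * chi (?r k * ?r l)) * cnj (\<Sum>l<?K. ?\<beta> l * chi (?r k * ?r l)))"
    by (intro sum.cong refl) (simp only: alpha lessThan_iff)
  also have "\<dots> = (\<Sum>k<?K. \<Sum>l<?K. \<Sum>l'<?K. ?\<beta> l * cnj (?\<beta> l') * (chi (?r k * ?r l) * cnj (chi (?r k * ?r l'))))"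
    unfolding cnj_sum sum_product by (intro sum.cong refl) (simp add: mult_ac)
  also have "\<dots> = (\<Sum>l<?K. \<Sum>k<?K. \<Sum>l'<?K. ?\<beta> l * cnj (?\<beta> l') * (chi (?r k * ?r l) * cnj (chi (?r k * ?r l'))))"
    by (rule sum.swap)
  also have "\<dots> = (\<Sum>l<?K. \<Sum>l'<?K. \<Sum>k<?K. ?\<beta> l * cnj (?\<beta> l') * (chi (?r k * ?r l) * cnj (chi (?r k * ?r l'))))"
    by (intro sum.cong refl sum.swap)
  also have "\<dots> = (\<Sum>l<?K. \<Sum>l'<?K. if l = l' then ?Q * (?\<beta> l * cnj (?\<beta> l')) else 0)"
    unfolding sum_distrib_left[symmetric] by (intro sum.cong refl) (simp add: orth)
  also have "\<dots> = (\<Sum>l<?K. ?Q * (?\<beta> l * cnj (?\<beta> l)))"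
    by (intro sum.cong refl) simp
  also have "\<dots> = ?Q * (\<Sum>l<?K. complex_of_real ((cmod (?\<beta> l))\<^sup>2))"
    unfolding complex_norm_square sum_distrib_left ..
  finally have "(\<Sum>k<?K. complex_of_real ((cmod (bint f (?r k) n))\<^sup>2)) = (\<Sum>l<?K. complex_of_real ((cmod (?\<beta> l))\<^sup>2))"
    by simp
  then have "(\<Sum>k<?K. (cmod (bint f (?r k) n))\<^sup>2) = (\<Sum>l<?K. (cmod (?\<beta> l))\<^sup>2)"
    unfolding of_real_sum[symmetric] of_real_eq_iff .
  then show ?thesis by (simp add: energy_def)
qed

text \<open>
  Equal energies at every level pass to the limit. Square-integrability of \<open>g\<close> is part of the
  conclusion, since bounded energies characterize \<open>L2\<close>.
\<close>

lemma fpair_L2: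
  assumes "fpair f g" "f \<in> L2 \<mu>"
  shows "g \<in> L2 \<mu>" "L2_norm \<mu> g = L2_norm \<mu> f"
proof -
  note li = fpair_loc_int[OF assms(1)]
  have 1: "g \<in> L2 \<mu> \<and> (\<lambda>n. energy n g) \<longlonglongrightarrow> (L2_norm \<mu> g)\<^sup>2"
    by (rule energy_bounded_imp_L2[OF li(2), of "(L2_norm \<mu> f)\<^sup>2"])
       (use energy_le_norm[OF assms(2)] fpair_energy[OF assms(1)] in simp)
  have "(\<lambda>n. energy n g) \<longlonglongrightarrow> (L2_norm \<mu> f)\<^sup>2"
    using energy_tendsto[OF assms(2)] fpair_energy[OF assms(1)] by simp
  with 1 have "(L2_norm \<mu> g)\<^sup>2 = (L2_norm \<mu> f)\<^sup>2" using LIMSEQ_unique by blast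
  then show "L2_norm \<mu> g = L2_norm \<mu> f" by simp
  show "g \<in> L2 \<mu>" using 1 by simp
qed

lemma fpair_L2_left: "fpair f g \<Longrightarrow> g \<in> L2 \<mu> \<Longrightarrow> f \<in> L2 \<mu>"
  using fpair_L2(1)[OF fpair_swap, of f g] L2_cnj[of g \<mu>] L2_cnj[of "\<lambda>x. cnj (f x)" \<mu>] by simp

lemma fpair_plancherel_nn:
  assumes "fpair f g"
  shows "(\<integral>\<^sup>+x. esq (g x) \<partial>\<mu>) = (\<integral>\<^sup>+x. esq (f x) \<partial>\<mu>)"
proof (cases "f \<in> L2 \<mu>")
  case True
  then show ?thesis using fpair_L2[OF assms] by (simp add: nn_eq_L2_norm)
next
  case False
  then have "g \<notin> L2 \<mu>" using fpair_L2_left[OF assms] by blast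
  with False show ?thesis
    using fpair_loc_int[OF assms, THEN loc_int_measurable]
    by (simp add: L2_iff_nn not_less top.extremum_unique)
qed

lemma fpair_inner:
  assumes "fpair f g" "fpair f' g'" "f \<in> L2 \<mu>" "f' \<in> L2 \<mu>"
  shows "L2_inner \<mu> f f' = L2_inner \<mu> g g'"
proof (rule L2_inner_polarization)
  show "L2_norm \<mu> (\<lambda>x. f x + z * f' x) = L2_norm \<mu> (\<lambda>x. g x + z * g' x)" for z
    by (rule fpair_L2(2)[symmetric, OF fpair_add[OF assms(1) fpair_cmult[OF assms(2)]]])
       (intro L2_add L2_scale assms)
qed (use assms fpair_L2 in auto)

lemma fpair_lim:
  assumes lim: "L2_lim \<mu> F f" "L2_lim \<mu> G g" and FG: "\<And>n. fpair (F n) (G n)"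
  shows "fpair f g"
proof -
  have L: "f \<in> L2 \<mu>" "g \<in> L2 \<mu>" using lim by (auto simp: L2_lim_def)
  have "bint (\<lambda>\<xi>. g \<xi> * chi (a * \<xi>)) 0 (- n) = qpow n * bint f a n" for a n
  proof -
    let ?t = "\<lambda>\<xi>. cnj (chi (a * \<xi>)) * indicator (pball 0 (- n)) \<xi>"
    have t: "?t \<in> L2 \<mu>"
      by (rule L2_bounded_mult[OF indicator_pball_L2]) (auto simp: chi_norm)
    have b: "bint (\<lambda>\<xi>. h \<xi> * chi (a * \<xi>)) 0 (- n) = L2_inner \<mu> h ?t" for h
      unfolding L2_inner_def set_lebesgue_integral_def
      by (intro Bochner_Integration.integral_cong) (auto simp: indicator_def)
    have "L2_inner \<mu> (G k) ?t = qpow n * bint (F k) a n" for k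
      using fpairD[OF FG[of k], where a = a and n = n] b[of "G k"] by simp
    then have "(\<lambda>k. qpow n * bint (F k) a n) \<longlonglongrightarrow> L2_inner \<mu> g ?t"
      using L2_lim_inner[OF lim(2) t] by (simp only:)
    moreover have "(\<lambda>k. qpow n * bint (F k) a n)
        \<longlonglongrightarrow> qpow n * bint f a n"
      using L2_lim_inner[OF lim(1) indicator_pball_L2] unfolding L2_inner_indicator
      by (intro tendsto_mult tendsto_const)
    ultimately show ?thesis unfolding b by (rule LIMSEQ_unique)
  qed
  then show ?thesis using L L2_loc_int by (simp add: fpair_def)
qed

section \<open>The Fourier transform\<close>

lemma fourier_L1_bound:
  "integrable \<mu> F \<Longrightarrow> cmod (fourier_L1 \<mu> chi F \<xi>) \<le> (LINT x|\<mu>. cmod (F x))"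
  unfolding fourier_L1_def using integral_norm_bound[of \<mu> "\<lambda>x. F x * cnj (chi (\<xi> * x))"]
  by (simp add: norm_mult chi_norm)

lemma integrable_mult_chi:
  "integrable \<mu> F \<Longrightarrow> integrable \<mu> (\<lambda>x. F x * cnj (chi (\<xi> * x)))"
  by (rule Bochner_Integration.integrable_bound[of \<mu> F])
     (auto simp: norm_mult chi_norm dest: borel_measurable_integrable)

lemma fourier_L1_continuous:
  assumes F: "integrable \<mu> F"
  shows "continuous_on UNIV (fourier_L1 \<mu> chi F)"
proof -
  have [measurable]: "F \<in> borel_measurable borel" using borel_measurable_integrable[OF F] by simp
  have "(\<lambda>n. fourier_L1 \<mu> chi F (X n)) \<longlonglongrightarrow> fourier_L1 \<mu> chi F \<xi>" if X: "X \<longlonglongrightarrow> \<xi>" for X \<xi>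
    unfolding fourier_L1_def
  proof (rule integral_dominated_convergence[of _ _ _ "\<lambda>x. cmod (F x)"])
    have "(\<lambda>n. chi (X n * x)) \<longlonglongrightarrow> chi (\<xi> * x)" for x
    proof -
      have "continuous_on UNIV (\<lambda>\<xi>. chi (x * \<xi>))"
        by (rule continuous_on_compose2[OF chi_continuous continuous_on_lf_mult]) auto
      then show ?thesis
        using X unfolding continuous_on_sequentially by (auto simp: o_def mult.commute)
    qed
    then show "AE x in \<mu>. (\<lambda>n. F x * cnj (chi (X n * x))) \<longlonglongrightarrow> F x * cnj (chi (\<xi> * x))"
      by (intro AE_I2 tendsto_intros)
  qed (use F in \<open>auto simp: norm_mult chi_norm\<close>)
  then show ?thesis by (auto simp: continuous_on_sequentially o_def)
qed

lemma fourier_L1_measurable [measurable]: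
  "integrable \<mu> F \<Longrightarrow> fourier_L1 \<mu> chi F \<in> borel_measurable borel"
  by (rule borel_measurable_continuous_onI[OF fourier_L1_continuous])

lemma loc_int_fourier_L1: "integrable \<mu> F \<Longrightarrow> loc_int (fourier_L1 \<mu> chi F)"
  by (rule loc_int_bound[OF loc_int_const[of "complex_of_real (LINT x|\<mu>. cmod (F x))"]])
     (auto simp: fourier_L1_bound intro: order_trans[OF fourier_L1_bound])

text \<open>
  The transform of a function supported in \<open>\<pp>^(-N) * \<O>\<close> is constant on cosets of \<open>\<pp>^N * \<O>\<close>, so the
  integral over a ball is a finite sum and may be exchanged with the integral defining the
  transform. The general case follows by truncation.
\<close>

lemma fpair_fourier_L1:
  assumes F: "integrable \<mu> F"
  shows "fpair F (fourier_L1 \<mu> chi F)"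
proof -
  have [measurable]: "F \<in> borel_measurable borel" using borel_measurable_integrable[OF F] by simp
  let ?C = "LINT x|\<mu>. cmod (F x)"
  define T where "T N x = indicator (pball 0 (- int N)) x *\<^sub>R F x" for N x
  have T: "integrable \<mu> (T N)" for N
    unfolding T_def by (rule integrable_mult_indicator[OF _ F]) simp
  have [measurable]: "T N \<in> borel_measurable borel" for N
    using borel_measurable_integrable[OF T] by simp
  have Tle: "cmod (T N x) \<le> cmod (F x)" for N x by (simp add: T_def indicator_def)
  have Tlim: "(\<lambda>N. T N x) \<longlonglongrightarrow> F x" for x
  proof -
    obtain k :: nat where k: "x \<in> pball 0 (- int k)" using exists_pball_0 by blast
    have "T N x = F x" if "N \<ge> k" for N
      using k pball_mono[of "- int N" "- int k" 0] that by (auto simp: T_def)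
    then show ?thesis by (intro tendsto_eventually eventually_sequentiallyI)
  qed
  let ?h = "\<lambda>N. fourier_L1 \<mu> chi (T N)"
  have hlim: "(\<lambda>N. ?h N \<xi>) \<longlonglongrightarrow> fourier_L1 \<mu> chi F \<xi>" for \<xi>
    unfolding fourier_L1_def
    by (rule integral_dominated_convergence[of _ _ _ "\<lambda>x. cmod (F x)"])
       (use F Tle Tlim in \<open>auto simp: norm_mult chi_norm intro!: AE_I2 tendsto_intros\<close>)
  have hb: "cmod (?h N \<xi>) \<le> ?C" for N \<xi>
    by (rule order_trans[OF fourier_L1_bound[OF T]])
       (auto intro!: Bochner_Integration.integral_mono Tle integrable_norm T F)
  have "bint (\<lambda>\<xi>. fourier_L1 \<mu> chi F \<xi> * chi (a * \<xi>)) 0 (- n)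
      = qpow n * bint F a n" for a n
  proof -
    obtain k :: nat where k: "a \<in> pball 0 (- int k)" using exists_pball_0 by blast
    let ?N = "max k (nat \<bar>n\<bar>)"
    have ev: "bint (\<lambda>\<xi>. ?h N \<xi> * chi (a * \<xi>)) 0 (- n) = qpow n * bint F a n"
      if "N \<ge> ?N" for N
    proof -
      have nN: "- n \<le> int N" "- int N \<le> n" using that by auto
      have aN: "a \<in> pball 0 (- int N)"
        using k pball_mono[of "- int N" "- int k" 0] that by auto
      have sub: "pball a n \<subseteq> pball 0 (- int N)" by (rule pball_subset[OF nN(2) aN])
      let ?K = "q ^ nat (int N - - n)" and ?r = "rep (int N)"
      have hconst: "?h N \<xi> = ?h N b" if "\<xi> \<in> pball b (int N)" for \<xi> b
        unfolding fourier_L1_def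
      proof (rule Bochner_Integration.integral_cong[OF refl])
        fix x
        have "chi (\<xi> * x) = chi (b * x)" if "x \<in> pball 0 (- int N)"
          using chi_const_on_ball[OF that \<open>\<xi> \<in> pball b (int N)\<close>] by (simp add: mult.commute)
        then show "T N x * cnj (chi (\<xi> * x)) = T N x * cnj (chi (b * x))"
          by (cases "x \<in> pball 0 (- int N)") (auto simp: T_def)
      qed
      have "bint (\<lambda>\<xi>. ?h N \<xi> * chi (a * \<xi>)) 0 (- n)
          = (\<Sum>k<?K. bint (\<lambda>\<xi>. ?h N \<xi> * chi (a * \<xi>)) (?r k) N)"
        by (rule bint_0_sum[OF loc_int_chi_mult[OF loc_int_fourier_L1[OF T]] nN(1)])
      also have "\<dots> = (\<Sum>k<?K. bint (\<lambda>\<xi>. ?h N (?r k) * chi (a * ?r k)) (?r k) N)"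
        by (intro sum.cong refl bint_cong) (simp only: hconst chi_const_on_ball[OF aN])
      also have "\<dots> = qpow (- int N) * (\<Sum>k<?K. ?h N (?r k) * chi (a * ?r k))"
        by (simp only: bint_const sum_distrib_left)
      also have "(\<Sum>k<?K. ?h N (?r k) * chi (a * ?r k))
          = (LINT x|\<mu>. (\<Sum>k<?K. T N x * cnj (chi (?r k * x)) * chi (a * ?r k)))"
        unfolding fourier_L1_def
        by (subst Bochner_Integration.integral_sum)
           (auto intro!: integrable_mult_left integrable_mult_chi T)
      also have "\<dots> = (LINT x|\<mu>. qpow (int N + n) * (indicator (pball a n) x *\<^sub>R F x))"
      proof (rule Bochner_Integration.integral_cong[OF refl])
        fix x
        show "(\<Sum>k<?K. T N x * cnj (chi (?r k * x)) * chi (a * ?r k))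
          = qpow (int N + n) * (indicator (pball a n) x *\<^sub>R F x)"
        proof (cases "x \<in> pball 0 (- int N)")
          case True
          have "(\<Sum>k<?K. T N x * cnj (chi (?r k * x)) * chi (a * ?r k))
              = F x * (\<Sum>k<?K. chi (?r k * (a - x)))"
            unfolding sum_distrib_left
            by (intro sum.cong refl) (use True in \<open>simp add: T_def right_diff_distrib chi_diff mult.commute[of a]\<close>)
          also have "(\<Sum>k<?K. chi (?r k * (a - x)))
              = (if a - x \<in> pball 0 (- (- n)) then qpow (int N - - n) else 0)"
            by (rule chi_orthogonality[OF nN(1) pball_0_diff[OF aN True]])
          finally show ?thesis
            using pball_0_shift[of a x n] pball_sym[of a x n] by (simp add: indicator_def)
        next
          case False
          then show ?thesis using sub by (auto simp: T_def indicator_def)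
        qed
      qed
      also have "\<dots> = qpow (int N + n) * bint F a n"
        unfolding set_lebesgue_integral_def by (rule integral_mult_right_zero)
      also have "qpow (- int N) * (qpow (int N + n) * bint F a n)
          = complex_of_real (real q powi (- int N) * real q powi (int N + n)) * bint F a n"
        by (simp only: of_real_mult mult.assoc)
      also have "real q powi (- int N) * real q powi (int N + n) = real q powi n"
        by (simp flip: power_int_add)
      finally show ?thesis .
    qed
    have "(\<lambda>N. bint (\<lambda>\<xi>. ?h N \<xi> * chi (a * \<xi>)) 0 (- n)) \<longlonglongrightarrow> bint (\<lambda>\<xi>. fourier_L1 \<mu> chi F \<xi> * chi (a * \<xi>)) 0 (- n)"
      unfolding set_lebesgue_integral_def
    proof (rule integral_dominated_convergence[of _ _ _ "\<lambda>x. indicator (pball 0 (- n)) x *\<^sub>R ?C"])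
      show "integrable \<mu> (\<lambda>x. indicator (pball 0 (- n)) x *\<^sub>R ?C)"
        by (intro integrable_scaleR_left integrable_real_indicator) (simp_all add: emeasure_pball)
      show "AE x in \<mu>. (\<lambda>N. indicator (pball 0 (- n)) x *\<^sub>R (?h N x * chi (a * x)))
          \<longlonglongrightarrow> indicator (pball 0 (- n)) x *\<^sub>R (fourier_L1 \<mu> chi F x * chi (a * x))"
        by (intro AE_I2 tendsto_intros hlim)
      show "AE x in \<mu>. cmod (indicator (pball 0 (- n)) x *\<^sub>R (?h N x * chi (a * x)))
          \<le> indicator (pball 0 (- n)) x *\<^sub>R ?C" for N
        using hb by (intro AE_I2) (simp add: norm_mult chi_norm indicator_def)
    qed (use F T in \<open>auto intro!: borel_measurable_scaleR borel_measurable_times\<close>)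
    moreover have "(\<lambda>N. bint (\<lambda>\<xi>. ?h N \<xi> * chi (a * \<xi>)) 0 (- n)) \<longlonglongrightarrow> qpow n * bint F a n"
      by (intro tendsto_eventually eventually_sequentiallyI[of ?N] ev)
    ultimately show ?thesis using LIMSEQ_unique by blast
  qed
  then show ?thesis using F by (simp add: fpair_def integrable_loc_int loc_int_fourier_L1)
qed

text \<open>
  The truncations of \<open>f\<close> to the balls \<open>\<pp>^(-N) * \<O>\<close> lie in \<open>L1\<close> and \<open>L2\<close> and converge to \<open>f\<close>; by the
  isometry their transforms form a Cauchy sequence.
\<close>

lemma fourier_exists:
  assumes f: "f \<in> L2 \<mu>"
  shows "\<exists>g F. (\<forall>n. integrable \<mu> (F n)) \<and> L2_lim \<mu> F f \<and> L2_lim \<mu> (\<lambda>n. fourier_L1 \<mu> chi (F n)) g"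
proof -
  have [measurable]: "f \<in> borel_measurable borel" using L2_meas[OF f] by simp
  define T where "T N x = indicator (pball 0 (- int N)) x * f x" for N :: nat and x
  have TL: "T N \<in> L2 \<mu>" for N
    unfolding T_def by (rule L2_bounded_mult[OF f]) (auto simp: indicator_def)
  have T1: "integrable \<mu> (T N)" for N
    unfolding T_def by (rule L2_mult_integrable(1)[OF indicator_pball_L2 f])
  have Tlim: "(\<lambda>N. T N x) \<longlonglongrightarrow> f x" for x
  proof -
    obtain k :: nat where k: "x \<in> pball 0 (- int k)" using exists_pball_0 by blast
    have "T N x = f x" if "N \<ge> k" for N
      using k pball_mono[of "- int N" "- int k" 0] that by (auto simp: T_def)
    then show ?thesis by (intro tendsto_eventually eventually_sequentiallyI)
  qed
  have "(\<lambda>N. LINT x|\<mu>. (cmod (T N x - f x))\<^sup>2) \<longlonglongrightarrow> (LINT x|\<mu>. 0)"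
  proof (rule integral_dominated_convergence[of _ _ _ "\<lambda>x. (cmod (f x))\<^sup>2"])
    show "integrable \<mu> (\<lambda>x. (cmod (f x))\<^sup>2)" by (rule L2_int[OF f])
    have "(\<lambda>N. (cmod (T N x - f x))\<^sup>2) \<longlonglongrightarrow> (cmod (f x - f x))\<^sup>2" for x
      by (intro tendsto_intros Tlim)
    then show "AE x in \<mu>. (\<lambda>N. (cmod (T N x - f x))\<^sup>2) \<longlonglongrightarrow> 0" by simp
    show "(\<lambda>x. (cmod (T N x - f x))\<^sup>2) \<in> borel_measurable \<mu>" for N
      unfolding T_def by simp
  qed (auto simp: T_def indicator_def)
  then have "(\<lambda>N. L2_norm \<mu> (\<lambda>x. T N x - f x)) \<longlonglongrightarrow> sqrt 0"
    unfolding L2_norm_def by (intro tendsto_real_sqrt) simp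
  then have lim: "L2_lim \<mu> T f" using TL f by (simp add: L2_lim_def)
  have pair: "fpair (T N) (fourier_L1 \<mu> chi (T N))" for N by (rule fpair_fourier_L1[OF T1])
  have "\<exists>g. L2_lim \<mu> (\<lambda>n. fourier_L1 \<mu> chi (T n)) g"
  proof (rule L2_complete[of "\<lambda>n. fourier_L1 \<mu> chi (T n)" \<mu>])
    show "fourier_L1 \<mu> chi (T n) \<in> L2 \<mu>" for n by (rule fpair_L2(1)[OF pair TL])
    fix e :: real assume "0 < e"
    then obtain N where N: "\<And>m n. m \<ge> N \<Longrightarrow> n \<ge> N \<Longrightarrow> L2_norm \<mu> (\<lambda>x. T m x - T n x) < e"
      using L2_lim_Cauchy[OF lim, of e] by blast
    show "\<exists>N. \<forall>m\<ge>N. \<forall>n\<ge>N. L2_norm \<mu> (\<lambda>x. fourier_L1 \<mu> chi (T m) x - fourier_L1 \<mu> chi (T n) x) < e"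
      using N fpair_L2(2)[OF fpair_diff[OF pair pair] L2_diff[OF TL TL]]
      by (intro exI[of _ N]) simp
  qed blast
  with T1 lim show ?thesis by blast
qed

text \<open>
  The relation \<open>fpair\<close> passes to \<open>L2\<close> limits, so it holds for every choice of the approximating
  sequence and of the representative in the definition of the transform.
\<close>

lemma fpair_fourier:
  assumes f: "f \<in> L2 \<mu>"
  shows "fpair f (fourier \<mu> chi f)" "fourier \<mu> chi f \<in> L2 \<mu>"
proof -
  let ?P = "\<lambda>g. \<exists>F. (\<forall>n. integrable \<mu> (F n)) \<and> L2_lim \<mu> F f \<and> L2_lim \<mu> (\<lambda>n. fourier_L1 \<mu> chi (F n)) g"
  have "?P (fourier \<mu> chi f)"
    unfolding fourier_def by (rule someI_ex[OF fourier_exists[OF f]])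
  then obtain F where F: "\<And>n. integrable \<mu> (F n)" "L2_lim \<mu> F f"
    "L2_lim \<mu> (\<lambda>n. fourier_L1 \<mu> chi (F n)) (fourier \<mu> chi f)" by blast
  show "fpair f (fourier \<mu> chi f)"
    by (rule fpair_lim[OF F(2,3) fpair_fourier_L1[OF F(1)]])
  show "fourier \<mu> chi f \<in> L2 \<mu>" using F(3) by (simp add: L2_lim_def)
qed

text \<open>By the symmetry of \<open>fpair\<close> the conjugate of the transform of \<open>cnj g\<close> is a preimage of \<open>g\<close>.\<close>

lemma fpair_surj:
  assumes "g \<in> L2 \<mu>"
  shows "\<exists>f\<in>L2 \<mu>. fpair f g"
proof -
  let ?h = "fourier \<mu> chi (\<lambda>x. cnj (g x))"
  have "fpair (\<lambda>x. cnj (g x)) ?h" "?h \<in> L2 \<mu>" by (rule fpair_fourier[OF L2_cnj[OF assms]])+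
  then show ?thesis using fpair_swap[of "\<lambda>x. cnj (g x)" ?h] L2_cnj[of ?h \<mu>]
    by (intro bexI[of _ "\<lambda>x. cnj (?h x)"]) auto
qed

section \<open>Translations and dilations\<close>

lemma fpair_translate:
  assumes "fpair f g"
  shows "fpair (\<lambda>x. f (x - t)) (\<lambda>\<xi>. g \<xi> * cnj (chi (t * \<xi>)))"
proof -
  note li = fpair_loc_int[OF assms]
  have [measurable]: "f \<in> borel_measurable borel" using li by (auto dest: loc_int_measurable)
  have ft [measurable]: "(\<lambda>x. f (x - t)) \<in> borel_measurable borel" by measurable
  have shift: "indicator (pball a n) (x + t) *\<^sub>R f x = indicator (pball (a - t) n) x *\<^sub>R f x" for a n x
    using pball_translate[of x t a n] by (simp add: indicator_def)
  have "set_integrable \<mu> (pball 0 n) (\<lambda>x. f (x - t))" for n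
  proof -
    have "integrable \<mu> (\<lambda>x. indicator (pball 0 n) (x + t) *\<^sub>R f ((x + t) - t))"
      using loc_int_ball_integrable[OF li(1), of "0 - t" n] by (simp only: shift add_diff_cancel)
    then show ?thesis
      using integrable_translate[of "\<lambda>x. indicator (pball 0 n) x *\<^sub>R f (x - t)" t]
      by (simp add: set_integrable_def)
  qed
  then have "loc_int (\<lambda>x. f (x - t))" using ft by (simp add: loc_int_def)
  moreover have "bint (\<lambda>\<xi>. g \<xi> * cnj (chi (t * \<xi>)) * chi (a * \<xi>)) 0 (- n)
      = qpow n * bint (\<lambda>x. f (x - t)) a n" for a n
  proof -
    have "bint (\<lambda>x. f (x - t)) a n = (LINT x|\<mu>. indicator (pball a n) (x + t) *\<^sub>R f ((x + t) - t))"
      unfolding set_lebesgue_integral_def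
      by (rule integral_translate[of "\<lambda>x. indicator (pball a n) x *\<^sub>R f (x - t)" t, symmetric]) simp
    also have "\<dots> = bint f (a - t) n"
      unfolding set_lebesgue_integral_def by (simp only: shift add_diff_cancel)
    finally have *: "bint (\<lambda>x. f (x - t)) a n = bint f (a - t) n" .
    have "bint (\<lambda>\<xi>. g \<xi> * cnj (chi (t * \<xi>)) * chi (a * \<xi>)) 0 (- n)
        = bint (\<lambda>\<xi>. g \<xi> * chi ((a - t) * \<xi>)) 0 (- n)"
      by (rule bint_cong) (simp add: left_diff_distrib chi_diff)
    also have "\<dots> = qpow n * bint f (a - t) n" by (rule fpairD[OF assms])
    finally show ?thesis by (simp only: *)
  qed
  ultimately show ?thesis using loc_int_cnj_chi_mult[OF li(2)] by (simp add: fpair_def)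
qed

lemma fpair_dilate:
  assumes "fpair f g"
  shows "fpair (\<lambda>x. f (\<pp> powi (- j) * x)) (\<lambda>\<xi>. qpow (- j) * g (\<pp> powi j * \<xi>))"
proof -
  note li = fpair_loc_int[OF assms]
  have [measurable]: "f \<in> borel_measurable borel" "g \<in> borel_measurable borel"
    using li by (auto dest: loc_int_measurable)
  have ind: "(indicator (pball a n) x :: real) = indicator (pball (\<pp> powi i * a) (n + i)) (\<pp> powi i * x)" for a n x i
    using pball_pp_mult[of i x a n] by (simp add: indicator_def)
  have loc: "loc_int (\<lambda>x. h (\<pp> powi i * x))" if h: "loc_int h" for h :: "'a \<Rightarrow> complex" and i
  proof -
    have [measurable]: "h \<in> borel_measurable borel" using h by (rule loc_int_measurable)
    have "integrable \<mu> (\<lambda>x. indicator (pball 0 n) x *\<^sub>R h (\<pp> powi i * x))" for n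
      unfolding ind[of 0 n _ i]
      using integrable_dilate[of "\<lambda>x. indicator (pball (\<pp> powi i * 0) (n + i)) x *\<^sub>R h x" i]
        loc_int_ball_integrable[OF h, of "\<pp> powi i * 0" "n + i"] by simp
    then show ?thesis by (simp add: loc_int_def set_integrable_def)
  qed
  have dil: "bint (\<lambda>x. h (\<pp> powi i * x)) a n
      = qpow i * bint h (\<pp> powi i * a) (n + i)" if h: "loc_int h" for h i a n
  proof -
    have [measurable]: "h \<in> borel_measurable borel" using h by (rule loc_int_measurable)
    show ?thesis
      unfolding set_lebesgue_integral_def ind[of a n _ i]
      by (rule integral_dilate[of "\<lambda>x. indicator (pball (\<pp> powi i * a) (n + i)) x *\<^sub>R h x" i]) simp
  qed
  have "bint (\<lambda>\<xi>. qpow (- j) * g (\<pp> powi j * \<xi>) * chi (a * \<xi>)) 0 (- n)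
      = qpow n * bint (\<lambda>x. f (\<pp> powi (- j) * x)) a n" for a n
  proof -
    let ?b = "\<pp> powi (- j) * a"
    have e: "?b * (\<pp> powi j * \<xi>) = a * \<xi>" for \<xi>
    proof -
      have "?b * (\<pp> powi j * \<xi>) = \<pp> powi (- j) * (\<pp> powi j * (a * \<xi>))"
        by (simp only: mult_ac)
      then show ?thesis by (simp only: pp_powi_cancel)
    qed
    have "bint (\<lambda>\<xi>. qpow (- j) * g (\<pp> powi j * \<xi>) * chi (a * \<xi>)) 0 (- n)
        = qpow (- j) * bint (\<lambda>\<xi>. g (\<pp> powi j * \<xi>) * chi (?b * (\<pp> powi j * \<xi>))) 0 (- n)"
      unfolding bint_cmult[symmetric] e by (simp only: mult.assoc)
    also have "bint (\<lambda>\<xi>. g (\<pp> powi j * \<xi>) * chi (?b * (\<pp> powi j * \<xi>))) 0 (- n)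
        = qpow j * bint (\<lambda>\<xi>. g \<xi> * chi (?b * \<xi>)) 0 (- (n - j))"
    proof -
      have "bint (\<lambda>\<xi>. g (\<pp> powi j * \<xi>) * chi (?b * (\<pp> powi j * \<xi>))) 0 (- n)
          = qpow j * bint (\<lambda>\<xi>. g \<xi> * chi (?b * \<xi>)) (\<pp> powi j * 0) (- n + j)"
        by (rule dil[OF loc_int_chi_mult[OF li(2)]])
      then show ?thesis by simp
    qed
    also have "\<dots> = qpow j * (qpow (n - j) * bint f ?b (n - j))"
      by (simp only: fpairD[OF assms])
    also have "qpow (- j) * \<dots>
        = complex_of_real (real q powi (- j) * (real q powi j * real q powi (n - j))) * bint f ?b (n - j)"
      by (simp only: of_real_mult mult.assoc)
    also have "real q powi (- j) * (real q powi j * real q powi (n - j)) = real q powi n * real q powi (- j)"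
      by (simp flip: power_int_add)
    also have "complex_of_real (real q powi n * real q powi (- j)) * bint f ?b (n - j)
        = qpow n * bint (\<lambda>x. f (\<pp> powi (- j) * x)) a n"
    proof -
      have "bint (\<lambda>x. f (\<pp> powi (- j) * x)) a n
          = qpow (- j) * bint f ?b (n + - j)"
        by (rule dil[OF li(1)])
      then show ?thesis by (simp only: of_real_mult mult.assoc) simp
    qed
    finally show ?thesis .
  qed
  then show ?thesis using loc[OF li(1)] loc[OF li(2)] by (simp add: fpair_def loc_int_cmult)
qed

section \<open>Periodization\<close>

lemma rep_0: "rep 0 k = u k"
  by (simp add: rep_def)

lemma ex1_coset: "\<exists>!k. x \<in> pball (u k) 0"
proof -
  obtain k where k: "x \<in> pball (u k) 0" using rep_cover_UNIV[of x 0] by (auto simp: rep_0)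
  moreover have "l = k" if "x \<in> pball (u l) 0" for l
    using rep_disjoint[of l k 0] k that by (auto simp: rep_0)
  ultimately show ?thesis by blast
qed

lemma in_coset_translate: "x + u k \<in> pball (u k) 0 \<longleftrightarrow> x \<in> pball 0 0"
  by (simp add: pball_def)

lemma nn_integral_coset_sum:
  assumes [measurable]: "h \<in> borel_measurable borel"
  shows "(\<integral>\<^sup>+x. h x \<partial>\<mu>) = (\<Sum>k. \<integral>\<^sup>+x. h (x + u k) * indicator (pball 0 0) x \<partial>\<mu>)"
proof -
  have "(\<Sum>k. h x * indicator (pball (u k) 0) x) = h x" for x
  proof -
    obtain k where k: "x \<in> pball (u k) 0" and k': "\<And>l. x \<in> pball (u l) 0 \<Longrightarrow> l = k"
      using ex1_coset[of x] by blast
    have "(\<lambda>l. h x * indicator (pball (u l) 0) x) = (\<lambda>l. if l = k then h x else 0)"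
    proof
      fix l
      show "h x * indicator (pball (u l) 0) x = (if l = k then h x else 0)"
        using k k'[of l] by (cases "l = k") (auto simp: indicator_def)
    qed
    then show ?thesis using sums_single[of k "\<lambda>_. h x"] by (simp add: sums_iff)
  qed
  then have "(\<integral>\<^sup>+x. h x \<partial>\<mu>) = (\<integral>\<^sup>+x. (\<Sum>k. h x * indicator (pball (u k) 0) x) \<partial>\<mu>)" by simp
  also have "\<dots> = (\<Sum>k. \<integral>\<^sup>+x. h x * indicator (pball (u k) 0) x \<partial>\<mu>)"
    by (rule nn_integral_suminf) simp
  also have "\<dots> = (\<Sum>k. \<integral>\<^sup>+x. h (x + u k) * indicator (pball 0 0) x \<partial>\<mu>)"
  proof (rule suminf_cong)
    fix k
    have "(\<integral>\<^sup>+x. h x * indicator (pball (u k) 0) x \<partial>\<mu>)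
        = (\<integral>\<^sup>+x. h (x + u k) * indicator (pball (u k) 0) (x + u k) \<partial>\<mu>)"
      by (rule nn_integral_translate[of "\<lambda>x. h x * indicator (pball (u k) 0) x" "u k", symmetric]) simp
    also have "\<dots> = (\<integral>\<^sup>+x. h (x + u k) * indicator (pball 0 0) x \<partial>\<mu>)"
      by (rule nn_integral_cong) (simp add: indicator_def in_coset_translate)
    finally show "(\<integral>\<^sup>+x. h x * indicator (pball (u k) 0) x \<partial>\<mu>)
        = (\<integral>\<^sup>+x. h (x + u k) * indicator (pball 0 0) x \<partial>\<mu>)" .
  qed
  finally show ?thesis .
qed

lemma integral_coset_sum:
  fixes h :: "'a \<Rightarrow> complex"
  assumes h: "integrable \<mu> h"
  shows "(LINT x|\<mu>. h x) = (\<Sum>k. LINT x|\<mu>. indicator (pball 0 0) x *\<^sub>R h (x + u k))"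
proof -
  have [measurable]: "h \<in> borel_measurable borel" using borel_measurable_integrable[OF h] by simp
  have U: "(\<Union>k. pball (u k) 0) = UNIV" using ex1_coset by blast
  have "(LINT x|\<mu>. h x) = (LINT x:(\<Union>k. pball (u k) 0)|\<mu>. h x)"
    by (simp add: U set_lebesgue_integral_def)
  also have "\<dots> = (\<Sum>k. LINT x:(pball (u k) 0)|\<mu>. h x)"
  proof (rule lebesgue_integral_countable_add)
    show "pball (u k) 0 \<inter> pball (u l) 0 = {}" if "k \<noteq> l" for k l
      using rep_disjoint[OF that, of 0] by (simp add: rep_0)
    show "set_integrable \<mu> (\<Union>k. pball (u k) 0) h"
      using h by (simp add: U set_integrable_def)
  qed simp
  also have "\<dots> = (\<Sum>k. LINT x|\<mu>. indicator (pball 0 0) x *\<^sub>R h (x + u k))"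
  proof (rule suminf_cong)
    fix k
    have "(LINT x:(pball (u k) 0)|\<mu>. h x) = (LINT x|\<mu>. indicator (pball (u k) 0) (x + u k) *\<^sub>R h (x + u k))"
      unfolding set_lebesgue_integral_def
      by (rule integral_translate[of "\<lambda>x. indicator (pball (u k) 0) x *\<^sub>R h x" "u k", symmetric]) simp
    also have "\<dots> = (LINT x|\<mu>. indicator (pball 0 0) x *\<^sub>R h (x + u k))"
      by (simp add: indicator_def in_coset_translate)
    finally show "(LINT x:(pball (u k) 0)|\<mu>. h x) = (LINT x|\<mu>. indicator (pball 0 0) x *\<^sub>R h (x + u k))" .
  qed
  finally show ?thesis .
qed

text \<open>
  Since \<open>chi (u k * u l) = 1\<close>, a function and its periodization have the same Fourier coefficients at
  the points \<open>u l\<close>. The periodization, cut off to \<open>\<O>\<close>, has a transform that is constant on the cosets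
  \<open>u l + \<O>\<close>, so Plancherel's identity on \<open>K\<close> becomes Parseval's identity on \<open>\<O>\<close>.
\<close>

lemma parseval_periodization:
  assumes g: "integrable \<mu> g"
  shows "(\<Sum>l. esq (fourier_L1 \<mu> chi g (u l)))
    = (\<integral>\<^sup>+x. esq (\<Sum>k. g (x + u k)) * indicator (pball 0 0) x \<partial>\<mu>)"
proof -
  have gm [measurable]: "g \<in> borel_measurable borel" using borel_measurable_integrable[OF g] by simp
  let ?f = "\<lambda>k x. indicator (pball 0 0) x *\<^sub>R g (x + u k)"
  have "integrable \<mu> (\<lambda>x. g (x + u k))" for k
    using integrable_translate[OF gm] g by simp
  then have fi: "integrable \<mu> (?f k)" for k by (intro integrable_mult_indicator) simp_all
  have "(\<Sum>k. ennreal (LINT x|\<mu>. cmod (?f k x))) = (\<Sum>k. \<integral>\<^sup>+x. ennreal (cmod (?f k x)) \<partial>\<mu>)"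
    by (intro suminf_cong nn_integral_eq_integral[symmetric] integrable_norm fi) simp
  also have S: "\<dots> = (\<integral>\<^sup>+x. ennreal (cmod (g x)) \<partial>\<mu>)"
    by (subst nn_integral_coset_sum) (auto intro!: suminf_cong nn_integral_cong simp: indicator_def)
  also have fin: "\<dots> < \<infinity>" using g by (simp add: integrable_iff_bounded)
  finally have sumI: "summable (\<lambda>k. LINT x|\<mu>. cmod (?f k x))"
    by (intro summable_suminf_not_top) auto
  have "(\<integral>\<^sup>+x. (\<Sum>k. ennreal (cmod (?f k x))) \<partial>\<mu>) = (\<Sum>k. \<integral>\<^sup>+x. ennreal (cmod (?f k x)) \<partial>\<mu>)"
    by (rule nn_integral_suminf) simp
  with S fin have "(\<integral>\<^sup>+x. (\<Sum>k. ennreal (cmod (?f k x))) \<partial>\<mu>) \<noteq> \<infinity>" by simp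
  then have "AE x in \<mu>. (\<Sum>k. ennreal (cmod (?f k x))) \<noteq> \<infinity>"
    by (intro nn_integral_PInf_AE) simp_all
  then have AEs: "AE x in \<mu>. summable (\<lambda>k. cmod (?f k x))"
    by eventually_elim (intro summable_suminf_not_top; simp)
  define G where "G x = (\<Sum>k. ?f k x)" for x
  have Gi: "integrable \<mu> G"
    unfolding G_def by (rule integrable_suminf[OF fi AEs sumI])
  have [measurable]: "G \<in> borel_measurable borel" using borel_measurable_integrable[OF Gi] by simp
  have G0: "G x = (\<Sum>k. g (x + u k)) * indicator (pball 0 0) x" for x
    by (simp add: G_def indicator_def)
  have coeff: "fourier_L1 \<mu> chi G (u l) = fourier_L1 \<mu> chi g (u l)" for l
  proof -
    let ?fc = "\<lambda>k x. ?f k x * cnj (chi (u l * x))"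
    have n: "cmod (?fc k x) = cmod (?f k x)" for k x by (simp add: norm_mult chi_norm)
    have "fourier_L1 \<mu> chi G (u l) = (LINT x|\<mu>. (\<Sum>k. ?fc k x))"
      unfolding fourier_L1_def
    proof (rule integral_cong_AE)
      show "AE x in \<mu>. G x * cnj (chi (u l * x)) = (\<Sum>k. ?fc k x)"
        using AEs unfolding G_def
        by eventually_elim (rule suminf_mult2[OF summable_norm_cancel])
    qed simp_all
    also have "\<dots> = (\<Sum>k. LINT x|\<mu>. ?fc k x)"
      by (rule integral_suminf) (use AEs sumI in \<open>simp_all only: n integrable_mult_chi fi\<close>)
    also have "\<dots> = (\<Sum>k. LINT x|\<mu>. indicator (pball 0 0) x *\<^sub>R (g (x + u k) * cnj (chi (u l * (x + u k)))))"
      by (simp add: distrib_left chi_add chi_u_u)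
    also have "\<dots> = (LINT x|\<mu>. g x * cnj (chi (u l * x)))"
      by (rule integral_coset_sum[symmetric, OF integrable_mult_chi[OF g]])
    finally show ?thesis by (simp add: fourier_L1_def)
  qed
  have hG [measurable]: "fourier_L1 \<mu> chi G \<in> borel_measurable borel"
    by (rule fourier_L1_measurable[OF Gi])
  have const: "fourier_L1 \<mu> chi G (x + u l) = fourier_L1 \<mu> chi G (u l)" if x: "x \<in> pball 0 0" for x l
    unfolding fourier_L1_def
  proof (rule Bochner_Integration.integral_cong[OF refl])
    fix y
    have "chi ((x + u l) * y) = chi (u l * y)" if "y \<in> pball 0 0"
      using chi_const_on_ball[of y 0 "x + u l" "u l"] that x in_coset_translate[of x l] by (simp add: mult.commute)
    then show "G y * cnj (chi ((x + u l) * y)) = G y * cnj (chi (u l * y))"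
      by (cases "y \<in> pball 0 0") (auto simp: G0)
  qed
  have "(\<Sum>l. esq (fourier_L1 \<mu> chi g (u l)))
      = (\<Sum>l. \<integral>\<^sup>+x. esq (fourier_L1 \<mu> chi G (x + u l)) * indicator (pball 0 0) x \<partial>\<mu>)"
  proof (rule suminf_cong)
    fix l
    have "(\<integral>\<^sup>+x. esq (fourier_L1 \<mu> chi G (x + u l)) * indicator (pball 0 0) x \<partial>\<mu>)
        = (\<integral>\<^sup>+x. esq (fourier_L1 \<mu> chi G (u l)) * indicator (pball 0 0) x \<partial>\<mu>)"
      by (rule nn_integral_cong) (simp add: indicator_def const)
    also have "\<dots> = esq (fourier_L1 \<mu> chi G (u l))"
      by (simp add: nn_integral_cmult_indicator emeasure_pball)
    finally show "esq (fourier_L1 \<mu> chi g (u l))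
        = (\<integral>\<^sup>+x. esq (fourier_L1 \<mu> chi G (x + u l)) * indicator (pball 0 0) x \<partial>\<mu>)"
      by (simp add: coeff)
  qed
  also have "\<dots> = (\<integral>\<^sup>+x. esq (fourier_L1 \<mu> chi G x) \<partial>\<mu>)"
    by (rule nn_integral_coset_sum[symmetric]) simp
  also have "\<dots> = (\<integral>\<^sup>+x. esq (G x) \<partial>\<mu>)"
    by (rule fpair_plancherel_nn[OF fpair_fourier_L1[OF Gi]])
  also have "\<dots> = (\<integral>\<^sup>+x. esq (\<Sum>k. g (x + u k)) * indicator (pball 0 0) x \<partial>\<mu>)"
    by (rule nn_integral_cong) (simp add: G0 indicator_def)
  finally show ?thesis .
qed

lemma translation_L2: "f \<in> L2 \<mu> \<Longrightarrow> translation u k f \<in> L2 \<mu>"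
  and fpair_translation: "fpair f g \<Longrightarrow> fpair (translation u k f) (\<lambda>\<xi>. g \<xi> * cnj (chi (u k * \<xi>)))"
proof -
  show *: "fpair f g \<Longrightarrow> fpair (translation u k f) (\<lambda>\<xi>. g \<xi> * cnj (chi (u k * \<xi>)))" for f g
    unfolding translation_def by (rule fpair_translate)
  assume f: "f \<in> L2 \<mu>"
  have "(\<lambda>\<xi>. cnj (chi (u k * \<xi>)) * fourier \<mu> chi f \<xi>) \<in> L2 \<mu>"
    by (rule L2_bounded_mult[OF fpair_fourier(2)[OF f]]) (auto simp: chi_norm)
  then show "translation u k f \<in> L2 \<mu>"
    using fpair_L2_left[OF *[OF fpair_fourier(1)[OF f]]] by (simp add: mult.commute)
qed

text \<open>
  Translation multiplies the transform by a character, which makes the inner products with the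
  translates of \<open>\<psi>\<close> the Fourier coefficients of \<open>\<psi>' * cnj f'\<close>, up to conjugation.
\<close>

lemma sum_translates:
  assumes f: "f \<in> L2 \<mu>" "fpair f f'" and psi: "\<psi> \<in> L2 \<mu>" "fpair \<psi> \<psi>'"
  shows "(\<Sum>k. esq (L2_inner \<mu> f (translation u k \<psi>)))
    = (\<integral>\<^sup>+x. esq (\<Sum>k. \<psi>' (x + u k) * cnj (f' (x + u k))) * indicator (pball 0 0) x \<partial>\<mu>)"
proof -
  let ?g = "\<lambda>x. \<psi>' x * cnj (f' x)"
  have "integrable \<mu> ?g" by (rule L2_mult_integrable(2)) (use f psi fpair_L2 in auto)
  moreover have "cmod (L2_inner \<mu> f (translation u k \<psi>)) = cmod (fourier_L1 \<mu> chi ?g (u k))" for k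
  proof -
    have "L2_inner \<mu> f (translation u k \<psi>) = L2_inner \<mu> f' (\<lambda>\<xi>. \<psi>' \<xi> * cnj (chi (u k * \<xi>)))"
      by (rule fpair_inner[OF f(2) fpair_translation[OF psi(2)] f(1) translation_L2[OF psi(1)]])
    also have "\<dots> = cnj (L2_inner \<mu> (\<lambda>\<xi>. \<psi>' \<xi> * cnj (chi (u k * \<xi>))) f')"
      by (rule L2_inner_commute)
    also have "L2_inner \<mu> (\<lambda>\<xi>. \<psi>' \<xi> * cnj (chi (u k * \<xi>))) f' = fourier_L1 \<mu> chi ?g (u k)"
      unfolding L2_inner_def fourier_L1_def by (simp add: mult_ac)
    finally show ?thesis by simp
  qed
  ultimately show ?thesis using parseval_periodization by simp
qed

section \<open>Sets whose translates are disjoint\<close>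

text \<open>
  Testing points of \<open>\<O>\<close> is enough: the cosets \<open>\<O> + u k\<close> tile \<open>K\<close> and the \<open>u k\<close> form a group.
\<close>

definition packs :: "'a set \<Rightarrow> bool" where
  "packs W \<longleftrightarrow> (AE x in \<mu>. x \<in> pball 0 0 \<longrightarrow> (\<forall>k l. x + u k \<in> W \<longrightarrow> x + u l \<in> W \<longrightarrow> k = l))"

lemma u_inj: "u k = u l \<Longrightarrow> k = l"
  using u_inj_cosets[of k l] by simp

lemma AE_translates: "AE x in \<mu>. P x \<Longrightarrow> AE x in \<mu>. \<forall>k :: nat. P (x + t k)"
  unfolding AE_all_countable by (intro allI AE_translate)

lemma image_translate: "(\<lambda>x. x + t) ` W = (\<lambda>x :: 'a. x - t) -` W"
proof (intro equalityI subsetI)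
  fix y assume "y \<in> (\<lambda>x. x - t) -` W"
  then show "y \<in> (\<lambda>x. x + t) ` W" by (intro image_eqI[of _ _ "y - t"]) auto
qed auto

lemma image_translate_sets: "W \<in> sets borel \<Longrightarrow> (\<lambda>x. x + t :: 'a) ` W \<in> sets borel"
  using measurable_sets[OF measurable_lf_diff[of t], of W] by (simp add: image_translate)

text \<open>
  A point in \<open>W + u k\<close> and \<open>W + u l\<close> is moved into \<open>\<O>\<close> by subtracting some \<open>u r\<close>, and the differences
  \<open>u r - u k\<close>, \<open>u r - u l\<close> are again representatives.
\<close>

lemma measurable_partition_translates_iff:
  assumes W: "W \<in> sets borel"
  shows "(\<exists>E. measurable_partition \<mu> (UNIV :: nat set) (\<lambda>k. (\<lambda>x. x + u k) ` W) E) \<longleftrightarrow> packs W"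
proof -
  let ?A = "\<lambda>k. (\<lambda>x. x + u k) ` W"
  have A: "?A k \<in> sets \<mu>" for k using image_translate_sets[OF W] by simp
  have "(\<exists>E. measurable_partition \<mu> (UNIV :: nat set) ?A E)
      \<longleftrightarrow> (AE x in \<mu>. \<forall>k l. x - u k \<in> W \<longrightarrow> x - u l \<in> W \<longrightarrow> k = l)" (is "_ \<longleftrightarrow> ?R")
  proof
    assume "\<exists>E. measurable_partition \<mu> (UNIV :: nat set) ?A E"
    then obtain E where E: "measurable_partition \<mu> (UNIV :: nat set) ?A E" by blast
    then have "E \<in> sets \<mu>" by (simp add: measurable_partition_def)
    from E[unfolded measurable_partition_iff_AE[OF A this]] show ?R
      by eventually_elim (auto simp: image_translate)
  next
    have "(\<Union>k. ?A k) \<in> sets \<mu>" using A by (intro sets.countable_UN) auto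
    moreover assume ?R
    ultimately have "measurable_partition \<mu> (UNIV :: nat set) ?A (\<Union>k. ?A k)"
      by (subst measurable_partition_iff_AE[OF A]) (auto simp: image_translate)
    then show "\<exists>E. measurable_partition \<mu> (UNIV :: nat set) ?A E" by blast
  qed
  also have "\<dots> \<longleftrightarrow> packs W"
  proof
    assume ?R
    then show "packs W" unfolding packs_def
    proof eventually_elim
      case (elim x)
      show ?case
      proof (intro impI allI)
        fix k l assume kl: "x + u k \<in> W" "x + u l \<in> W"
        obtain k' where k': "- u k = u k'" using u_diff[of 0 k] by auto
        obtain l' where l': "- u l = u l'" using u_diff[of 0 l] by auto
        have "x - u k' \<in> W" "x - u l' \<in> W" using kl by (simp_all flip: k' l')
        then have "- u k = - u l" using elim k' l' by auto
        then show "k = l" by (intro u_inj) simp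
      qed
    qed
  next
    assume p: "packs W"
    have "\<forall>k. \<exists>r. - u k = u r" using u_diff[of 0] by simp
    then obtain neg where neg: "\<And>k. - u k = u (neg k)" by metis
    have "AE x in \<mu>. \<forall>r. x + u (neg r) \<in> pball 0 0 \<longrightarrow>
        (\<forall>k l. x + u (neg r) + u k \<in> W \<longrightarrow> x + u (neg r) + u l \<in> W \<longrightarrow> k = l)"
      using AE_translates[OF p[unfolded packs_def], of "\<lambda>r. u (neg r)"] by simp
    then show ?R
    proof eventually_elim
      case (elim x)
      show ?case
      proof (intro allI impI)
        fix k l assume kl: "x - u k \<in> W" "x - u l \<in> W"
        obtain r where r: "x \<in> pball (u r) 0" using ex1_coset[of x] by blast
        obtain k' where k': "u r - u k = u k'" using u_diff by blast
        obtain l' where l': "u r - u l = u l'" using u_diff by blast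
        have "x + u (neg r) \<in> pball 0 0" using r by (simp add: pball_def flip: neg)
        moreover have "x + u (neg r) + u k' \<in> W" "x + u (neg r) + u l' \<in> W"
          using kl by (simp_all flip: neg k' l')
        ultimately have "k' = l'" using elim by blast
        then have "u r - u k = u r - u l" using k' l' by simp
        then show "k = l" by (intro u_inj) simp
      qed
    qed
  qed
  finally show ?thesis .
qed

text \<open>
  At most one term of the periodization is nonzero, so the square of the sum is the sum of the squares.
\<close>

lemma packs_periodization:
  assumes p: "packs W" and g [measurable]: "g \<in> borel_measurable borel"
    and supp: "AE x in \<mu>. x \<notin> W \<longrightarrow> g x = 0"
  shows "(\<integral>\<^sup>+x. esq (\<Sum>k. g (x + u k)) * indicator (pball 0 0) x \<partial>\<mu>)
    = (\<integral>\<^sup>+x. esq (g x) \<partial>\<mu>)"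
proof -
  have "(\<integral>\<^sup>+x. esq (g x) \<partial>\<mu>)
      = (\<Sum>k. \<integral>\<^sup>+x. esq (g (x + u k)) * indicator (pball 0 0) x \<partial>\<mu>)"
    by (rule nn_integral_coset_sum) simp
  also have "\<dots> = (\<integral>\<^sup>+x. (\<Sum>k. esq (g (x + u k)) * indicator (pball 0 0) x) \<partial>\<mu>)"
    by (rule nn_integral_suminf[symmetric]) simp
  also have "\<dots> = (\<integral>\<^sup>+x. esq (\<Sum>k. g (x + u k)) * indicator (pball 0 0) x \<partial>\<mu>)"
  proof (rule nn_integral_cong_AE)
    show "AE x in \<mu>. (\<Sum>k. esq (g (x + u k)) * indicator (pball 0 0) x)
        = esq (\<Sum>k. g (x + u k)) * indicator (pball 0 0) x"
      using p[unfolded packs_def] AE_translates[OF supp, of u]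
    proof eventually_elim
      case (elim x)
      show ?case
      proof (cases "x \<in> pball 0 0 \<and> (\<exists>k. g (x + u k) \<noteq> 0)")
        case True
        then obtain k where k: "g (x + u k) \<noteq> 0" by blast
        have "g (x + u l) = 0" if "l \<noteq> k" for l
          using elim True k that by blast
        then have g: "(\<lambda>l. g (x + u l)) = (\<lambda>l. if l = k then g (x + u k) else 0)" by auto
        have "(\<Sum>l. g (x + u l)) = g (x + u k)"
          by (subst g) (use sums_single[of k "\<lambda>_. g (x + u k)"] in \<open>simp add: sums_iff\<close>)
        moreover have "(\<lambda>l. esq (g (x + u l)))
            = (\<lambda>l. if l = k then esq (g (x + u k)) else 0)"
          using \<open>\<And>l. l \<noteq> k \<Longrightarrow> g (x + u l) = 0\<close> by auto
        then have "(\<Sum>l. esq (g (x + u l))) = esq (g (x + u k))"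
          using sums_single[of k "\<lambda>_. esq (g (x + u k))"] by (simp add: sums_iff)
        ultimately show ?thesis using True by simp
      next
        case False
        then show ?thesis by (cases "x \<in> pball 0 0") auto
      qed
    qed
  qed
  finally show ?thesis ..
qed

lemma sum_translates_packs:
  assumes f: "f \<in> L2 \<mu>" "fpair f f'" and psi: "\<psi> \<in> L2 \<mu>" "fpair \<psi> \<psi>'"
    and abs: "AE x in \<mu>. cmod (\<psi>' x) = indicator W x" and p: "packs W"
  shows "(\<Sum>k. esq (L2_inner \<mu> f (translation u k \<psi>)))
    = (\<integral>\<^sup>+x. esq (f' x) * indicator W x \<partial>\<mu>)"
proof -
  have [measurable]: "f' \<in> borel_measurable borel" "\<psi>' \<in> borel_measurable borel"
    using fpair_loc_int(2) f psi loc_int_measurable by blast+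
  let ?g = "\<lambda>x. \<psi>' x * cnj (f' x)"
  have "(\<Sum>k. esq (L2_inner \<mu> f (translation u k \<psi>))) = (\<integral>\<^sup>+x. esq (?g x) \<partial>\<mu>)"
    unfolding sum_translates[OF f psi]
  proof (rule packs_periodization[OF p])
    show "AE x in \<mu>. x \<notin> W \<longrightarrow> ?g x = 0" using abs by eventually_elim auto
  qed simp
  also have "\<dots> = (\<integral>\<^sup>+x. esq (f' x) * indicator W x \<partial>\<mu>)"
    by (rule nn_integral_cong_AE, use abs in eventually_elim)
       (auto simp: norm_mult power_mult_distrib indicator_def)
  finally show ?thesis .
qed

text \<open>
  The number \<open>N x\<close> of translates that cover \<open>x\<close> is the periodization of \<open>\<bar>\<psi>'\<bar>\<^sup>2\<close>. The hypothesis
  says that \<open>N\<close> and \<open>N\<^sup>2\<close> have the same finite integral over \<open>\<O>\<close>, and \<open>N\<close> is integer-valued.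
\<close>

lemma packs_if_sum_translates:
  assumes [measurable]: "W \<in> sets borel" and psi: "\<psi> \<in> L2 \<mu>" "fpair \<psi> \<psi>'"
    and abs: "AE x in \<mu>. cmod (\<psi>' x) = indicator W x"
    and eq: "(\<Sum>k. esq (L2_inner \<mu> \<psi> (translation u k \<psi>))) = ennreal ((L2_norm \<mu> \<psi>)\<^sup>2)"
  shows "packs W"
proof -
  let ?O = "indicator (pball 0 0) :: 'a \<Rightarrow> ennreal"
  define N where "N x = (\<Sum>k. indicator W (x + u k) :: ennreal)" for x
  have [measurable]: "N \<in> borel_measurable borel" unfolding N_def by measurable
  define Z where "Z = {x \<in> pball 0 0. \<exists>k l. k \<noteq> l \<and> x + u k \<in> W \<and> x + u l \<in> W}"
  have Zeq: "Z = pball 0 0 \<inter> (\<Union>k. \<Union>l\<in>{l. k \<noteq> l}. (\<lambda>x. x + u k) -` W \<inter> (\<lambda>x. x + u l) -` W)"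
    unfolding Z_def by blast
  have "(\<lambda>x. x + u k) -` W \<in> sets borel" for k
    using measurable_sets[OF measurable_lf_add[of "u k"], of W] by simp
  then have [measurable]: "Z \<in> sets borel" unfolding Zeq by auto
  have sq: "AE x in \<mu>. \<psi>' x * cnj (\<psi>' x) = complex_of_real (indicator W x)"
    using abs by eventually_elim (simp add: complex_norm_square[symmetric] indicator_def)
  have "(\<integral>\<^sup>+x. N x * ?O x \<partial>\<mu>) = (\<integral>\<^sup>+x. (\<Sum>k. indicator W (x + u k) * ?O x) \<partial>\<mu>)"
    by (simp add: N_def)
  also have "\<dots> = (\<Sum>k. \<integral>\<^sup>+x. indicator W (x + u k) * ?O x \<partial>\<mu>)"
    by (rule nn_integral_suminf) simp
  also have "\<dots> = (\<integral>\<^sup>+x. indicator W x \<partial>\<mu>)"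
    by (rule nn_integral_coset_sum[symmetric]) simp
  also have "\<dots> = (\<integral>\<^sup>+x. esq (\<psi>' x) \<partial>\<mu>)"
    by (rule nn_integral_cong_AE, use abs in eventually_elim) (auto simp: indicator_def)
  also have "\<dots> = ennreal ((L2_norm \<mu> \<psi>)\<^sup>2)"
    using fpair_plancherel_nn[OF psi(2)] nn_eq_L2_norm[OF psi(1)] by simp
  finally have IN: "(\<integral>\<^sup>+x. N x * ?O x \<partial>\<mu>) = ennreal ((L2_norm \<mu> \<psi>)\<^sup>2)" .
  then have "AE x in \<mu>. N x * ?O x \<noteq> \<infinity>" by (intro nn_integral_PInf_AE) simp_all
  moreover note AE_translates[OF sq, of u]
  ultimately have AEsq: "AE x in \<mu>. N x * N x * ?O x
      = esq (\<Sum>k. \<psi>' (x + u k) * cnj (\<psi>' (x + u k))) * ?O x"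
  proof eventually_elim
    case (elim x)
    show ?case
    proof (cases "x \<in> pball 0 0")
      case True
      have Ne: "N x = (\<Sum>k. ennreal (indicator W (x + u k)))"
        by (simp add: N_def ennreal_indicator)
      then have summ: "summable (\<lambda>k. indicator W (x + u k) :: real)"
        using elim(1) True by (intro summable_suminf_not_top) auto
      let ?n = "\<Sum>k. indicator W (x + u k) :: real"
      have n0: "0 \<le> ?n" by (rule suminf_nonneg[OF summ]) simp
      have "N x = ennreal ?n" unfolding Ne by (rule suminf_ennreal2[OF _ summ]) simp
      moreover have "(\<Sum>k. \<psi>' (x + u k) * cnj (\<psi>' (x + u k))) = complex_of_real ?n"
        using elim(2) suminf_of_real[OF summ, where 'a = complex] by simp
      ultimately show ?thesis using True n0
        by (simp add: power2_eq_square ennreal_mult)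
    qed simp
  qed
  have "ennreal ((L2_norm \<mu> \<psi>)\<^sup>2) = (\<integral>\<^sup>+x. N x * N x * ?O x \<partial>\<mu>)"
    unfolding eq[symmetric] sum_translates[OF psi psi]
    by (rule nn_integral_cong_AE, use AEsq in eventually_elim) simp
  also have "\<dots> \<ge> (\<integral>\<^sup>+x. N x * ?O x + indicator Z x \<partial>\<mu>)"
  proof (rule nn_integral_mono)
    fix x
    show "N x * ?O x + indicator Z x \<le> N x * N x * ?O x"
    proof (cases "x \<in> pball 0 0")
      case True
      have le: "(\<Sum>k\<in>K. indicator W (x + u k)) \<le> N x" if "finite K" for K
        unfolding N_def by (rule sum_le_suminf) (use that in auto)
      consider "x \<in> Z" | "x \<notin> Z" "\<exists>k. x + u k \<in> W" | "x \<notin> Z" "\<forall>k. x + u k \<notin> W" by blast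
      then show ?thesis
      proof cases
        case 1
        then obtain k l where kl: "k \<noteq> l" "x + u k \<in> W" "x + u l \<in> W" by (auto simp: Z_def)
        then have 2: "2 \<le> N x" using le[of "{k, l}"] by simp
        have "N x + 1 \<le> N x + N x" using 2 by (intro add_left_mono) (rule order_trans[OF _ 2], simp)
        also have "\<dots> = N x * 2" by (simp add: mult_2_right)
        also have "\<dots> \<le> N x * N x" using 2 by (rule mult_left_mono) simp
        finally show ?thesis using True 1 by simp
      next
        case 2
        then obtain k where "x + u k \<in> W" by blast
        then have "1 \<le> N x" using le[of "{k}"] by simp
        then have "N x * 1 \<le> N x * N x" by (rule mult_left_mono) simp
        then show ?thesis using True 2 by simp
      next
        case 3
        then have "N x = 0" by (simp add: N_def)
        then show ?thesis using 3 by simp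
      qed
    qed (auto simp: Z_def)
  qed
  also have "(\<integral>\<^sup>+x. N x * ?O x + indicator Z x \<partial>\<mu>) = ennreal ((L2_norm \<mu> \<psi>)\<^sup>2) + emeasure \<mu> Z"
    by (subst nn_integral_add) (simp_all add: IN)
  finally have "ennreal ((L2_norm \<mu> \<psi>)\<^sup>2) + emeasure \<mu> Z \<le> ennreal ((L2_norm \<mu> \<psi>)\<^sup>2) + 0" by simp
  then have "emeasure \<mu> Z = 0"
    by (subst (asm) ennreal_add_left_cancel_le) auto
  then have "AE x in \<mu>. x \<notin> Z" by (intro AE_not_in) (simp add: null_sets_def)
  then show ?thesis unfolding packs_def by eventually_elim (auto simp: Z_def)
qed

section \<open>Dilations\<close>

lemma dilation_0 [simp]: "dilation \<pp> q 0 f = f"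
  by (simp add: dilation_def)

lemma translation_0 [simp]: "translation u 0 f = f"
  by (simp add: translation_def)

lemma dilation_L2:
  assumes f: "f \<in> L2 \<mu>"
  shows "dilation \<pp> q j f \<in> L2 \<mu>"
proof -
  have [measurable]: "f \<in> borel_measurable borel" using L2_meas[OF f] by simp
  have "(\<integral>\<^sup>+x. esq (f (\<pp> powi (- j) * x)) \<partial>\<mu>)
      = ennreal (real q powi (- j)) * (\<integral>\<^sup>+x. esq (f x) \<partial>\<mu>)"
    by (rule nn_integral_dilate[of "\<lambda>x. esq (f x)"]) simp
  also have "\<dots> < \<infinity>" using nn_eq_L2_norm[OF f] by (simp flip: ennreal_mult)
  finally have "(\<lambda>x. f (\<pp> powi (- j) * x)) \<in> L2 \<mu>"
    by (simp add: L2_iff_nn)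
  then show ?thesis unfolding dilation_def by (rule L2_scale)
qed

lemma powi_eq_powr: "real q powi i = real q powr (real_of_int i)"
  by (rule powr_real_of_int'[symmetric]) simp_all

lemma q_powr_half: "real q powr (real_of_int j / 2) * real q powi (- j) = real q powr (- real_of_int j / 2)"
proof -
  have "real q powr (real_of_int j / 2) * real q powi (- j)
      = real q powr (real_of_int j / 2 + real_of_int (- j))"
    by (simp only: powr_add powi_eq_powr)
  also have "real_of_int j / 2 + real_of_int (- j) = - real_of_int j / 2" by simp
  finally show ?thesis .
qed

lemma fpair_dilation:
  assumes "fpair f g"
  shows "fpair (dilation \<pp> q j f)
    (\<lambda>\<xi>. complex_of_real (real q powr (- real_of_int j / 2)) * g (\<pp> powi j * \<xi>))"
proof -
  have "fpair (dilation \<pp> q j f)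
    (\<lambda>\<xi>. complex_of_real (real q powr (real_of_int j / 2)) * (qpow (- j) * g (\<pp> powi j * \<xi>)))"
    unfolding dilation_def by (rule fpair_cmult[OF fpair_dilate[OF assms]])
  then show ?thesis
    by (simp only: mult.assoc[symmetric] of_real_mult[symmetric] q_powr_half)
qed

lemma dilation_adjoint:
  assumes "f \<in> L2 \<mu>" "h \<in> L2 \<mu>"
  shows "L2_inner \<mu> f (dilation \<pp> q j h) = L2_inner \<mu> (dilation \<pp> q (- j) f) h"
proof -
  have [measurable]: "f \<in> borel_measurable borel" "h \<in> borel_measurable borel"
    using assms[THEN L2_meas] by simp_all
  let ?s = "complex_of_real (real q powr (real_of_int j / 2))"
  let ?F = "\<lambda>y. ?s * (f (\<pp> powi j * y) * cnj (h y))"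
  have "L2_inner \<mu> f (dilation \<pp> q j h) = (LINT x|\<mu>. ?F (\<pp> powi (- j) * x))"
    unfolding L2_inner_def dilation_def pp_powi_cancel
    by (simp only: complex_cnj_mult complex_cnj_complex_of_real mult.left_commute)
  also have "\<dots> = qpow (- j) * (LINT y|\<mu>. ?F y)"
    by (rule integral_dilate) simp
  also have "\<dots> = complex_of_real (real q powr (real_of_int j / 2) * real q powi (- j))
      * (LINT y|\<mu>. f (\<pp> powi j * y) * cnj (h y))"
    unfolding integral_mult_right_zero of_real_mult by (simp only: mult_ac)
  also have "\<dots> = complex_of_real (real q powr (real_of_int (- j) / 2))
      * (LINT y|\<mu>. f (\<pp> powi j * y) * cnj (h y))"
    by (simp only: q_powr_half of_int_minus)
  also have "\<dots> = L2_inner \<mu> (dilation \<pp> q (- j) f) h"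
    unfolding L2_inner_def dilation_def
    by (subst integral_mult_right_zero[symmetric]) (simp add: mult.assoc)
  finally show ?thesis .
qed

lemma sum_translates_dilation:
  assumes f: "f \<in> L2 \<mu>" "fpair f f'" and psi: "\<psi> \<in> L2 \<mu>" "fpair \<psi> \<psi>'"
    and abs: "AE x in \<mu>. cmod (\<psi>' x) = indicator W x" and p: "packs W" and W [measurable]: "W \<in> sets borel"
  shows "(\<Sum>k. esq (L2_inner \<mu> f (dilation \<pp> q j (translation u k \<psi>))))
    = (\<integral>\<^sup>+\<xi>. esq (f' \<xi>) * indicator W (\<pp> powi j * \<xi>) \<partial>\<mu>)"
proof -
  have [measurable]: "f' \<in> borel_measurable borel"
    using fpair_loc_int(2)[OF f(2)] loc_int_measurable by blast
  let ?s = "complex_of_real (real q powr (- real_of_int (- j) / 2))"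
  let ?H = "\<lambda>\<xi>. esq (f' \<xi>) * indicator W (\<pp> powi j * \<xi>)"
  have s: "(cmod ?s)\<^sup>2 = real q powi j"
    unfolding powi_eq_powr by (simp add: power2_eq_square powr_add[symmetric])
  have "(\<Sum>k. esq (L2_inner \<mu> f (dilation \<pp> q j (translation u k \<psi>))))
      = (\<Sum>k. esq (L2_inner \<mu> (dilation \<pp> q (- j) f) (translation u k \<psi>)))"
    by (simp add: dilation_adjoint f translation_L2 psi)
  also have "\<dots> = (\<integral>\<^sup>+x. esq (?s * f' (\<pp> powi (- j) * x)) * indicator W x \<partial>\<mu>)"
    by (rule sum_translates_packs[OF dilation_L2[OF f(1)] fpair_dilation[OF f(2)] psi abs p])
  also have "\<dots> = (\<integral>\<^sup>+x. ennreal (real q powi j) * ?H (\<pp> powi (- j) * x) \<partial>\<mu>)"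
    by (rule nn_integral_cong) (simp only: norm_mult power_mult_distrib s pp_powi_cancel ennreal_mult zero_le_power_int of_nat_0_le_iff zero_le_power2 mult.assoc)
  also have "\<dots> = ennreal (real q powi j) * (\<integral>\<^sup>+x. ?H (\<pp> powi (- j) * x) \<partial>\<mu>)"
    by (rule nn_integral_cmult) simp
  also have "(\<integral>\<^sup>+x. ?H (\<pp> powi (- j) * x) \<partial>\<mu>) = ennreal (real q powi (- j)) * (\<integral>\<^sup>+x. ?H x \<partial>\<mu>)"
    by (rule nn_integral_dilate[of ?H "- j"]) simp
  also have "ennreal (real q powi j) * (ennreal (real q powi (- j)) * (\<integral>\<^sup>+x. ?H x \<partial>\<mu>))
      = ennreal (real q powi j * real q powi (- j)) * (\<integral>\<^sup>+x. ?H x \<partial>\<mu>)"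
    by (subst ennreal_mult) (simp_all add: mult.assoc)
  also have "real q powi j * real q powi (- j) = 1" by (simp flip: power_int_add)
  finally show ?thesis by simp
qed

section \<open>The space spanned by the translates\<close>

lemma fpair_sum:
  "(\<And>i. i \<in> I \<Longrightarrow> fpair (F i) (G i)) \<Longrightarrow> fpair (\<lambda>x. \<Sum>i\<in>I. F i x) (\<lambda>x. \<Sum>i\<in>I. G i x)"
  by (induction I rule: infinite_finite_induct) (auto simp: fpair_zero intro: fpair_add)

text \<open>
  The energy of \<open>f'\<close> outside \<open>W\<close> is at most the squared distance of \<open>f'\<close> from \<open>G n\<close>, which is that
  of \<open>f\<close> from \<open>F n\<close>.
\<close>

lemma fpair_lim_support:
  assumes lim: "L2_lim \<mu> F f" and f: "fpair f f'" and FG: "\<And>n. fpair (F n) (G n)"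
    and W: "W \<in> sets borel" and supp: "\<And>n. AE x in \<mu>. x \<notin> W \<longrightarrow> G n x = 0"
  shows "AE x in \<mu>. x \<notin> W \<longrightarrow> f' x = 0"
proof -
  have L: "f \<in> L2 \<mu>" "\<And>n. F n \<in> L2 \<mu>" using lim by (auto simp: L2_lim_def)
  have [measurable]: "f' \<in> borel_measurable borel" "W \<in> sets borel"
    using W fpair_loc_int(2)[OF f] loc_int_measurable by auto
  let ?I = "\<integral>\<^sup>+x. esq (f' x) * indicator (- W) x \<partial>\<mu>"
  have le: "?I \<le> ennreal ((L2_norm \<mu> (\<lambda>x. F n x - f x))\<^sup>2)" for n
  proof -
    have "?I \<le> (\<integral>\<^sup>+x. esq (G n x - f' x) \<partial>\<mu>)"
      by (rule nn_integral_mono_AE, use supp[of n] in eventually_elim) (auto simp: indicator_def)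
    also have "\<dots> = (\<integral>\<^sup>+x. esq (F n x - f x) \<partial>\<mu>)"
      by (rule fpair_plancherel_nn[OF fpair_diff[OF FG f]])
    also have "\<dots> = ennreal ((L2_norm \<mu> (\<lambda>x. F n x - f x))\<^sup>2)"
      by (rule nn_eq_L2_norm[OF L2_diff[OF L(2,1)]])
    finally show ?thesis .
  qed
  have "(\<lambda>n. ennreal ((L2_norm \<mu> (\<lambda>x. F n x - f x))\<^sup>2)) \<longlonglongrightarrow> ennreal (0\<^sup>2)"
    using lim by (intro tendsto_ennrealI tendsto_power) (simp add: L2_lim_def)
  then have "?I \<le> ennreal (0\<^sup>2)"
    by (rule LIMSEQ_le_const) (use le in auto)
  then have "?I = 0" by simp
  then have "AE x in \<mu>. esq (f' x) * indicator (- W) x = 0"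
    by (subst (asm) nn_integral_0_iff_AE) simp_all
  then show ?thesis by eventually_elim (auto simp: indicator_def)
qed

lemma closed_span_support:
  assumes S: "\<And>g. g \<in> S \<Longrightarrow> \<exists>g'. g \<in> L2 \<mu> \<and> fpair g g' \<and> (AE x in \<mu>. x \<notin> W \<longrightarrow> g' x = 0)"
    and W: "W \<in> sets borel" and f: "f \<in> closed_span \<mu> S"
  shows "\<exists>f'. f \<in> L2 \<mu> \<and> fpair f f' \<and> (AE x in \<mu>. x \<notin> W \<longrightarrow> f' x = 0)"
proof -
  obtain F where F: "\<And>n. \<exists>B a. finite B \<and> B \<subseteq> S \<and> F n = (\<lambda>x. \<Sum>g\<in>B. a g * g x)" "L2_lim \<mu> F f"
    using f by (auto simp: closed_span_def)
  have "\<exists>G. \<forall>n. fpair (F n) (G n) \<and> (AE x in \<mu>. x \<notin> W \<longrightarrow> G n x = 0)"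
  proof (rule choice, rule allI)
    fix n
    obtain B a where B: "finite B" "B \<subseteq> S" "F n = (\<lambda>x. \<Sum>g\<in>B. a g * g x)" using F(1) by blast
    obtain t where t: "\<And>g. g \<in> S \<Longrightarrow> fpair g (t g) \<and> (AE x in \<mu>. x \<notin> W \<longrightarrow> t g x = 0)"
      using S by metis
    have "fpair (F n) (\<lambda>x. \<Sum>g\<in>B. a g * t g x)"
      unfolding B(3) by (intro fpair_sum fpair_cmult) (use B(2) t in auto)
    moreover have "AE x in \<mu>. \<forall>g\<in>B. x \<notin> W \<longrightarrow> t g x = 0"
      using B(1,2) t by (intro AE_finite_allI) auto
    then have "AE x in \<mu>. x \<notin> W \<longrightarrow> (\<Sum>g\<in>B. a g * t g x) = 0"
      by eventually_elim (auto intro!: sum.neutral)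
    ultimately show "\<exists>G. fpair (F n) G \<and> (AE x in \<mu>. x \<notin> W \<longrightarrow> G x = 0)" by blast
  qed
  then obtain G where G: "\<And>n. fpair (F n) (G n)" "\<And>n. AE x in \<mu>. x \<notin> W \<longrightarrow> G n x = 0" by blast
  have fL: "f \<in> L2 \<mu>" using F(2) by (simp add: L2_lim_def)
  show ?thesis
    using fL fpair_fourier(1)[OF fL] fpair_lim_support[OF F(2) fpair_fourier(1)[OF fL] G(1) W G(2)]
    by blast
qed

lemma closed_span_superset: "g \<in> S \<Longrightarrow> g \<in> L2 \<mu> \<Longrightarrow> g \<in> closed_span \<mu> S"
proof -
  assume g: "g \<in> S" "g \<in> L2 \<mu>"
  have "finite {g} \<and> {g} \<subseteq> S \<and> g = (\<lambda>x. \<Sum>h\<in>{g}. 1 * h x)" using g(1) by simp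
  then have "\<forall>n :: nat. \<exists>B a. finite B \<and> B \<subseteq> S \<and> g = (\<lambda>x. \<Sum>h\<in>B. a h * h x)"
    by (intro allI exI[of _ "{g}"] exI[of _ "\<lambda>_. 1"])
  moreover have "L2_lim \<mu> (\<lambda>_. g) g" using g(2) by (simp add: L2_lim_def L2_norm_def)
  ultimately show ?thesis
    unfolding closed_span_def mem_Collect_eq by (intro exI[of _ "\<lambda>_. g"] conjI)
qed

lemma fpair_disjoint_orthogonal:
  assumes "f \<in> L2 \<mu>" "fpair f f'" "g \<in> L2 \<mu>" "fpair g g'"
    and "AE x in \<mu>. f' x = 0 \<or> g' x = 0"
  shows "L2_inner \<mu> f g = 0"
proof -
  have "L2_inner \<mu> f g = L2_inner \<mu> f' g'" by (rule fpair_inner) (use assms in auto)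
  also have "\<dots> = 0"
    unfolding L2_inner_def by (rule integral_eq_zero_AE) (use assms(5) in \<open>eventually_elim, auto\<close>)
  finally show ?thesis .
qed

section \<open>Dilates that partition the field\<close>

lemma image_dilate: "(\<lambda>x. \<pp> powi j * x) ` W = (\<lambda>x. \<pp> powi (- j) * x) -` W"
proof (intro equalityI subsetI)
  fix y assume "y \<in> (\<lambda>x. \<pp> powi (- j) * x) -` W"
  then show "y \<in> (\<lambda>x. \<pp> powi j * x) ` W"
    by (intro image_eqI[of _ _ "\<pp> powi (- j) * y"]) auto
qed auto

lemma dilate_vimage_sets: "W \<in> sets borel \<Longrightarrow> (\<lambda>x. \<pp> powi j * x) -` W \<in> sets borel"
  using measurable_sets[OF measurable_lf_mult[of "\<pp> powi j"], of W] by simp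

lemma measurable_partition_dilates_iff:
  assumes W: "W \<in> sets borel"
  shows "measurable_partition \<mu> (UNIV :: int set) (\<lambda>j. (\<lambda>x. \<pp> powi j * x) ` W) UNIV
    \<longleftrightarrow> (AE x in \<mu>. \<exists>!j. \<pp> powi j * x \<in> W)"
proof -
  have A: "(\<lambda>x. \<pp> powi j * x) ` W \<in> sets \<mu>" for j
    unfolding image_dilate using dilate_vimage_sets[OF W] by simp
  have neg: "(\<forall>i j :: int. P (- i) \<longrightarrow> P (- j) \<longrightarrow> i = j) \<and> (\<exists>i. P (- i)) \<longleftrightarrow> (\<exists>!j. P j)" for P
    by (metis minus_minus)
  have ex1: "(\<forall>i j. \<pp> powi (- i) * x \<in> W \<longrightarrow> \<pp> powi (- j) * x \<in> W \<longrightarrow> i = j) \<and>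
      (\<exists>i. \<pp> powi (- i) * x \<in> W) \<longleftrightarrow> (\<exists>!j. \<pp> powi j * x \<in> W)" for x
    by (rule neg[of "\<lambda>j. \<pp> powi j * x \<in> W"])
  have "measurable_partition \<mu> UNIV (\<lambda>j. (\<lambda>x. \<pp> powi j * x) ` W) UNIV \<longleftrightarrow>
      (AE x in \<mu>. (\<forall>i j. \<pp> powi (- i) * x \<in> W \<longrightarrow> \<pp> powi (- j) * x \<in> W \<longrightarrow> i = j) \<and>
        (\<exists>i. \<pp> powi (- i) * x \<in> W))"
    by (subst measurable_partition_iff_AE[OF A]) (simp_all only: image_dilate vimage_eq, simp_all)
  then show ?thesis by (simp only: ex1)
qed

definition dilate_count :: "'a set \<Rightarrow> 'a \<Rightarrow> ennreal" where
  "dilate_count W x = (\<integral>\<^sup>+j. indicator W (\<pp> powi j * x) \<partial>count_space (UNIV :: int set))"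

lemma dilate_count_measurable [measurable]:
  assumes [measurable]: "W \<in> sets borel"
  shows "dilate_count W \<in> borel_measurable borel"
proof -
  have "dilate_count W x = (\<Sum>n. indicator W (\<pp> powi (int_decode n) * x))" for x
    unfolding dilate_count_def nn_integral_count_space_nat[symmetric]
    by (rule nn_integral_bij_count_space[OF bij_int_decode, symmetric])
  then have "dilate_count W = (\<lambda>x. \<Sum>n. indicator W (\<pp> powi (int_decode n) * x))" by blast
  then show ?thesis by simp
qed

lemma dilate_count_eq_1_iff: "dilate_count W x = 1 \<longleftrightarrow> (\<exists>!j. \<pp> powi j * x \<in> W)"
proof
  assume 1: "dilate_count W x = 1"
  have le: "(\<Sum>j\<in>J. indicator W (\<pp> powi j * x)) \<le> dilate_count W x" if "finite J" for J
  proof -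
    have "(\<Sum>j\<in>J. indicator W (\<pp> powi j * x)) = (\<integral>\<^sup>+j. indicator W (\<pp> powi j * x) \<partial>count_space J)"
      by (rule nn_integral_count_space_finite[symmetric, OF that])
    also have "\<dots> = (\<integral>\<^sup>+j. indicator W (\<pp> powi j * x) * indicator J j \<partial>count_space UNIV)"
      by (cases "J = UNIV") (simp_all add: nn_integral_count_space_indicator)
    also have "\<dots> \<le> dilate_count W x"
      unfolding dilate_count_def by (rule nn_integral_mono) (simp add: indicator_def)
    finally show ?thesis .
  qed
  have "\<exists>j. \<pp> powi j * x \<in> W"
  proof (rule ccontr)
    assume "\<nexists>j. \<pp> powi j * x \<in> W"
    then have "dilate_count W x = 0" by (simp add: dilate_count_def)
    with 1 show False by simp
  qed
  moreover have "i = j" if "\<pp> powi i * x \<in> W" "\<pp> powi j * x \<in> W" for i j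
  proof (rule ccontr)
    assume "i \<noteq> j"
    then have "(2 :: ennreal) \<le> 1" using le[of "{i, j}"] that 1 by simp
    then show False by simp
  qed
  ultimately show "\<exists>!j. \<pp> powi j * x \<in> W" by blast
next
  assume "\<exists>!j. \<pp> powi j * x \<in> W"
  then obtain j where j: "\<pp> powi j * x \<in> W" "\<And>i. \<pp> powi i * x \<in> W \<Longrightarrow> i = j" by blast
  have "dilate_count W x = (\<Sum>i\<in>{j}. indicator W (\<pp> powi i * x))"
    unfolding dilate_count_def
    by (rule nn_integral_count_space') (use j(2) in \<open>auto simp: indicator_def\<close>)
  then show "dilate_count W x = 1" using j(1) by simp
qed

end

section \<open>The characterization\<close>

locale disjoint_wavelet_sets = local_field_setup \<pp> c q \<epsilon> \<mu> chi
  for \<pp> :: "'a::local_field" and c q \<epsilon> \<mu> chi +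
  fixes M :: nat and \<psi> :: "nat \<Rightarrow> 'a \<Rightarrow> complex" and W :: "nat \<Rightarrow> 'a set"
  assumes psi: "\<And>m. m \<in> {1..M} \<Longrightarrow> \<psi> m \<in> L2 \<mu>"
    and W_sets: "\<And>m. m \<in> {1..M} \<Longrightarrow> W m \<in> sets \<mu>"
    and W_disjoint: "disjoint_family_on W {1..M}"
    and psi_hat: "\<And>m. m \<in> {1..M} \<Longrightarrow> AE \<xi> in \<mu>. cmod (fourier \<mu> chi (\<psi> m) \<xi>) = indicator (W m) \<xi>"
begin

abbreviation Wall :: "'a set" where "Wall \<equiv> \<Union>m\<in>{1..M}. W m"

lemma W_borel: "m \<in> {1..M} \<Longrightarrow> W m \<in> sets borel"
  using W_sets by simp

lemma Wall_borel [measurable]: "Wall \<in> sets borel"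
  using W_borel by auto

abbreviation coeff :: "('a \<Rightarrow> complex) \<Rightarrow> nat \<Rightarrow> int \<Rightarrow> nat \<Rightarrow> ennreal" where
  "coeff f m j k \<equiv> esq (L2_inner \<mu> f (dilation \<pp> q j (translation u k (\<psi> m))))"

lemma parseval_iff:
  "parseval_frame_multiwavelet \<mu> \<pp> q u M \<psi> \<longleftrightarrow>
    (\<forall>f\<in>L2 \<mu>. (\<Sum>m\<in>{1..M}. \<integral>\<^sup>+j. (\<Sum>k. coeff f m j k) \<partial>count_space UNIV) = ennreal ((L2_norm \<mu> f)\<^sup>2))"
proof -
  have "((\<lambda>(m, j, k). (cmod (L2_inner \<mu> f (dilation \<pp> q j (translation u k (\<psi> m)))))\<^sup>2)
      has_sum (L2_norm \<mu> f)\<^sup>2) ({1..M} \<times> (UNIV :: int set) \<times> (UNIV :: nat set))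
    \<longleftrightarrow> (\<Sum>m\<in>{1..M}. \<integral>\<^sup>+j. (\<Sum>k. coeff f m j k) \<partial>count_space UNIV) = ennreal ((L2_norm \<mu> f)\<^sup>2)" for f
    by (subst has_sum_nonneg_iff_nn_integral, simp add: case_prod_unfold, simp,
        subst nn_integral_count_space_triple) simp_all
  then show ?thesis using psi by (simp add: parseval_frame_multiwavelet_def)
qed

lemma indicator_Wall: "(indicator Wall x :: ennreal) = (\<Sum>m\<in>{1..M}. indicator (W m) x)"
  by (rule indicator_UN_disjoint[OF _ W_disjoint]) simp

text \<open>
  If the translates of each \<open>W m\<close> are disjoint, the sum over the translates is an integral over
  \<open>W m\<close>, and the total of all coefficients is the energy of \<open>f\<close> weighted by the number of dilates of
  \<open>W\<close> that contain a given point.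
\<close>

lemma sum_coeff:
  assumes p: "\<And>m. m \<in> {1..M} \<Longrightarrow> packs (W m)" and f: "f \<in> L2 \<mu>" "fpair f f'"
  shows "(\<Sum>m\<in>{1..M}. \<integral>\<^sup>+j. (\<Sum>k. coeff f m j k) \<partial>count_space UNIV)
    = (\<integral>\<^sup>+\<xi>. esq (f' \<xi>) * dilate_count Wall \<xi> \<partial>\<mu>)"
proof -
  have [measurable]: "f' \<in> borel_measurable borel"
    using fpair_loc_int(2)[OF f(2)] loc_int_measurable by blast
  let ?e = "\<lambda>\<xi>. esq (f' \<xi>)"
  have Wm: "(\<lambda>\<xi>. ?e \<xi> * indicator (W m) (\<pp> powi j * \<xi>)) \<in> borel_measurable borel" if "m \<in> {1..M}" for m j
  proof -
    have [measurable]: "W m \<in> sets borel" by (rule W_borel[OF that])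
    show ?thesis by measurable
  qed
  have "(\<Sum>m\<in>{1..M}. \<integral>\<^sup>+j. (\<Sum>k. coeff f m j k) \<partial>count_space UNIV)
      = (\<Sum>m\<in>{1..M}. \<integral>\<^sup>+j. \<integral>\<^sup>+\<xi>. ?e \<xi> * indicator (W m) (\<pp> powi j * \<xi>) \<partial>\<mu> \<partial>count_space UNIV)"
  proof (intro sum.cong refl nn_integral_cong)
    fix m j assume m: "m \<in> {1..M}"
    show "(\<Sum>k. coeff f m j k) = (\<integral>\<^sup>+\<xi>. ?e \<xi> * indicator (W m) (\<pp> powi j * \<xi>) \<partial>\<mu>)"
      by (rule sum_translates_dilation[OF f psi[OF m] fpair_fourier(1)[OF psi[OF m]] psi_hat[OF m] p[OF m] W_borel[OF m]])
  qed
  also have "\<dots> = (\<Sum>m\<in>{1..M}. \<integral>\<^sup>+\<xi>. \<integral>\<^sup>+j. ?e \<xi> * indicator (W m) (\<pp> powi j * \<xi>) \<partial>count_space UNIV \<partial>\<mu>)"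
    by (intro sum.cong refl nn_integral_count_space_nn_integral[symmetric]) (use Wm in auto)
  also have "\<dots> = (\<Sum>m\<in>{1..M}. \<integral>\<^sup>+\<xi>. ?e \<xi> * dilate_count (W m) \<xi> \<partial>\<mu>)"
    unfolding dilate_count_def by (simp add: nn_integral_cmult)
  also have "\<dots> = (\<integral>\<^sup>+\<xi>. (\<Sum>m\<in>{1..M}. ?e \<xi> * dilate_count (W m) \<xi>) \<partial>\<mu>)"
    by (rule nn_integral_sum[symmetric]) (use W_borel in \<open>auto intro!: borel_measurable_times\<close>)
  also have "\<dots> = (\<integral>\<^sup>+\<xi>. ?e \<xi> * dilate_count Wall \<xi> \<partial>\<mu>)"
  proof (rule nn_integral_cong)
    fix \<xi>
    have "(\<Sum>m\<in>{1..M}. dilate_count (W m) \<xi>) = dilate_count Wall \<xi>"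
      unfolding dilate_count_def indicator_Wall by (rule nn_integral_sum[symmetric]) simp
    then show "(\<Sum>m\<in>{1..M}. ?e \<xi> * dilate_count (W m) \<xi>) = ?e \<xi> * dilate_count Wall \<xi>"
      by (simp add: sum_distrib_left[symmetric])
  qed
  finally show ?thesis .
qed

text \<open>
  By surjectivity of the transform, the Parseval identity may be tested on functions whose
  transform is the indicator of a ball.
\<close>

lemma parseval_iff_dilates:
  assumes p: "\<And>m. m \<in> {1..M} \<Longrightarrow> packs (W m)"
  shows "parseval_frame_multiwavelet \<mu> \<pp> q u M \<psi> \<longleftrightarrow> (AE x in \<mu>. \<exists>!j. \<pp> powi j * x \<in> Wall)"
    (is "?P \<longleftrightarrow> ?R")
proof
  assume ?P
  interpret sigma_finite_measure \<mu> by (rule sigma_finite_mu)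
  define D where "D = dilate_count Wall"
  have [measurable]: "D \<in> borel_measurable borel"
    unfolding D_def by (rule dilate_count_measurable[OF Wall_borel])
  have "density \<mu> D = density \<mu> (\<lambda>_. 1)"
  proof (rule measure_eqI_pball)
    fix a n
    let ?g = "indicator (pball a n) :: 'a \<Rightarrow> complex"
    obtain f where f: "f \<in> L2 \<mu>" "fpair f ?g" using fpair_surj[OF indicator_pball_L2] by blast
    have ind: "esq (?g \<xi>) = indicator (pball a n) \<xi>" for \<xi>
      by (simp add: indicator_def)
    have "(\<integral>\<^sup>+\<xi>. indicator (pball a n) \<xi> * D \<xi> \<partial>\<mu>) = ennreal ((L2_norm \<mu> f)\<^sup>2)"
      using trans[OF sum_coeff[OF p f, symmetric] \<open>?P\<close>[unfolded parseval_iff, rule_format, OF f(1)]]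
      unfolding ind D_def .
    also have "\<dots> = (\<integral>\<^sup>+\<xi>. esq (?g \<xi>) \<partial>\<mu>)"
      using fpair_plancherel_nn[OF f(2)] nn_eq_L2_norm[OF f(1)] by simp
    also have "\<dots> = emeasure \<mu> (pball a n)" unfolding ind by simp
    finally have *: "emeasure (density \<mu> D) (pball a n) = emeasure \<mu> (pball a n)"
      by (subst emeasure_density) (simp_all add: mult.commute)
    then show "emeasure (density \<mu> D) (pball a n) = emeasure (density \<mu> (\<lambda>_. 1)) (pball a n)"
      by (simp add: density_1)
    show "emeasure (density \<mu> D) (pball a n) \<noteq> \<infinity>"
      using * by (simp add: emeasure_pball)
  qed simp_all
  then have "AE x in \<mu>. D x = 1" by (intro density_unique) simp_all
  then show ?R by (simp only: D_def dilate_count_eq_1_iff)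
next
  assume ?R
  then have 1: "AE x in \<mu>. dilate_count Wall x = 1" by (simp only: dilate_count_eq_1_iff)
  show ?P unfolding parseval_iff
  proof
    fix f assume f: "f \<in> L2 \<mu>"
    let ?f = "fourier \<mu> chi f"
    note pair = fpair_fourier(1)[OF f]
    have "(\<integral>\<^sup>+\<xi>. esq (?f \<xi>) * dilate_count Wall \<xi> \<partial>\<mu>) = (\<integral>\<^sup>+\<xi>. esq (?f \<xi>) \<partial>\<mu>)"
      by (rule nn_integral_cong_AE, use 1 in eventually_elim) simp
    also have "\<dots> = ennreal ((L2_norm \<mu> f)\<^sup>2)"
      using fpair_plancherel_nn[OF pair] nn_eq_L2_norm[OF f] by simp
    finally show "(\<Sum>m\<in>{1..M}. \<integral>\<^sup>+j. (\<Sum>k. coeff f m j k) \<partial>count_space UNIV) = ennreal ((L2_norm \<mu> f)\<^sup>2)"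
      by (simp only: sum_coeff[OF p f pair])
  qed
qed

abbreviation translates :: "('a \<Rightarrow> complex) set" where
  "translates \<equiv> {translation u k (\<psi> m) | k m. m \<in> {1..M}}"

text \<open>The transforms of \<open>D^i f\<close> and \<open>D^j g\<close> live on the almost disjoint sets \<open>\<pp>^(-i) * W\<close> and \<open>\<pp>^(-j) * W\<close>.\<close>

lemma semi_orthogonalI:
  assumes R: "AE x in \<mu>. \<exists>!j. \<pp> powi j * x \<in> Wall"
  shows "semi_orthogonal \<mu> \<pp> q u M \<psi>"
  unfolding semi_orthogonal_def Let_def
proof (intro allI impI ballI)
  fix i j :: int and f g
  assume ij: "i \<noteq> j" and f: "f \<in> closed_span \<mu> translates" and g: "g \<in> closed_span \<mu> translates"
  have S: "\<exists>h'. h \<in> L2 \<mu> \<and> fpair h h' \<and> (AE x in \<mu>. x \<notin> Wall \<longrightarrow> h' x = 0)" if h: "h \<in> translates" for h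
  proof -
    obtain k m where m: "m \<in> {1..M}" and h: "h = translation u k (\<psi> m)" using h by blast
    have "AE x in \<mu>. x \<notin> Wall \<longrightarrow> fourier \<mu> chi (\<psi> m) x * cnj (chi (u k * x)) = 0"
      using psi_hat[OF m] by eventually_elim (use m in auto)
    then show ?thesis
      using fpair_translation[OF fpair_fourier(1)[OF psi[OF m]], of k] translation_L2[OF psi[OF m], of k]
      unfolding h by blast
  qed
  obtain f' where f': "f \<in> L2 \<mu>" "fpair f f'" "AE x in \<mu>. x \<notin> Wall \<longrightarrow> f' x = 0"
    using closed_span_support[OF S Wall_borel f] by blast
  obtain g' where g': "g \<in> L2 \<mu>" "fpair g g'" "AE x in \<mu>. x \<notin> Wall \<longrightarrow> g' x = 0"
    using closed_span_support[OF S Wall_borel g] by blast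
  show "L2_inner \<mu> (dilation \<pp> q i f) (dilation \<pp> q j g) = 0"
  proof (rule fpair_disjoint_orthogonal[OF dilation_L2[OF f'(1)] fpair_dilation[OF f'(2)]
        dilation_L2[OF g'(1)] fpair_dilation[OF g'(2)]])
    show "AE x in \<mu>. complex_of_real (real q powr (- real_of_int i / 2)) * f' (\<pp> powi i * x) = 0
        \<or> complex_of_real (real q powr (- real_of_int j / 2)) * g' (\<pp> powi j * x) = 0"
      using R AE_dilate[OF f'(3), of i] AE_dilate[OF g'(3), of j]
    proof eventually_elim
      case (elim x)
      have "\<pp> powi i * x \<notin> Wall \<or> \<pp> powi j * x \<notin> Wall"
        using elim(1) ij by blast
      then show ?case using elim(2,3) by auto
    qed
  qed
qed

text \<open>
  For \<open>f = \<psi> m\<close> semi-orthogonality removes all scales but \<open>j = 0\<close>, and disjointness of the sets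
  \<open>W m'\<close> removes all generators but \<open>\<psi> m\<close> itself from the Parseval identity.
\<close>

lemma packs_if_parseval:
  assumes P: "parseval_frame_multiwavelet \<mu> \<pp> q u M \<psi>" and so: "semi_orthogonal \<mu> \<pp> q u M \<psi>"
    and m: "m \<in> {1..M}"
  shows "packs (W m)"
proof (rule packs_if_sum_translates[OF W_borel[OF m] psi[OF m] fpair_fourier(1)[OF psi[OF m]] psi_hat[OF m]])
  have mem: "translation u k (\<psi> n) \<in> closed_span \<mu> translates" if "n \<in> {1..M}" for n k
    using that translation_L2[OF psi[OF that], of k] by (intro closed_span_superset) blast+
  have scale: "coeff (\<psi> m) n j k = 0" if n: "n \<in> {1..M}" and j: "j \<noteq> 0" for n j k
  proof -
    have "L2_inner \<mu> (dilation \<pp> q 0 (translation u 0 (\<psi> m))) (dilation \<pp> q j (translation u k (\<psi> n))) = 0"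
      by (rule so[unfolded semi_orthogonal_def Let_def, rule_format,
            OF j[symmetric] mem[OF m] mem[OF n]])
    then show ?thesis by simp
  qed
  have gen: "coeff (\<psi> m) n 0 k = 0" if n: "n \<in> {1..M}" and nm: "n \<noteq> m" for n k
  proof -
    have "L2_inner \<mu> (\<psi> m) (translation u k (\<psi> n)) = 0"
    proof (rule fpair_disjoint_orthogonal[OF psi[OF m] fpair_fourier(1)[OF psi[OF m]]
          translation_L2[OF psi[OF n]] fpair_translation[OF fpair_fourier(1)[OF psi[OF n]]]])
      have dis: "W m \<inter> W n = {}" using W_disjoint m n nm by (auto simp: disjoint_family_on_def)
      show "AE x in \<mu>. fourier \<mu> chi (\<psi> m) x = 0 \<or> fourier \<mu> chi (\<psi> n) x * cnj (chi (u k * x)) = 0"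
        using psi_hat[OF m] psi_hat[OF n]
      proof eventually_elim
        case (elim x)
        have "x \<notin> W m \<or> x \<notin> W n" using dis by blast
        then show ?case using elim by auto
      qed
    qed
    then show ?thesis by simp
  qed
  have "ennreal ((L2_norm \<mu> (\<psi> m))\<^sup>2)
      = (\<Sum>n\<in>{1..M}. \<integral>\<^sup>+j. (\<Sum>k. coeff (\<psi> m) n j k) \<partial>count_space UNIV)"
    using P psi[OF m] unfolding parseval_iff by simp
  also have "\<dots> = (\<Sum>n\<in>{1..M}. \<Sum>k. coeff (\<psi> m) n 0 k)"
  proof (rule sum.cong[OF refl])
    fix n assume "n \<in> {1..M}"
    then have "(\<integral>\<^sup>+j. (\<Sum>k. coeff (\<psi> m) n j k) \<partial>count_space UNIV) = (\<Sum>j\<in>{0}. \<Sum>k. coeff (\<psi> m) n j k)"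
      by (intro nn_integral_count_space') (simp_all add: scale)
    then show "(\<integral>\<^sup>+j. (\<Sum>k. coeff (\<psi> m) n j k) \<partial>count_space UNIV) = (\<Sum>k. coeff (\<psi> m) n 0 k)" by simp
  qed
  also have "\<dots> = (\<Sum>n\<in>{m}. \<Sum>k. coeff (\<psi> m) n 0 k)"
    by (rule sum.mono_neutral_right) (use m gen in auto)
  finally show "(\<Sum>k. esq (L2_inner \<mu> (\<psi> m) (translation u k (\<psi> m)))) = ennreal ((L2_norm \<mu> (\<psi> m))\<^sup>2)"
    by simp
qed

lemma semi_orthogonal_parseval_iff:
  "parseval_frame_multiwavelet \<mu> \<pp> q u M \<psi> \<and> semi_orthogonal \<mu> \<pp> q u M \<psi> \<longleftrightarrow>
    (AE x in \<mu>. \<exists>!j. \<pp> powi j * x \<in> Wall) \<and> (\<forall>m\<in>{1..M}. packs (W m))"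
  using packs_if_parseval parseval_iff_dilates semi_orthogonalI by blast

end

theorem theorem3p3:
  fixes \<pp> :: "'a::local_field"
    and c q M :: nat
    and \<epsilon> :: "nat \<Rightarrow> 'a"
    and \<mu> :: "'a measure"
    and chi :: "'a \<Rightarrow> complex"
    and \<psi> :: "nat \<Rightarrow> 'a \<Rightarrow> complex"
    and W :: "nat \<Rightarrow> 'a set"
  assumes "local_field_setup \<pp> c q \<epsilon> \<mu> chi"
    and "1 \<le> M"
    and "\<And>m. m \<in> {1..M} \<Longrightarrow> \<psi> m \<in> L2 \<mu>"
    and "\<And>m. m \<in> {1..M} \<Longrightarrow> W m \<in> sets \<mu>"
    and "disjoint_family_on W {1..M}"
    and "\<And>m. m \<in> {1..M} \<Longrightarrow> AE \<xi> in \<mu>. cmod (fourier \<mu> chi (\<psi> m) \<xi>) = indicator (W m) \<xi>"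
  shows "parseval_frame_multiwavelet \<mu> \<pp> q (u_elem \<pp> c \<epsilon>) M \<psi> \<and>
         semi_orthogonal \<mu> \<pp> q (u_elem \<pp> c \<epsilon>) M \<psi> \<longleftrightarrow>
         measurable_partition \<mu> (UNIV :: int set)
           (\<lambda>j. (\<lambda>x. \<pp> powi j * x) ` (\<Union>m\<in>{1..M}. W m)) UNIV \<and>
         (\<forall>m\<in>{1..M}. \<exists>E. measurable_partition \<mu> (UNIV :: nat set)
           (\<lambda>k. (\<lambda>x. x + u_elem \<pp> c \<epsilon> k) ` W m) E)"
proof -
  interpret disjoint_wavelet_sets \<pp> c q \<epsilon> \<mu> chi M \<psi> W
    by (intro disjoint_wavelet_sets.intro disjoint_wavelet_sets_axioms.intro assms)
  show ?thesis
    unfolding semi_orthogonal_parseval_iff measurable_partition_dilates_iff[OF Wall_borel]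
    using measurable_partition_translates_iff[OF W_borel] by blast
qed

end
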